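(* Let $N\le 3$ and $m\ge 1$ be integers, let $H\in C^2(\mathbf{R}^m)$, and let $u=(u_i)_{i=1}^m:\mathbf{R}^N\to\mathbf{R}^m$ be a bounded $H$-monotone entire solution of the system $\Delta u=\nabla H(u)$ in $\mathbf{R}^N$. Then the level sets of each component $u_i$, $i=1,\dots,m$, are hyperplanes.
   Context: For $H\in C^2(\mathbf{R}^m)$, $H_{u_i}$ and $H_{u_iu_j}$ denote the first and second partial derivatives of $H$ with respect to its $i$-th (and $j$-th) variables. The system $\Delta u=\nabla H(u)$ means $\Delta u_i=H_{u_i}(u_1,\dots,u_m)$ for $i=1,\dots,m$; solutions are classical ($C^2$). When $H_{u_iu_j}$ appears next to functions of $x$ it is evaluated at $u(x)$. Points of $\mathbf{R}^N$ are written $x=(x',x_N)$, and $\partial_N=\partial/\partial x_N$. A solution $u=(u_k)_{k=1}^m$ is called $H$-monotone if: (1) for every $i\in\{1,\dots,m\}$, $u_i$ is strictly monotone in the $x_N$-variable, in the sense that $\partial_N u_i(x)\neq 0$ for all $x\in\mathbf{R}^N$; and (2) for all $1\le i<j\le m$, $H_{u_iu_j}(u(x))\,\partial_N u_i(x)\,\partial_N u_j(x)\le 0$ for all $x\in\mathbf{R}^N$. (Some components may be increasing and others decreasing in $x_N$.) *)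

theory Defs
  imports "HOL-Analysis.Analysis"
begin

definition partial_deriv :: "'n::finite \<Rightarrow> (real^'n \<Rightarrow> real) \<Rightarrow> real^'n \<Rightarrow> real" where
  "partial_deriv i f x = deriv (\<lambda>t::real. f (x + t *\<^sub>R axis i 1)) 0"

text \<open>\<open>C_k k f\<close>: the function is of class \<open>C\<^sup>k\<close> on the whole space. The existence of the partial
  derivatives is required explicitly, since \<^const>\<open>deriv\<close> is total.\<close>

primrec C_k :: "nat \<Rightarrow> (real^'n::finite \<Rightarrow> real) \<Rightarrow> bool" where
  "C_k 0 f \<longleftrightarrow> continuous_on UNIV f"
| "C_k (Suc k) f \<longleftrightarrow> continuous_on UNIV f \<and>
     (\<forall>i. (\<forall>x. (\<lambda>t::real. f (x + t *\<^sub>R axis i 1)) differentiable (at 0)) \<and>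
          C_k k (partial_deriv i f))"

definition laplacian :: "(real^'n::finite \<Rightarrow> real) \<Rightarrow> real^'n \<Rightarrow> real" where
  "laplacian f x = (\<Sum>j\<in>UNIV. partial_deriv j (partial_deriv j f) x)"

definition classical_solution :: "(real^'m::finite \<Rightarrow> real) \<Rightarrow> (real^'n::finite \<Rightarrow> real^'m) \<Rightarrow> bool" where
  "classical_solution H u \<longleftrightarrow>
     (\<forall>i. C_k 2 (\<lambda>x. u x $ i) \<and>
          (\<forall>x. laplacian (\<lambda>y. u y $ i) x = partial_deriv i H (u x)))"

text \<open>The coordinates are indexed by a finite linearly ordered type, so that the last coordinate
  \<open>x\<^sub>N\<close> is the one with the greatest index.\<close>

definition partial_last :: "(real^'n::{finite,linorder} \<Rightarrow> real) \<Rightarrow> real^'n::{finite,linorder} \<Rightarrow> real" where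
  "partial_last f = partial_deriv (Max UNIV) f"

definition H_monotone ::
  "(real^'m::{finite,linorder} \<Rightarrow> real) \<Rightarrow> (real^'n::{finite,linorder} \<Rightarrow> real^'m::{finite,linorder}) \<Rightarrow> bool" where
  "H_monotone H u \<longleftrightarrow>
     (\<forall>i x. partial_last (\<lambda>y. u y $ i) x \<noteq> 0) \<and>
     (\<forall>i j. i < j \<longrightarrow>
        (\<forall>x. partial_deriv j (partial_deriv i H) (u x) *
              partial_last (\<lambda>y. u y $ i) x * partial_last (\<lambda>y. u y $ j) x \<le> 0))"

definition hyperplane :: "'a::euclidean_space set \<Rightarrow> bool" where
  "hyperplane S \<longleftrightarrow> (\<exists>a b. a \<noteq> 0 \<and> S = {x. a \<bullet> x = b})"

end

theory Submission
  imports Defs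
begin

text \<open>Fix the direction \<open>N\<close>, write \<open>\<phi>\<^sub>i = \<partial>\<^sub>N u\<^sub>i\<close>, and for a second direction \<open>l\<close> write
  \<open>\<psi>\<^sub>i = \<partial>\<^sub>l u\<^sub>i\<close> and \<open>\<sigma>\<^sub>i = \<psi>\<^sub>i / \<phi>\<^sub>i\<close>. The aim is that every \<open>\<sigma>\<^sub>i\<close> is constant: then the gradient
  of \<open>u\<^sub>i\<close> is a scalar function without zeros times a constant vector, and the level sets of \<open>u\<^sub>i\<close>
  are hyperplanes. Both \<open>\<phi>\<close> and \<open>\<psi>\<close> solve the linearized system
  \<open>\<Delta> v\<^sub>i = (\<Sum>\<^sub>j H\<^sub>i\<^sub>j v\<^sub>j)\<close>, hence \<open>div (\<phi>\<^sub>i\<^sup>2 \<nabla>\<sigma>\<^sub>i) = (\<Sum>\<^sub>j H\<^sub>i\<^sub>j \<phi>\<^sub>i \<phi>\<^sub>j (\<sigma>\<^sub>j - \<sigma>\<^sub>i))\<close>. When this is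
  tested with functions \<open>G\<^sub>i\<close> that are ordered at every point in the same way as the \<open>\<sigma>\<^sub>i\<close>, the
  right-hand side, symmetrized in \<open>i\<close> and \<open>j\<close>, has a sign, because
  \<open>H\<^sub>i\<^sub>j \<phi>\<^sub>i \<phi>\<^sub>j \<le> 0\<close> for \<open>i \<noteq> j\<close> (lemma \<open>monotone_test\<close>). The system thus obeys the energy
  inequalities of a single equation \<open>div (\<phi>\<^sup>2 \<nabla>\<sigma>) = 0\<close>, for all test functions
  \<open>\<xi>\<^sup>2 \<beta> (\<mu> \<sigma>\<^sub>i)\<close> with \<open>\<beta>\<close> increasing and \<open>\<mu> > 0\<close> (lemma \<open>caccioppoli\<close>).

  With \<open>\<beta> s = s\<close> and \<open>\<mu> = 1\<close> the energy of \<open>\<sigma>\<close> is controlled by the integral of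
  \<open>\<psi>\<^sup>2 |\<nabla>\<xi>|\<^sup>2\<close>. A logarithmic cutoff then forces \<open>\<nabla>\<sigma> = 0\<close> as soon as the integral of \<open>\<psi>\<^sup>2\<close>
  over the box of size \<open>R\<close> is at most of order \<open>R\<^sup>2 ln R\<close> (lemma \<open>energy_zero\<close>). In three
  dimensions the boundedness of \<open>\<psi>\<close> gives only \<open>R\<^sup>3\<close>, and the rest of the proof gains the missing
  power (lemma \<open>direction_energy\<close>).

  The gain comes from cylinders of radius \<open>R\<close> and arbitrary height \<open>L\<close> around the \<open>N\<close>-axis. As
  \<open>\<phi>\<^sub>i\<close> has a sign and a bounded antiderivative in \<open>x\<^sub>N\<close>, its mass in the cylinder is of order
  \<open>R\<^sup>2\<close>, uniformly in \<open>L\<close> (lemma \<open>mass_bound\<close>). An integration by parts compares the mean of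
  \<open>\<psi>\<^sup>2\<close> over height \<open>R\<close> with the mean over height \<open>L\<close>; besides terms that \<open>mass_bound\<close> controls,
  it produces the flux \<open>\<phi>\<^sup>2 \<partial>\<^sub>l\<sigma>\<close>. Two facts finish the argument.

  First, for suitable large \<open>L\<close> the mean of \<open>|\<psi>|\<close> over the tall cylinder is of order \<open>1 / R\<close>
  (lemma \<open>tall_average\<close>). On a segment of length \<open>R\<close> in direction \<open>l\<close> the integral of \<open>\<psi>\<close> is
  bounded by the oscillation of \<open>u\<close>, so only changes of sign can make that of \<open>|\<psi>|\<close> large. These
  would need \<open>\<partial>\<^sub>l\<psi> / \<psi>\<close> to be large, whereas \<open>\<partial>\<^sub>l\<psi> / \<psi> = \<partial>\<^sub>l\<phi> / \<phi> + \<partial>\<^sub>l\<sigma> / \<sigma>\<close>, where \<open>\<nabla>\<phi> / \<phi>\<close>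
  is bounded in mean square and the energy of \<open>\<sigma>\<close> per unit of height is arbitrarily small in tall
  cylinders.

  Second, the integral of \<open>|\<phi>\<^sup>2 \<partial>\<^sub>l\<sigma>|\<close> over the cylinder is of order \<open>R ln R\<close>, uniformly in \<open>L\<close>
  (lemma \<open>flux_bound\<close>). This is the energy inequality for a \<open>\<beta>\<close> of logarithmic growth, with a
  majorant \<open>\<mu>\<close> of the \<open>|\<phi>\<^sub>i|\<close> that varies slowly at scale \<open>R\<close>: the choice bounds the error
  terms, up to logarithms, by the mass of \<open>\<phi>\<close> and a small multiple of that of \<open>\<mu>\<close>.\<close>

section \<open>Functions with a continuous gradient\<close>

text \<open>The gradient is carried along as a family of functions indexed by the coordinates, so that
  identities between partial derivatives are identities between real functions.\<close>

definition has_grad :: "(real^'n::finite \<Rightarrow> real) \<Rightarrow> ('n \<Rightarrow> real^'n \<Rightarrow> real) \<Rightarrow> bool" where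
  "has_grad f g \<longleftrightarrow> (\<forall>x. (f has_derivative (\<lambda>h. \<Sum>k\<in>UNIV. g k x * h $ k)) (at x)) \<and>
     (\<forall>k. continuous_on UNIV (g k))"

lemma has_grad_continuous: "has_grad f g \<Longrightarrow> continuous_on S f"
  unfolding has_grad_def
  by (meson continuous_at_imp_continuous_on has_derivative_continuous)

lemma has_grad_cont_grad: "has_grad f g \<Longrightarrow> continuous_on S (g k)"
  unfolding has_grad_def using continuous_on_subset by blast

lemma has_gradI:
  assumes "\<And>x. (f has_derivative (\<lambda>h. \<Sum>k\<in>UNIV. g k x * h $ k)) (at x)" "\<And>k. continuous_on UNIV (g k)"
  shows "has_grad f g"
  using assms unfolding has_grad_def by blast

lemma has_gradD: "has_grad f g \<Longrightarrow> (f has_derivative (\<lambda>h. \<Sum>k\<in>UNIV. g k x * h $ k)) (at x)"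
  unfolding has_grad_def by blast

lemma has_grad_const: "has_grad (\<lambda>x. c) (\<lambda>k x. 0)"
  by (rule has_gradI) auto

lemma has_grad_add:
  assumes "has_grad f f'" "has_grad g g'"
  shows "has_grad (\<lambda>x. f x + g x) (\<lambda>k x. f' k x + g' k x)"
proof (rule has_gradI)
  show "((\<lambda>x. f x + g x) has_derivative (\<lambda>h. \<Sum>k\<in>UNIV. (f' k x + g' k x) * h $ k)) (at x)" for x
    using has_derivative_add[OF has_gradD[OF assms(1)] has_gradD[OF assms(2)]]
    by (simp add: sum.distrib distrib_right)
qed (intro continuous_intros has_grad_cont_grad[OF assms(1)] has_grad_cont_grad[OF assms(2)])

lemma has_grad_mult:
  assumes "has_grad f f'" "has_grad g g'"
  shows "has_grad (\<lambda>x. f x * g x) (\<lambda>k x. f' k x * g x + f x * g' k x)"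
proof (rule has_gradI)
  show "((\<lambda>x. f x * g x) has_derivative (\<lambda>h. \<Sum>k\<in>UNIV. (f' k x * g x + f x * g' k x) * h $ k)) (at x)" for x
    by (rule has_derivative_eq_rhs[OF has_derivative_mult[OF has_gradD[OF assms(1)] has_gradD[OF assms(2)]]])
       (simp add: sum.distrib distrib_right sum_distrib_left sum_distrib_right algebra_simps)
qed (intro continuous_intros has_grad_cont_grad[OF assms(1)] has_grad_cont_grad[OF assms(2)]
       has_grad_continuous[OF assms(1)] has_grad_continuous[OF assms(2)])

lemma has_grad_sum:
  assumes "\<And>i. i \<in> A \<Longrightarrow> has_grad (f i) (f' i)" "finite A"
  shows "has_grad (\<lambda>x. \<Sum>i\<in>A. f i x) (\<lambda>k x. \<Sum>i\<in>A. f' i k x)"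
  using assms(2,1)
  by (induction rule: finite_induct) (auto intro!: has_grad_const has_grad_add)

lemma has_grad_compose:
  assumes "has_grad f f'" "\<And>x. (F has_real_derivative F' (f x)) (at (f x))" "continuous_on (range f) F'"
  shows "has_grad (\<lambda>x. F (f x)) (\<lambda>k x. F' (f x) * f' k x)"
proof (rule has_gradI)
  fix x
  show "((\<lambda>x. F (f x)) has_derivative (\<lambda>h. \<Sum>k\<in>UNIV. F' (f x) * f' k x * h $ k)) (at x)"
    using has_derivative_compose[OF has_gradD[OF assms(1), of x] assms(2)[of x, unfolded has_field_derivative_def]]
    by (simp add: sum_distrib_left mult.assoc)
next
  fix k
  show "continuous_on UNIV (\<lambda>x. F' (f x) * f' k x)"
    by (intro continuous_intros has_grad_cont_grad[OF assms(1)]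
         continuous_on_compose2[OF assms(3) has_grad_continuous[OF assms(1)]]) auto
qed

lemma has_grad_compose':
  assumes "has_grad f f'" "\<And>y. (F has_real_derivative F' y) (at y)" "continuous_on UNIV F'"
  shows "has_grad (\<lambda>x. F (f x)) (\<lambda>k x. F' (f x) * f' k x)"
  by (rule has_grad_compose[OF assms(1,2)]) (rule continuous_on_subset[OF assms(3)], simp)

lemma has_grad_cmult: "has_grad f f' \<Longrightarrow> has_grad (\<lambda>x. c * f x) (\<lambda>k x. c * f' k x)"
  using has_grad_mult[OF has_grad_const[of c], of f f'] by simp

lemma has_grad_diff:
  assumes "has_grad f f'" "has_grad g g'"
  shows "has_grad (\<lambda>x. f x - g x) (\<lambda>k x. f' k x - g' k x)"
  using has_grad_add[OF assms(1) has_grad_cmult[OF assms(2), of "-1"]] by simp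

lemma has_grad_inverse:
  assumes "has_grad f f'" "\<And>x. f x \<noteq> 0"
  shows "has_grad (\<lambda>x. inverse (f x)) (\<lambda>k x. - (f' k x) / (f x)^2)"
proof -
  have "has_grad (\<lambda>x. inverse (f x)) (\<lambda>k x. - (inverse (f x) * inverse (f x)) * f' k x)"
    by (rule has_grad_compose[OF assms(1), where F'="\<lambda>y. - (inverse y * inverse y)"])
       (auto intro!: derivative_eq_intros continuous_intros simp: assms(2) power2_eq_square)
  then show ?thesis by (simp add: divide_inverse power2_eq_square mult_ac)
qed

lemma has_grad_divide:
  assumes "has_grad f f'" "has_grad g g'" "\<And>x. g x \<noteq> 0"
  shows "has_grad (\<lambda>x. f x / g x) (\<lambda>k x. (f' k x * g x - f x * g' k x) / (g x)^2)"
proof -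
  have eq: "(\<lambda>k x. f' k x * inverse (g x) + f x * (- g' k x / (g x)\<^sup>2)) =
      (\<lambda>k x. (f' k x * g x - f x * g' k x) / (g x)^2)"
  proof (intro ext)
    fix k x
    show "f' k x * inverse (g x) + f x * (- g' k x / (g x)\<^sup>2) = (f' k x * g x - f x * g' k x) / (g x)^2"
      using assms(3)[of x] by (simp add: field_simps power2_eq_square)
  qed
  have "has_grad (\<lambda>x. f x * inverse (g x)) (\<lambda>k x. f' k x * inverse (g x) + f x * (- g' k x / (g x)\<^sup>2))"
    by (rule has_grad_mult[OF assms(1) has_grad_inverse[OF assms(2,3)]])
  then show ?thesis unfolding eq by (simp add: divide_inverse)
qed

lemma has_grad_shift:
  assumes "has_grad f f'" shows "has_grad (\<lambda>x. f (x + c)) (\<lambda>k x. f' k (x + c))"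
proof (rule has_gradI)
  fix x
  have "((\<lambda>x. x + c) has_derivative (\<lambda>h. h)) (at x)"
    by (auto intro!: derivative_eq_intros)
  from has_derivative_compose[OF this has_gradD[OF assms, of "x+c"]]
  show "((\<lambda>x. f (x + c)) has_derivative (\<lambda>h. \<Sum>k\<in>UNIV. f' k (x + c) * h $ k)) (at x)" by simp
next
  fix k show "continuous_on UNIV (\<lambda>x. f' k (x + c))"
    by (rule continuous_on_compose2[OF has_grad_cont_grad[OF assms, of UNIV k]]) (auto intro!: continuous_intros)
qed

lemma has_grad_nth: "has_grad (\<lambda>x::real^'n::finite. x $ i) (\<lambda>k x. if k = i then 1 else 0)"
proof (rule has_gradI)
  fix x :: "real^'n"
  have "((\<lambda>x. x $ i) has_derivative (\<lambda>h. h $ i)) (at x)"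
    by (rule bounded_linear.has_derivative[OF bounded_linear_vec_nth has_derivative_ident])
  moreover have "(\<Sum>k\<in>UNIV. (if k = i then 1 else 0) * h $ k) = h $ i" for h :: "real^'n"
    by (simp add: if_distrib[of "\<lambda>c. c * _"] cong: if_cong)
  ultimately show "((\<lambda>x. x $ i) has_derivative (\<lambda>h. \<Sum>k\<in>UNIV. (if k = i then 1 else 0) * h $ k)) (at x)"
    by simp
qed auto

lemma has_grad_line:
  assumes "has_grad f g"
  shows "((\<lambda>t. f (x + t *\<^sub>R v)) has_real_derivative (\<Sum>k\<in>UNIV. g k (x + t *\<^sub>R v) * v $ k)) (at t)"
proof -
  have "((\<lambda>t. x + t *\<^sub>R v) has_derivative (\<lambda>h. h *\<^sub>R v)) (at t)"
    by (auto intro!: derivative_eq_intros)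
  from has_derivative_compose[OF this has_gradD[OF assms]]
  show ?thesis unfolding has_field_derivative_def
    by (rule has_derivative_eq_rhs) (auto simp: fun_eq_iff sum_distrib_left mult_ac)
qed

lemma sum_axis: "(\<Sum>k\<in>UNIV. g k * axis i (1::real) $ k) = g (i::'n::finite)"
  by (simp add: axis_def if_distrib[of "\<lambda>c. _ * c"] cong: if_cong)

lemma has_grad_line_axis:
  assumes "has_grad f g"
  shows "((\<lambda>t. f (x + t *\<^sub>R axis i 1)) has_real_derivative g i (x + t *\<^sub>R axis i 1)) (at t)"
  using has_grad_line[OF assms, of x "axis i 1" t] by (simp add: sum_axis)

text \<open>Continuous partial derivatives imply differentiability: the increment is telescoped over
  the coordinates and the mean value theorem is applied in each.\<close>

lemma has_grad_partials:
  fixes f :: "real^'n::finite \<Rightarrow> real"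
  assumes d: "\<And>x i. ((\<lambda>t. f (x + t *\<^sub>R axis i 1)) has_real_derivative g i x) (at 0)"
    and c: "\<And>i. continuous_on UNIV (g i)"
  shows "has_grad f g"
proof (rule has_gradI[OF _ c])
  fix x
  have d': "((\<lambda>t. f (y + t *\<^sub>R axis i 1)) has_real_derivative g i (y + t *\<^sub>R axis i 1)) (at t)" for y i t
  proof -
    have "((\<lambda>s. f ((y + t *\<^sub>R axis i 1) + s *\<^sub>R axis i 1)) has_real_derivative g i (y + t *\<^sub>R axis i 1)) (at 0)"
      by (rule d)
    then have "((\<lambda>s. f (y + (s + t) *\<^sub>R axis i 1)) has_real_derivative g i (y + t *\<^sub>R axis i 1)) (at 0)"
      by (simp add: algebra_simps)
    then show ?thesis
      using DERIV_shift[of "\<lambda>t. f (y + t *\<^sub>R axis i 1)" _ 0 t] by simp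
  qed
  let ?L = "\<lambda>h::real^'n. \<Sum>k\<in>UNIV. g k x * h $ k"
  have lin: "bounded_linear ?L"
    by (intro bounded_linear_sum bounded_linear_const_mult bounded_linear_vec_nth)
  show "(f has_derivative ?L) (at x)"
  unfolding has_derivative_at LIM_eq
  proof (intro conjI lin allI impI)
    fix e :: real assume "e > 0"
    define e' where "e' = e / (2 * real CARD('n))"
    have "e' > 0" using \<open>e > 0\<close> by (simp add: e'_def)
    have "\<exists>s>0. \<forall>y. dist y x < s \<longrightarrow> \<bar>g i y - g i x\<bar> < e'" for i
      using c[of i] \<open>e' > 0\<close> unfolding continuous_on_iff dist_real_def by (metis UNIV_I dist_commute)
    then obtain s where s: "\<And>i. s i > 0" "\<And>i y. dist y x < s i \<Longrightarrow> \<bar>g i y - g i x\<bar> < e'" by metis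
    define \<delta> where "\<delta> = Min (range s)"
    have "\<delta> > 0" unfolding \<delta>_def using s(1) by simp
    have \<delta>: "\<bar>g i y - g i x\<bar> < e'" if "dist y x < \<delta>" for i y
      using s(2)[of y i] that Min_le[of "range s" "s i"] by (auto simp: \<delta>_def)
    define r where "r h S = (\<chi> i. if i \<in> S then h $ i else 0)" for h :: "real^'n" and S
    have rn: "norm (r h S) \<le> norm h" for h S
      unfolding r_def norm_vec_def L2_set_def by (intro real_sqrt_le_mono sum_mono) auto
    have *: "\<bar>f (x + r h S) - f x - (\<Sum>k\<in>S. g k x * h $ k)\<bar> \<le> e' * (\<Sum>k\<in>S. \<bar>h $ k\<bar>)"
      if "norm h < \<delta>" and "finite S" for h S
      using that(2)
    proof (induction S rule: finite_induct)
      case empty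
      have "r h {} = 0" by (simp add: r_def vec_eq_iff)
      then show ?case by simp
    next
      case (insert j S)
      let ?y = "x + r h S"
      have rr: "r h (insert j S) = r h S + (h $ j) *\<^sub>R axis j 1"
        using insert.hyps by (auto simp: r_def vec_eq_iff axis_def)
      have "\<exists>\<theta>. \<theta> \<in> {0..1} \<and> f (?y + (h $ j) *\<^sub>R axis j 1) - f ?y = h $ j * g j (?y + (\<theta> * h $ j) *\<^sub>R axis j 1)"
      proof -
        have "((\<lambda>t. f (?y + (t * h $ j) *\<^sub>R axis j 1)) has_real_derivative g j (?y + (t * h $ j) *\<^sub>R axis j 1) * h $ j) (at t)" for t
          by (rule DERIV_chain2[where f="\<lambda>t. f (?y + t *\<^sub>R axis j 1)" and g="\<lambda>t. t * h $ j", OF d'])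
             (auto intro!: derivative_eq_intros)
        then have "\<exists>z. z > 0 \<and> z < 1 \<and> f (?y + (1 * h $ j) *\<^sub>R axis j 1) - f (?y + (0 * h $ j) *\<^sub>R axis j 1) =
            (1 - 0) * (g j (?y + (z * h $ j) *\<^sub>R axis j 1) * h $ j)"
          by (intro MVT2) auto
        then obtain z where "z > 0" "z < 1" "f (?y + (1 * h $ j) *\<^sub>R axis j 1) - f (?y + (0 * h $ j) *\<^sub>R axis j 1) =
            (1 - 0) * (g j (?y + (z * h $ j) *\<^sub>R axis j 1) * h $ j)" by blast
        then show ?thesis by (intro exI[of _ z]) (auto simp: mult.commute)
      qed
      then obtain \<theta> where \<theta>: "\<theta> \<in> {0..1}" "f (?y + (h $ j) *\<^sub>R axis j 1) - f ?y = h $ j * g j (?y + (\<theta> * h $ j) *\<^sub>R axis j 1)"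
        by blast
      have "norm (r h S + (\<theta> * h $ j) *\<^sub>R axis j 1) \<le> norm h"
        unfolding r_def norm_vec_def L2_set_def
      proof (intro real_sqrt_le_mono sum_mono)
        fix i
        have "\<bar>\<theta> * h $ j\<bar> \<le> \<bar>h $ j\<bar>" using \<theta>(1) by (simp add: abs_mult mult_left_le_one_le)
        then show "(norm (((\<chi> i. if i \<in> S then h $ i else 0) + (\<theta> * h $ j) *\<^sub>R axis j 1) $ i))\<^sup>2 \<le> (norm (h $ i))\<^sup>2"
          using insert.hyps by (auto simp: axis_def abs_le_square_iff[symmetric] abs_mult)
      qed
      then have "\<bar>g j (?y + (\<theta> * h $ j) *\<^sub>R axis j 1) - g j x\<bar> < e'"
        using that(1) by (intro \<delta>) (simp add: dist_norm add.assoc)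
      then have "\<bar>h $ j * (g j (?y + (\<theta> * h $ j) *\<^sub>R axis j 1) - g j x)\<bar> \<le> \<bar>h $ j\<bar> * e'"
        unfolding abs_mult by (intro mult_left_mono) auto
      moreover have "f (x + r h (insert j S)) - f x - (\<Sum>k\<in>insert j S. g k x * h $ k) =
          h $ j * (g j (?y + (\<theta> * h $ j) *\<^sub>R axis j 1) - g j x) + (f ?y - f x - (\<Sum>k\<in>S. g k x * h $ k))"
        using insert.hyps \<theta>(2) unfolding rr by (simp add: algebra_simps)
      ultimately show ?case using insert by (simp add: algebra_simps)
    qed
    have rU: "r h UNIV = h" for h by (simp add: r_def vec_eq_iff)
    have "\<exists>s>0. \<forall>h. h \<noteq> 0 \<and> norm h < s \<longrightarrow> \<bar>f (x + h) - f x - ?L h\<bar> / norm h < e"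
    proof (intro exI[of _ \<delta>] conjI allI impI \<open>\<delta> > 0\<close>; elim conjE)
      fix h :: "real^'n" assume h: "h \<noteq> 0" "norm h < \<delta>"
      have "(\<Sum>k\<in>UNIV. \<bar>h $ k\<bar>) \<le> (\<Sum>k\<in>(UNIV::'n set). norm h)"
        by (intro sum_mono component_le_norm_cart)
      then have "e' * (\<Sum>k\<in>UNIV. \<bar>h $ k\<bar>) \<le> e' * (real CARD('n) * norm h)"
        using \<open>e' > 0\<close> by (intro mult_left_mono) auto
      also have "\<dots> = e / 2 * norm h" by (simp add: e'_def)
      finally have "\<bar>f (x + h) - f x - ?L h\<bar> \<le> e / 2 * norm h"
        using *[OF h(2) finite, of UNIV] unfolding rU by linarith
      also have "\<dots> < e * norm h" using h(1) \<open>e > 0\<close> by simp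
      finally show "\<bar>f (x + h) - f x - ?L h\<bar> / norm h < e" using h(1) by (simp add: divide_less_eq)
    qed
    then show "\<exists>s>0. \<forall>h. h \<noteq> 0 \<and> norm (h - 0) < s \<longrightarrow>
        norm (norm (f (x + h) - f x - ?L h) / norm h - 0) < e" by simp
  qed
qed

lemma C_k_Suc_has_grad:
  assumes "C_k (Suc k) f" shows "has_grad f (\<lambda>i. partial_deriv i f)"
proof (rule has_grad_partials)
  fix x i
  have "(\<lambda>t::real. f (x + t *\<^sub>R axis i 1)) differentiable (at 0)" using assms by auto
  then show "((\<lambda>t. f (x + t *\<^sub>R axis i 1)) has_real_derivative partial_deriv i f x) (at 0)"
    unfolding partial_deriv_def using DERIV_deriv_iff_real_differentiable by blast
next
  fix i
  have "C_k k (partial_deriv i f)" using assms by auto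
  then show "continuous_on UNIV (partial_deriv i f)" by (cases k) auto
qed

text \<open>Both mixed derivatives are limits of one second difference quotient, which is symmetric in the
  two directions.\<close>

lemma has_grad_symmetric:
  assumes f: "has_grad f g" and g: "\<And>i. has_grad (g i) (D i)"
  shows "D i k x = D k i x"
proof -
  have key: "\<exists>y. norm (y - x) \<le> 2 * s \<and> f (x + s *\<^sub>R axis i 1 + s *\<^sub>R axis k 1) - f (x + s *\<^sub>R axis i 1)
      - f (x + s *\<^sub>R axis k 1) + f x = s * s * D i k y" if "s > 0" for s i k
  proof -
    define F where "F t = f (x + s *\<^sub>R axis k 1 + t *\<^sub>R axis i 1) - f (x + t *\<^sub>R axis i 1)" for t
    have "(F has_real_derivative g i (x + s *\<^sub>R axis k 1 + t *\<^sub>R axis i 1) - g i (x + t *\<^sub>R axis i 1)) (at t)" for t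
      unfolding F_def by (intro DERIV_diff has_grad_line_axis[OF f])
    then have "\<exists>z. z > 0 \<and> z < s \<and> F s - F 0 =
       (s - 0) * (g i (x + s *\<^sub>R axis k 1 + z *\<^sub>R axis i 1) - g i (x + z *\<^sub>R axis i 1))"
      using that by (intro MVT2) auto
    then obtain z where z: "z > 0" "z < s" "F s - F 0 = s * (g i (x + z *\<^sub>R axis i 1 + s *\<^sub>R axis k 1) - g i (x + z *\<^sub>R axis i 1))"
      by (auto simp: algebra_simps)
    have "\<exists>w. w > 0 \<and> w < s \<and> g i (x + z *\<^sub>R axis i 1 + s *\<^sub>R axis k 1) - g i (x + z *\<^sub>R axis i 1 + 0 *\<^sub>R axis k 1) =
       (s - 0) * D i k (x + z *\<^sub>R axis i 1 + w *\<^sub>R axis k 1)"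
      using that has_grad_line_axis[OF g, of i "x + z *\<^sub>R axis i 1" k] by (intro MVT2) auto
    then obtain w where w: "w > 0" "w < s" "g i (x + z *\<^sub>R axis i 1 + s *\<^sub>R axis k 1) - g i (x + z *\<^sub>R axis i 1) =
       s * D i k (x + z *\<^sub>R axis i 1 + w *\<^sub>R axis k 1)" by auto
    have "norm (z *\<^sub>R axis i (1::real) + w *\<^sub>R axis k 1) \<le> norm (z *\<^sub>R axis i (1::real)) + norm (w *\<^sub>R axis k (1::real))"
      by (rule norm_triangle_ineq)
    also have "\<dots> \<le> 2 * s" using z w by (simp add: norm_axis_1)
    finally show ?thesis using z(3) w(3)
      by (intro exI[of _ "x + z *\<^sub>R axis i 1 + w *\<^sub>R axis k 1"]) (auto simp: F_def algebra_simps)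
  qed
  have lim: "((\<lambda>s. (f (x + s *\<^sub>R axis i 1 + s *\<^sub>R axis k 1) - f (x + s *\<^sub>R axis i 1)
      - f (x + s *\<^sub>R axis k 1) + f x) / (s * s)) \<longlongrightarrow> D i k x) (at_right 0)" for i k
  proof (rule tendstoI)
    fix e :: real assume "e > 0"
    have "continuous_on UNIV (D i k)" by (rule has_grad_cont_grad[OF g])
    then obtain d where d: "d > 0" "\<And>y. dist y x < d \<Longrightarrow> dist (D i k y) (D i k x) < e"
      using \<open>e > 0\<close> unfolding continuous_on_iff by (metis UNIV_I)
    have "\<forall>\<^sub>F s in at_right 0. s \<in> {0<..<d/2}"
      by (rule eventually_at_right_field[THEN iffD2]) (use d in \<open>auto intro: exI[of _ "d/2"]\<close>)
    then show "\<forall>\<^sub>F s in at_right 0. dist ((f (x + s *\<^sub>R axis i 1 + s *\<^sub>R axis k 1) - f (x + s *\<^sub>R axis i 1)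
      - f (x + s *\<^sub>R axis k 1) + f x) / (s * s)) (D i k x) < e"
    proof eventually_elim
      case (elim s)
      then obtain y where y: "norm (y - x) \<le> 2 * s" "f (x + s *\<^sub>R axis i 1 + s *\<^sub>R axis k 1) - f (x + s *\<^sub>R axis i 1)
      - f (x + s *\<^sub>R axis k 1) + f x = s * s * D i k y" using key[of s i k] by auto
      then show ?case using elim d(2)[of y] by (simp add: dist_norm)
    qed
  qed
  have "(\<lambda>s. (f (x + s *\<^sub>R axis i 1 + s *\<^sub>R axis k 1) - f (x + s *\<^sub>R axis i 1)
      - f (x + s *\<^sub>R axis k 1) + f x) / (s * s)) = (\<lambda>s. (f (x + s *\<^sub>R axis k 1 + s *\<^sub>R axis i 1) - f (x + s *\<^sub>R axis k 1)
      - f (x + s *\<^sub>R axis i 1) + f x) / (s * s))"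
    by (intro ext) (simp add: algebra_simps)
  with lim[of i k] lim[of k i] show ?thesis
    using tendsto_unique[of "at_right (0::real)"] by force
qed

section \<open>Integrals of continuous functions with bounded support\<close>

text \<open>Every integrand below is a cutoff times a continuous function. For this class
  integrability is automatic, and the Lebesgue integral is an integral over a box.\<close>

definition cc :: "('a::euclidean_space \<Rightarrow> real) \<Rightarrow> bool" where
  "cc f \<longleftrightarrow> continuous_on UNIV f \<and> bounded {x. f x \<noteq> 0}"

lemma ccI: "continuous_on UNIV f \<Longrightarrow> bounded B \<Longrightarrow> (\<And>x. x \<notin> B \<Longrightarrow> f x = 0) \<Longrightarrow> cc f"
  unfolding cc_def using bounded_subset[of B "{x. f x \<noteq> 0}"] by blast

lemma cc_cont: "cc f \<Longrightarrow> continuous_on S f"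
  unfolding cc_def by (meson continuous_on_subset subset_UNIV)

lemma cc_box:
  assumes "cc f" obtains a b where "\<And>x. x \<notin> cbox a b \<Longrightarrow> f x = 0"
proof -
  from assms have "bounded {x. f x \<noteq> 0}" by (simp add: cc_def)
  then obtain a where "{x. f x \<noteq> 0} \<subseteq> cbox (-a) a" by (rule bounded_subset_cbox_symmetric)
  then have "f x = 0" if "x \<notin> cbox (-a) a" for x using that by auto
  then show thesis by (rule that)
qed

lemma cc_integrable_cbox:
  assumes "continuous_on UNIV f" "\<And>x. x \<notin> cbox a b \<Longrightarrow> f x = 0"
  shows "integrable lborel (f::'a::euclidean_space \<Rightarrow> real)" "integral\<^sup>L lborel f = integral (cbox a b) f"
proof -
  have eq: "(\<lambda>x. indicator (cbox a b) x *\<^sub>R f x) = f"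
    using assms(2) by (auto simp: fun_eq_iff indicator_def)
  show *: "integrable lborel f"
    using borel_integrable_compact[OF compact_cbox continuous_on_subset[OF assms(1)], of a b] eq by simp
  have "integral\<^sup>L lborel f = integral UNIV f" using integral_lborel[OF *] by simp
  also have "\<dots> = integral (cbox a b) f"
  proof -
    have "(\<lambda>x. if x \<in> cbox a b then f x else 0) = f" using assms(2) by (auto simp: fun_eq_iff)
    then show ?thesis using integral_restrict_UNIV[of "cbox a b" f] by simp
  qed
  finally show "integral\<^sup>L lborel f = integral (cbox a b) f" .
qed

lemma cc_integrable: "cc f \<Longrightarrow> integrable lborel f"
proof -
  assume f: "cc f"
  then obtain a b where "\<And>x. x \<notin> cbox a b \<Longrightarrow> f x = 0" using cc_box by blast
  with cc_cont[OF f] show ?thesis by (rule cc_integrable_cbox(1))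
qed

lemma cc_mult_right: "cc f \<Longrightarrow> continuous_on UNIV g \<Longrightarrow> cc (\<lambda>x. f x * g x)"
  by (rule ccI[of _ "{x. f x \<noteq> 0}"]) (auto simp: cc_def intro!: continuous_intros)

lemma cc_mult_left: "cc f \<Longrightarrow> continuous_on UNIV g \<Longrightarrow> cc (\<lambda>x. g x * f x)"
  using cc_mult_right[of f g] by (simp add: mult.commute)

lemma cc_add: assumes "cc f" "cc g" shows "cc (\<lambda>x. f x + g x)"
proof (rule ccI)
  show "bounded ({x. f x \<noteq> 0} \<union> {x. g x \<noteq> 0})" using assms by (auto simp: cc_def)
qed (use assms in \<open>auto simp: cc_def intro!: continuous_intros\<close>)

lemma cc_cmult: "cc f \<Longrightarrow> cc (\<lambda>x. c * f x)"
  by (rule cc_mult_left) auto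

lemma cc_uminus: "cc f \<Longrightarrow> cc (\<lambda>x. - f x)"
  using cc_cmult[of f "-1"] by simp

lemma cc_diff: "cc f \<Longrightarrow> cc g \<Longrightarrow> cc (\<lambda>x. f x - g x)"
  using cc_add[of f "\<lambda>x. - g x"] cc_uminus[of g] by simp

lemma cc_zero: "cc (\<lambda>x. 0)" by (simp add: cc_def)

lemma cc_sum: "(\<And>i. i \<in> A \<Longrightarrow> cc (f i)) \<Longrightarrow> cc (\<lambda>x. \<Sum>i\<in>A. f i x)"
  by (induction A rule: infinite_finite_induct) (auto intro: cc_zero cc_add)

lemma cc_abs: "cc f \<Longrightarrow> cc (\<lambda>x. \<bar>f x\<bar>)"
  unfolding cc_def by (auto intro!: continuous_intros)

lemma cc_shift:
  assumes "cc f" shows "cc (\<lambda>x. f (x + c))"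
proof -
  have "{x. f (x + c) \<noteq> 0} = (\<lambda>x. - c + x) ` {x. f x \<noteq> 0}"
  proof (intro equalityI subsetI)
    fix x assume "x \<in> {x. f (x + c) \<noteq> 0}"
    then show "x \<in> (\<lambda>x. - c + x) ` {x. f x \<noteq> 0}" by (intro image_eqI[of _ _ "x + c"]) auto
  qed auto
  moreover have "continuous_on UNIV (\<lambda>x. f (x + c))"
    by (rule continuous_on_compose2[OF cc_cont[OF assms, of UNIV]]) (auto intro!: continuous_intros)
  ultimately show ?thesis using assms unfolding cc_def by (auto intro: bounded_translation bounded_translation_minus)
qed

lemma integral_shift:
  fixes f :: "'a::euclidean_space \<Rightarrow> real"
  assumes "cc f" shows "(\<integral>x. f (x + c) \<partial>lborel) = (\<integral>x. f x \<partial>lborel)"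
proof -
  have "(\<integral>x. f x \<partial>lborel) = (\<integral>x. f x \<partial>(distr lborel borel ((+) c)))"
    by (simp add: lborel_distr_plus)
  also have "\<dots> = (\<integral>x. f (c + x) \<partial>lborel)"
    by (rule integral_distr) (use borel_measurable_integrable[OF cc_integrable[OF assms]] in auto)
  finally show ?thesis by (simp add: add.commute)
qed

lemma cc_mono: "cc f \<Longrightarrow> cc g \<Longrightarrow> (\<And>x. f x \<le> g x) \<Longrightarrow> (\<integral>x. f x \<partial>lborel) \<le> (\<integral>x. g x \<partial>lborel)"
  by (rule integral_mono) (auto intro: cc_integrable)

lemma cc_nonneg: "(\<And>x. 0 \<le> (f x::real)) \<Longrightarrow> 0 \<le> (\<integral>x. f x \<partial>lborel)"
  by (intro integral_nonneg_AE) auto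

lemma integral_cc_add: "cc f \<Longrightarrow> cc g \<Longrightarrow> (\<integral>x. f x + g x \<partial>lborel) = (\<integral>x. f x \<partial>lborel) + (\<integral>x. g x \<partial>lborel)"
  by (rule Bochner_Integration.integral_add) (auto intro: cc_integrable)

lemma integral_cc_diff: "cc f \<Longrightarrow> cc g \<Longrightarrow> (\<integral>x. f x - g x \<partial>lborel) = (\<integral>x. f x \<partial>lborel) - (\<integral>x. g x \<partial>lborel)"
  by (rule Bochner_Integration.integral_diff) (auto intro: cc_integrable)

lemma integral_cc_sum: "(\<And>i. i \<in> A \<Longrightarrow> cc (f i)) \<Longrightarrow> (\<integral>x. (\<Sum>i\<in>A. f i x) \<partial>lborel) = (\<Sum>i\<in>A. (\<integral>x. f i x \<partial>lborel))"
  by (rule Bochner_Integration.integral_sum) (auto intro: cc_integrable)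

text \<open>The support condition confines the parameter integral to one box, where differentiation under
  the integral is available.\<close>

lemma leibniz_cc:
  fixes f :: "real \<Rightarrow> 'a::euclidean_space \<Rightarrow> real"
  assumes d: "\<And>t x. ((\<lambda>t. f t x) has_real_derivative f' t x) (at t)"
    and c': "continuous_on UNIV (\<lambda>(t,x). f' t x)"
    and c: "\<And>t. continuous_on UNIV (f t)"
    and B: "bounded B" "\<And>t x. \<bar>t\<bar> < 1 \<Longrightarrow> x \<notin> B \<Longrightarrow> f t x = 0"
  shows "((\<lambda>t. \<integral>x. f t x \<partial>lborel) has_real_derivative (\<integral>x. f' 0 x \<partial>lborel)) (at 0)"
proof -
  obtain a where a: "B \<subseteq> cbox (-a) a" by (rule bounded_subset_cbox_symmetric[OF B(1)])
  let ?U = "{-1<..<1::real}"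
  have z: "f t x = 0" if "t \<in> ?U" "x \<notin> cbox (-a) a" for t x
  proof -
    have "\<bar>t\<bar> < 1" using that(1) by auto
    moreover have "x \<notin> B" using that(2) a by blast
    ultimately show ?thesis by (rule B(2))
  qed
  have z': "f' 0 x = 0" if "x \<notin> cbox (-a) a" for x
  proof -
    have ev: "\<forall>\<^sub>F t in nhds 0. f t x = 0"
      using eventually_nhds_in_open[of ?U 0] z[OF _ that] by (auto elim: eventually_mono)
    have "((\<lambda>t. f t x) has_real_derivative 0) (at 0)"
      by (subst DERIV_cong_ev[OF refl ev refl]) simp
    then show ?thesis using DERIV_unique[OF d[of x 0]] by blast
  qed
  have c'0: "continuous_on UNIV (f' t)" for t
    by (rule continuous_on_compose2[OF c', of UNIV "\<lambda>x. (t, x)", simplified]) (auto intro!: continuous_intros)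
  have "((\<lambda>t. integral (cbox (-a) a) (f t)) has_field_derivative integral (cbox (-a) a) (f' 0)) (at 0 within ?U)"
  proof (rule leibniz_rule_field_derivative)
    show "continuous_on (?U \<times> cbox (-a) a) (\<lambda>(t,x). f' t x)"
      by (rule continuous_on_subset[OF c']) simp
    show "f t integrable_on cbox (-a) a" for t
      by (rule integrable_continuous[OF continuous_on_subset[OF c]]) simp
  qed (auto intro: d has_field_derivative_at_within)
  then have "((\<lambda>t. integral (cbox (-a) a) (f t)) has_field_derivative integral (cbox (-a) a) (f' 0)) (at 0)"
    by (simp add: at_within_open[of 0 ?U])
  then have D: "((\<lambda>t. integral (cbox (-a) a) (f t)) has_field_derivative (\<integral>x. f' 0 x \<partial>lborel)) (at 0)"
    using cc_integrable_cbox(2)[OF c'0 z'] by simp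
  have ev: "\<forall>\<^sub>F t in nhds 0. (\<integral>x. f t x \<partial>lborel) = integral (cbox (-a) a) (f t)"
    using eventually_nhds_in_open[of ?U 0] cc_integrable_cbox(2)[OF c z] by (auto elim: eventually_mono)
  show ?thesis
    by (subst DERIV_cong_ev[OF refl ev refl]) (rule D)
qed

lemma fubini_cc:
  fixes f :: "'a::euclidean_space \<Rightarrow> 'b::euclidean_space \<Rightarrow> real"
  assumes c: "continuous_on UNIV (\<lambda>(x,y). f x y)" and B: "bounded A" "bounded B"
    and z: "\<And>x y. x \<notin> A \<or> y \<notin> B \<Longrightarrow> f x y = 0"
  shows "(\<integral>x. (\<integral>y. f x y \<partial>lborel) \<partial>lborel) = (\<integral>y. (\<integral>x. f x y \<partial>lborel) \<partial>lborel)"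
    and "cc (\<lambda>x. \<integral>y. f x y \<partial>lborel)"
proof -
  obtain a where a: "A \<subseteq> cbox (-a) a" by (rule bounded_subset_cbox_symmetric[OF B(1)])
  obtain b where b: "B \<subseteq> cbox (-b) b" by (rule bounded_subset_cbox_symmetric[OF B(2)])
  have c1: "continuous_on UNIV (f x)" for x
    by (rule continuous_on_compose2[OF c, of UNIV "\<lambda>y. (x, y)", simplified]) (auto intro!: continuous_intros)
  have c2: "continuous_on UNIV (\<lambda>x. f x y)" for y
    by (rule continuous_on_compose2[OF c, of UNIV "\<lambda>x. (x, y)", simplified]) (auto intro!: continuous_intros)
  have i1: "(\<integral>y. f x y \<partial>lborel) = integral (cbox (-b) b) (f x)" for x
    by (rule cc_integrable_cbox(2)[OF c1]) (use z b in blast)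
  have i2: "(\<integral>x. f x y \<partial>lborel) = integral (cbox (-a) a) (\<lambda>x. f x y)" for y
    by (rule cc_integrable_cbox(2)[OF c2]) (use z a in blast)
  have k1: "continuous_on UNIV (\<lambda>x. integral (cbox (-b) b) (f x))"
    by (rule integral_continuous_on_param[OF continuous_on_subset[OF c]]) simp
  have c': "continuous_on UNIV (\<lambda>(y,x). f x y)"
    using continuous_on_compose2[OF c continuous_on_swap[of UNIV]] by (simp add: case_prod_beta prod.swap_def)
  have k2: "continuous_on UNIV (\<lambda>y. integral (cbox (-a) a) (\<lambda>x. f x y))"
    by (rule integral_continuous_on_param[OF continuous_on_subset[OF c']]) simp
  have z1: "integral (cbox (-b) b) (f x) = 0" if "x \<notin> cbox (-a) a" for x
    by (rule integral_unique, rule has_integral_is_0) (use z[of x] a that in blast)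
  have z2: "integral (cbox (-a) a) (\<lambda>x. f x y) = 0" if "y \<notin> cbox (-b) b" for y
    by (rule integral_unique, rule has_integral_is_0) (use z[of _ y] b that in blast)
  have "(\<integral>x. (\<integral>y. f x y \<partial>lborel) \<partial>lborel) = integral (cbox (-a) a) (\<lambda>x. integral (cbox (-b) b) (f x))"
    unfolding i1 by (rule cc_integrable_cbox(2)[OF k1 z1])
  also have "\<dots> = integral (cbox (-b) b) (\<lambda>y. integral (cbox (-a) a) (\<lambda>x. f x y))"
    by (rule integral_swap_continuous[OF continuous_on_subset[OF c]]) simp
  also have "\<dots> = (\<integral>y. (\<integral>x. f x y \<partial>lborel) \<partial>lborel)"
    unfolding i2 by (rule cc_integrable_cbox(2)[OF k2 z2, symmetric])
  finally show "(\<integral>x. (\<integral>y. f x y \<partial>lborel) \<partial>lborel) = (\<integral>y. (\<integral>x. f x y \<partial>lborel) \<partial>lborel)" .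
  show "cc (\<lambda>x. \<integral>y. f x y \<partial>lborel)"
    unfolding i1 by (rule ccI[OF k1 bounded_cbox z1])
qed

lemma cont_param_cc:
  fixes f :: "'a::euclidean_space \<Rightarrow> 'b::euclidean_space \<Rightarrow> real"
  assumes c: "continuous_on UNIV (\<lambda>(x,y). f x y)" and B: "bounded B"
    and z: "\<And>x y. y \<notin> B \<Longrightarrow> f x y = 0"
  shows "continuous_on UNIV (\<lambda>x. \<integral>y. f x y \<partial>lborel)"
proof -
  obtain b where b: "B \<subseteq> cbox (-b) b" by (rule bounded_subset_cbox_symmetric[OF B(1)])
  have c1: "continuous_on UNIV (f x)" for x
    by (rule continuous_on_compose2[OF c, of UNIV "\<lambda>y. (x, y)", simplified]) (auto intro!: continuous_intros)
  have i1: "(\<integral>y. f x y \<partial>lborel) = integral (cbox (-b) b) (f x)" for x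
    by (rule cc_integrable_cbox(2)[OF c1]) (use z b in blast)
  show ?thesis unfolding i1
    by (rule integral_continuous_on_param[OF continuous_on_subset[OF c]]) simp
qed

lemma has_grad_zero_outside:
  assumes "has_grad f g" "closed B" "\<And>x. x \<notin> B \<Longrightarrow> f x = 0" "x \<notin> B"
  shows "g k x = 0"
proof -
  have "open (-B)" using assms(2) by (simp add: open_Compl)
  then have "open ((\<lambda>t. x + t *\<^sub>R axis k (1::real)) -` (-B))"
    by (rule open_vimage) (intro continuous_intros)
  then have "\<forall>\<^sub>F t in nhds 0. t \<in> (\<lambda>t. x + t *\<^sub>R axis k (1::real)) -` (-B)"
    by (rule eventually_nhds_in_open) (use assms in auto)
  then have ev: "\<forall>\<^sub>F t in nhds 0. f (x + t *\<^sub>R axis k 1) = 0"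
    by (rule eventually_mono) (use assms in auto)
  have "((\<lambda>t. f (x + t *\<^sub>R axis k 1)) has_real_derivative 0) (at 0)"
    by (subst DERIV_cong_ev[OF refl ev refl]) simp
  then show ?thesis using DERIV_unique has_grad_line_axis[OF assms(1), of x k 0] by fastforce
qed

lemma has_grad_cc:
  assumes "has_grad f g" "bounded {x. f x \<noteq> 0}"
  shows "cc f" "cc (g k)"
proof -
  show "cc f" using assms has_grad_continuous[OF assms(1), of UNIV] by (simp add: cc_def)
  have "closed (closure {x. f x \<noteq> 0})" by simp
  from has_grad_zero_outside[OF assms(1) this] closure_subset[of "{x. f x \<noteq> 0}"]
  have "g k x = 0" if "x \<notin> closure {x. f x \<noteq> 0}" for x using that by blast
  then show "cc (g k)"
    by (intro ccI[OF has_grad_cont_grad[OF assms(1)] bounded_closure[OF assms(2)]])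
qed

text \<open>The integral does not change when the function is translated; its derivative with respect to the
  translation is the integral of the partial derivative.\<close>

lemma integral_grad_zero:
  assumes f: "has_grad f g" and b: "bounded {x. f x \<noteq> 0}"
  shows "(\<integral>x. g k x \<partial>lborel) = 0"
proof -
  obtain M where M: "\<And>x. f x \<noteq> 0 \<Longrightarrow> norm x \<le> M" using b unfolding bounded_iff by auto
  have "((\<lambda>t. \<integral>x. f (x + t *\<^sub>R axis k 1) \<partial>lborel) has_real_derivative (\<integral>x. g k (x + 0 *\<^sub>R axis k 1) \<partial>lborel)) (at 0)"
  proof (rule leibniz_cc[where B = "cball 0 (M+1)"])
    show "continuous_on UNIV (\<lambda>(t, x). g k (x + t *\<^sub>R axis k 1))"
      unfolding case_prod_beta
      by (rule continuous_on_compose2[OF has_grad_cont_grad[OF f, of UNIV k]]) (auto intro!: continuous_intros)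
    show "continuous_on UNIV (\<lambda>x. f (x + t *\<^sub>R axis k 1))" for t
      by (rule continuous_on_compose2[OF has_grad_continuous[OF f, of UNIV]]) (auto intro!: continuous_intros)
    show "f (x + t *\<^sub>R axis k 1) = 0" if "\<bar>t\<bar> < 1" "x \<notin> cball 0 (M+1)" for t x
    proof (rule ccontr)
      assume "f (x + t *\<^sub>R axis k 1) \<noteq> 0"
      then have "norm (x + t *\<^sub>R axis k 1) \<le> M" using M by blast
      moreover have "norm x \<le> norm (x + t *\<^sub>R axis k 1) + norm (t *\<^sub>R axis k (1::real))"
        using norm_triangle_ineq4[of "x + t *\<^sub>R axis k 1" "t *\<^sub>R axis k 1"] by simp
      ultimately show False using that by simp
    qed
  qed (auto intro: has_grad_line_axis[OF f])
  moreover have "(\<integral>x. f (x + t *\<^sub>R axis k 1) \<partial>lborel) = (\<integral>x. f x \<partial>lborel)" for t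
    by (rule integral_shift) (rule has_grad_cc(1)[OF f b])
  ultimately have "((\<lambda>t::real. \<integral>x. f x \<partial>lborel) has_real_derivative (\<integral>x. g k x \<partial>lborel)) (at 0)" by simp
  then show ?thesis using DERIV_unique DERIV_const by blast
qed

lemma integral_by_parts:
  assumes f: "has_grad f f'" and g: "has_grad g g'" and b: "bounded {x. f x \<noteq> 0}"
  shows "(\<integral>x. f' k x * g x \<partial>lborel) = - (\<integral>x. f x * g' k x \<partial>lborel)"
proof -
  have "bounded {x. f x * g x \<noteq> 0}" by (rule bounded_subset[OF b]) auto
  from integral_grad_zero[OF has_grad_mult[OF f g] this, of k]
  show ?thesis
    using has_grad_cc[OF f b] has_grad_cont_grad[OF g, of UNIV] has_grad_continuous[OF g, of UNIV]
    by (subst (asm) integral_cc_add) (auto intro!: cc_mult_right)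
qed

lemma cc_nonpos: "(\<And>x. (f x::real) \<le> 0) \<Longrightarrow> (\<integral>x. f x \<partial>lborel) \<le> 0"
  using cc_nonneg[of "\<lambda>x. - f x"] by simp

section \<open>The linearized system\<close>

lemma young_inequality: "\<bar>p * q\<bar> \<le> e / 4 * p^2 + q^2 / e" if "e > 0" for p q e :: real
proof -
  have "0 \<le> (e / 2 * \<bar>p\<bar> - \<bar>q\<bar>)^2" by simp
  then have "e * \<bar>p\<bar> * \<bar>q\<bar> \<le> e^2/4 * p^2 + q^2" by (simp add: power2_eq_square algebra_simps)
  then have "(e * \<bar>p\<bar> * \<bar>q\<bar>) / e \<le> (e^2/4 * p^2 + q^2) / e"
    using that by (intro divide_right_mono) auto
  moreover have "(e * \<bar>p\<bar> * \<bar>q\<bar>) / e = \<bar>p * q\<bar>" using that by (simp add: abs_mult)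
  moreover have "(e^2/4 * p^2 + q^2) / e = e / 4 * p^2 + q^2 / e"
    using that by (simp add: field_simps power2_eq_square)
  ultimately show ?thesis by simp
qed

text \<open>The linearized problem without \<open>H\<close>: \<open>P\<close> and \<open>D\<close> are the first and second derivatives of \<open>u\<close>,
  \<open>f\<close> stands for \<open>\<nabla>H (u)\<close> and \<open>c\<close> for the matrix of second derivatives of \<open>H\<close> at \<open>u\<close>.\<close>

locale monotone_system =
  fixes u :: "'m::finite \<Rightarrow> real^'n::finite \<Rightarrow> real"
    and P :: "'m \<Rightarrow> 'n \<Rightarrow> real^'n \<Rightarrow> real"
    and D :: "'m \<Rightarrow> 'n \<Rightarrow> 'n \<Rightarrow> real^'n \<Rightarrow> real"
    and f :: "'m \<Rightarrow> real^'n \<Rightarrow> real"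
    and c :: "'m \<Rightarrow> 'm \<Rightarrow> real^'n \<Rightarrow> real"
    and N :: 'n and U F \<Lambda> :: real
  assumes grad_u: "\<And>i. has_grad (u i) (P i)"
    and grad_P: "\<And>i k. has_grad (P i k) (D i k)"
    and D_sym: "\<And>i k l x. D i k l x = D i l k x"
    and equation: "\<And>i x. (\<Sum>k\<in>UNIV. D i k k x) = f i x"
    and grad_f: "\<And>i. has_grad (f i) (\<lambda>k x. \<Sum>j\<in>UNIV. c i j x * P j k x)"
    and cont_c: "\<And>i j. continuous_on UNIV (c i j)"
    and c_sym: "\<And>i j x. c i j x = c j i x"
    and c_bound: "\<And>i j x. \<bar>c i j x\<bar> \<le> \<Lambda>"
    and f_bound: "\<And>i x. \<bar>f i x\<bar> \<le> F"
    and u_bound: "\<And>i x. \<bar>u i x\<bar> \<le> U"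
    and monotone: "\<And>i x. P i N x \<noteq> 0"
    and coupling: "\<And>i j x. i \<noteq> j \<Longrightarrow> c i j x * P i N x * P j N x \<le> 0"
    and dim: "CARD('n) \<le> 3"
begin

lemma cont_P: "continuous_on S (P i k)" by (rule has_grad_continuous[OF grad_P])
lemma cont_D: "continuous_on S (D i k l)" by (rule has_grad_cont_grad[OF grad_P])
lemma cont_u: "continuous_on S (u i)" by (rule has_grad_continuous[OF grad_u])
lemma cont_f: "continuous_on S (f i)" by (rule has_grad_continuous[OF grad_f])

lemma U_nonneg: "0 \<le> U" using u_bound[of undefined undefined] by linarith
lemma \<Lambda>_nonneg: "0 \<le> \<Lambda>" using c_bound[of undefined undefined undefined] by linarith

text \<open>The translation by \<open>v\<close> serves as the parameter in which the equation is differentiated below.\<close>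

lemma weak_equation:
  assumes z: "has_grad \<zeta> \<zeta>'" and b: "bounded {x. \<zeta> x \<noteq> 0}"
  shows "(\<integral>x. (\<Sum>k\<in>UNIV. P i k (x + v) * \<zeta>' k x) + f i (x + v) * \<zeta> x \<partial>lborel) = 0"
proof -
  have "(\<integral>x. \<zeta>' k x * P i k (x + v) \<partial>lborel) = - (\<integral>x. \<zeta> x * D i k k (x + v) \<partial>lborel)" for k
    by (rule integral_by_parts[OF z has_grad_shift[OF grad_P] b])
  note parts = this
  note ccz = has_grad_cc[OF z b]
  have cs: "continuous_on UNIV (\<lambda>x. g (x + v))" if "continuous_on UNIV g" for g :: "real^'n \<Rightarrow> real"
    by (rule continuous_on_compose2[OF that]) (auto intro!: continuous_intros)
  have cc1: "cc (\<lambda>x. P i k (x + v) * \<zeta>' k x)" for k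
    by (rule cc_mult_left[OF ccz(2) cs[OF cont_P]])
  have cc2: "cc (\<lambda>x. D i k k (x + v) * \<zeta> x)" for k
    by (rule cc_mult_left[OF ccz(1) cs[OF cont_D]])
  have eq: "f i (x + v) * \<zeta> x = (\<Sum>k\<in>UNIV. D i k k (x + v) * \<zeta> x)" for x
    by (simp add: equation[symmetric] sum_distrib_right)
  have parts': "(\<integral>x. P i k (x + v) * \<zeta>' k x \<partial>lborel) = - (\<integral>x. D i k k (x + v) * \<zeta> x \<partial>lborel)" for k
    using parts[of k] by (simp add: mult.commute)
  have "(\<integral>x. (\<Sum>k\<in>UNIV. P i k (x + v) * \<zeta>' k x) + (\<Sum>k\<in>UNIV. D i k k (x + v) * \<zeta> x) \<partial>lborel)
      = (\<Sum>k\<in>UNIV. \<integral>x. P i k (x + v) * \<zeta>' k x \<partial>lborel) + (\<Sum>k\<in>UNIV. \<integral>x. D i k k (x + v) * \<zeta> x \<partial>lborel)"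
    by (simp add: integral_cc_add integral_cc_sum cc_sum cc1 cc2)
  then show ?thesis unfolding eq parts' by (simp add: sum_negf)
qed

text \<open>The functions \<open>P\<close> have only one continuous derivative, so that the linearized system has no
  classical meaning. Its weak form is the derivative of the weak equation with respect
  to a translation.\<close>

lemma weak_linearized:
  assumes z: "has_grad \<zeta> \<zeta>'" and b: "bounded {x. \<zeta> x \<noteq> 0}"
  shows "(\<integral>x. (\<Sum>k\<in>UNIV. D i m k x * \<zeta>' k x) \<partial>lborel) = - (\<integral>x. (\<Sum>j\<in>UNIV. c i j x * P j m x) * \<zeta> x \<partial>lborel)"
proof -
  note ccz = has_grad_cc[OF z b]
  let ?e = "axis m (1::real)"
  define g where "g t x = (\<Sum>k\<in>UNIV. P i k (x + t *\<^sub>R ?e) * \<zeta>' k x) + f i (x + t *\<^sub>R ?e) * \<zeta> x" for t x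
  define g' where "g' t x = (\<Sum>k\<in>UNIV. D i k m (x + t *\<^sub>R ?e) * \<zeta>' k x)
      + (\<Sum>j\<in>UNIV. c i j (x + t *\<^sub>R ?e) * P j m (x + t *\<^sub>R ?e)) * \<zeta> x" for t x
  have cs: "continuous_on UNIV (\<lambda>(t,x). h (x + t *\<^sub>R ?e))" if "continuous_on UNIV h" for h :: "real^'n \<Rightarrow> real"
    unfolding case_prod_beta by (rule continuous_on_compose2[OF that]) (auto intro!: continuous_intros)
  have cs2: "continuous_on UNIV (\<lambda>(t::real,x). h x)" if "continuous_on UNIV h" for h :: "real^'n \<Rightarrow> real"
    unfolding case_prod_beta by (rule continuous_on_compose2[OF that]) (auto intro!: continuous_intros)
  obtain M where M: "\<And>x. \<zeta> x \<noteq> 0 \<Longrightarrow> norm x \<le> M" using b unfolding bounded_iff by auto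
  have z0: "\<zeta> x = 0" if "x \<notin> cball 0 M" for x using M[of x] that by auto
  have "((\<lambda>t. \<integral>x. g t x \<partial>lborel) has_real_derivative (\<integral>x. g' 0 x \<partial>lborel)) (at 0)"
  proof (rule leibniz_cc[where B="cball 0 M"])
    show "((\<lambda>t. g t x) has_real_derivative g' t x) (at t)" for t x
      unfolding g_def g'_def
      by (intro DERIV_add DERIV_sum DERIV_cmult_right has_grad_line_axis[OF grad_P]
          has_grad_line_axis[OF grad_f, of i x m])
    show "continuous_on UNIV (\<lambda>(t, x). g' t x)"
      unfolding g'_def case_prod_beta
      by (intro continuous_intros cs[unfolded case_prod_beta, OF cont_D] cs[unfolded case_prod_beta, OF cont_P]
           cs[unfolded case_prod_beta, OF cont_c] cs2[unfolded case_prod_beta, OF cc_cont[OF ccz(1)]]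
           cs2[unfolded case_prod_beta, OF cc_cont[OF ccz(2)]])
    have cs1: "continuous_on UNIV (\<lambda>x. h (x + t *\<^sub>R ?e))" if "continuous_on UNIV h" for h :: "real^'n \<Rightarrow> real" and t
      by (rule continuous_on_compose2[OF that]) (auto intro!: continuous_intros)
    show "continuous_on UNIV (g t)" for t
      unfolding g_def
      by (intro continuous_intros cs1[OF cont_P] cs1[OF cont_f] cc_cont[OF ccz(1)] cc_cont[OF ccz(2)])
    show "g t x = 0" if "x \<notin> cball 0 M" for t x
      unfolding g_def using z0[OF that] has_grad_zero_outside[OF z closed_cball z0 that] by simp
  qed simp
  moreover have "(\<integral>x. g t x \<partial>lborel) = 0" for t
    unfolding g_def by (rule weak_equation[OF z b])
  ultimately have "(\<integral>x. g' 0 x \<partial>lborel) = 0"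
    using DERIV_unique[of "\<lambda>t. 0::real" "\<integral>x. g' 0 x \<partial>lborel" 0 0] by simp
  moreover have "(\<integral>x. g' 0 x \<partial>lborel) = (\<integral>x. (\<Sum>k\<in>UNIV. D i k m x * \<zeta>' k x) \<partial>lborel)
     + (\<integral>x. (\<Sum>j\<in>UNIV. c i j x * P j m x) * \<zeta> x \<partial>lborel)"
    unfolding g'_def using ccz by (subst integral_cc_add)
      (auto intro!: cc_sum cc_mult_left cont_D cont_P cont_c continuous_intros)
  ultimately show ?thesis by (simp add: D_sym[of i m])
qed

abbreviation "\<phi> i \<equiv> P i N"

end

text \<open>A second direction \<open>l\<close> is compared with \<open>N\<close> through the quotient \<open>\<sigma>\<close> of the two derivatives.
  The field \<open>W\<close> is \<open>\<phi>\<^sup>2 \<nabla>\<sigma>\<close>, the flux in the divergence form of the equation for \<open>\<sigma>\<close>.\<close>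

locale monotone_system_dir = monotone_system +
  fixes l :: 'b
  assumes l_ne: "l \<noteq> N"
begin

abbreviation "\<psi> i \<equiv> P i l"

definition "\<sigma> i x = \<psi> i x / \<phi> i x"
definition "W i k x = \<phi> i x * D i l k x - \<psi> i x * D i N k x"
definition "\<sigma>' i k x = W i k x / (\<phi> i x)^2"

lemma grad_\<sigma>: "has_grad (\<sigma> i) (\<sigma>' i)"
proof -
  have "(\<lambda>x. \<psi> i x / \<phi> i x) = \<sigma> i" by (simp add: \<sigma>_def fun_eq_iff)
  moreover have "(\<lambda>k x. (D i l k x * \<phi> i x - \<psi> i x * D i N k x) / (\<phi> i x)^2) = \<sigma>' i"
    by (simp add: \<sigma>'_def W_def fun_eq_iff mult.commute)
  ultimately show ?thesis
    using has_grad_divide[OF grad_P[of i l] grad_P[of i N] monotone] by simp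
qed

lemma cont_\<sigma>: "continuous_on S (\<sigma> i)" by (rule has_grad_continuous[OF grad_\<sigma>])
lemma cont_\<sigma>': "continuous_on S (\<sigma>' i k)" by (rule has_grad_cont_grad[OF grad_\<sigma>])
lemma cont_W: "continuous_on S (W i k)"
  unfolding W_def by (intro continuous_intros cont_P cont_D)
lemma W_eq: "W i k x = (\<phi> i x)^2 * \<sigma>' i k x" using monotone by (simp add: \<sigma>'_def)
lemma \<psi>_eq: "\<psi> i x = \<phi> i x * \<sigma> i x" using monotone by (simp add: \<sigma>_def fun_eq_iff)

text \<open>Subtract the linearized equation for \<open>\<phi>\<^sub>i\<close> tested with \<open>G\<^sub>i \<psi>\<^sub>i\<close> from the one for \<open>\<psi>\<^sub>i\<close> tested with
  \<open>G\<^sub>i \<phi>\<^sub>i\<close>: the gradient terms combine to \<open>W \<bullet> \<nabla>G\<close>. After summation over the components and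
  symmetrization, the coupling terms are \<open>c\<^sub>i\<^sub>j \<phi>\<^sub>i \<phi>\<^sub>j (\<sigma>\<^sub>i - \<sigma>\<^sub>j) (G\<^sub>i - G\<^sub>j) / 2\<close>, and these are
  nonpositive because \<open>G\<close> is ordered like \<open>\<sigma>\<close>.\<close>

lemma monotone_test:
  assumes G: "\<And>i. has_grad (G i) (G' i)" and b: "\<And>i. bounded {x. G i x \<noteq> 0}"
    and mono: "\<And>i j x. \<sigma> i x \<le> \<sigma> j x \<Longrightarrow> G i x \<le> G j x"
  shows "(\<Sum>i\<in>UNIV. \<integral>x. (\<Sum>k\<in>UNIV. W i k x * G' i k x) \<partial>lborel) \<le> 0"
proof -
  note ccG = has_grad_cc[OF G b]
  have b1: "bounded {x. G i x * P j k x \<noteq> 0}" for i j k by (rule bounded_subset[OF b[of i]]) auto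
  let ?A = "\<lambda>i x. \<Sum>k\<in>UNIV. D i l k x * (G' i k x * \<phi> i x + G i x * D i N k x)"
  let ?B = "\<lambda>i x. \<Sum>k\<in>UNIV. D i N k x * (G' i k x * \<psi> i x + G i x * D i l k x)"
  let ?a = "\<lambda>i x. (\<Sum>j\<in>UNIV. c i j x * \<psi> j x) * (G i x * \<phi> i x)"
  let ?b = "\<lambda>i x. (\<Sum>j\<in>UNIV. c i j x * \<phi> j x) * (G i x * \<psi> i x)"
  have ccA: "cc (?A i)" "cc (?B i)" "cc (?a i)" "cc (?b i)" for i
    by (intro cc_sum cc_mult_left cc_mult_right cc_add ccG continuous_intros cont_P cont_D cont_c)+
  have WG: "(\<Sum>k\<in>UNIV. W i k x * G' i k x) = ?A i x - ?B i x" for i x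
    unfolding sum_subtractf[symmetric] W_def by (intro sum.cong) (auto simp: algebra_simps)
  have "(\<integral>x. (\<Sum>k\<in>UNIV. W i k x * G' i k x) \<partial>lborel) = (\<integral>x. ?b i x - ?a i x \<partial>lborel)" for i
    unfolding WG using weak_linearized[OF has_grad_mult[OF G[of i] grad_P[of i N]] b1, of i l]
      weak_linearized[OF has_grad_mult[OF G[of i] grad_P[of i l]] b1, of i N]
    by (simp add: integral_cc_diff ccA)
  then have "(\<Sum>i\<in>UNIV. \<integral>x. (\<Sum>k\<in>UNIV. W i k x * G' i k x) \<partial>lborel) = (\<integral>x. (\<Sum>i\<in>UNIV. ?b i x - ?a i x) \<partial>lborel)"
    by (simp add: integral_cc_sum cc_diff ccA)
  also have "\<dots> \<le> 0"
  proof (rule cc_nonpos)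
    fix x
    let ?h = "\<lambda>i j. c i j x * \<phi> i x * \<phi> j x * (\<sigma> i x - \<sigma> j x) * G i x"
    have 1: "?b i x - ?a i x = (\<Sum>j\<in>UNIV. ?h i j)" for i
      unfolding sum_distrib_right sum_subtractf[symmetric]
      by (intro sum.cong) (auto simp: \<psi>_eq algebra_simps)
    have "(\<Sum>i\<in>UNIV. \<Sum>j\<in>UNIV. ?h i j) = (\<Sum>i\<in>UNIV. \<Sum>j\<in>UNIV. ?h j i)" by (rule sum.swap)
    then have "2 * (\<Sum>i\<in>UNIV. \<Sum>j\<in>UNIV. ?h i j) = (\<Sum>i\<in>UNIV. \<Sum>j\<in>UNIV. ?h i j + ?h j i)"
      by (simp add: sum.distrib)
    also have "\<dots> \<le> 0"
    proof (intro sum_nonpos)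
      fix i j
      have "?h i j + ?h j i = (c i j x * \<phi> i x * \<phi> j x) * ((\<sigma> i x - \<sigma> j x) * (G i x - G j x))"
        by (simp add: c_sym[of j i] algebra_simps)
      also have "\<dots> \<le> 0"
      proof (cases "i = j")
        case False
        have "0 \<le> (\<sigma> i x - \<sigma> j x) * (G i x - G j x)"
          using mono[of i x j] mono[of j x i] by (cases "\<sigma> i x \<le> \<sigma> j x") (auto intro: mult_nonneg_nonneg mult_nonpos_nonpos)
        then show ?thesis using coupling[OF False] by (rule mult_nonpos_nonneg[rotated])
      qed simp
      finally show "?h i j + ?h j i \<le> 0" .
    qed
    finally show "(\<Sum>i\<in>UNIV. ?b i x - ?a i x) \<le> 0" unfolding 1 by simp
  qed
  finally show ?thesis .
qed

text \<open>The test function \<open>\<xi>\<^sup>2 \<beta> (\<mu> \<sigma>\<^sub>i)\<close> is ordered like \<open>\<sigma>\<^sub>i\<close> since \<open>\<mu>\<close> is positive and does not depend on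
  \<open>i\<close>. Its gradient contains \<open>\<xi>\<^sup>2 \<beta>' \<mu> \<nabla>\<sigma>\<close>, which gives the energy; the derivatives that fall on \<open>\<xi>\<close>
  and on \<open>\<mu>\<close> are absorbed by Young's inequality.\<close>

lemma caccioppoli:
  assumes chi: "has_grad \<xi> \<xi>'" "bounded {x. \<xi> x \<noteq> 0}"
    and mu: "has_grad \<mu> \<mu>'" "\<And>x. \<mu> x > 0"
    and beta: "\<And>s. (\<beta> has_real_derivative \<beta>' s) (at s)" "continuous_on UNIV \<beta>'" "\<And>s. \<beta>' s > 0"
  shows "(\<Sum>i\<in>UNIV. \<integral>x. (\<xi> x)^2 * \<beta>' (\<mu> x * \<sigma> i x) * \<mu> x * (\<phi> i x)^2 * (\<Sum>k\<in>UNIV. (\<sigma>' i k x)^2) \<partial>lborel)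
    \<le> (\<Sum>i\<in>UNIV. \<integral>x. (\<phi> i x)^2 / \<mu> x * (8 * (\<beta> (\<mu> x * \<sigma> i x))^2 / \<beta>' (\<mu> x * \<sigma> i x) * (\<Sum>k\<in>UNIV. (\<xi>' k x)^2)
        + 2 * (\<xi> x)^2 * \<beta>' (\<mu> x * \<sigma> i x) * (\<mu> x * \<sigma> i x)^2 * (\<Sum>k\<in>UNIV. (\<mu>' k x / \<mu> x)^2)) \<partial>lborel)"
    (is "(\<Sum>i\<in>UNIV. \<integral>x. ?L i x \<partial>lborel) \<le> (\<Sum>i\<in>UNIV. \<integral>x. ?R i x \<partial>lborel)")
proof -
  let ?t = "\<lambda>i x. \<mu> x * \<sigma> i x"
  define G where "G i x = \<xi> x * \<xi> x * \<beta> (?t i x)" for i x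
  define G' where "G' i k x = (\<xi>' k x * \<xi> x + \<xi> x * \<xi>' k x) * \<beta> (?t i x)
     + \<xi> x * \<xi> x * (\<beta>' (?t i x) * (\<mu>' k x * \<sigma> i x + \<mu> x * \<sigma>' i k x))" for i k x
  have G: "has_grad (G i) (G' i)" for i
    unfolding G_def G'_def
    by (intro has_grad_mult chi has_grad_compose'[OF _ beta(1,2)] mu grad_\<sigma>)
  have bG: "bounded {x. G i x \<noteq> 0}" for i
    by (rule bounded_subset[OF chi(2)]) (auto simp: G_def)
  have mb: "\<beta> a \<le> \<beta> b" if "a \<le> b" for a b
    using that beta(1,3) by (metis DERIV_nonneg_imp_nondecreasing less_eq_real_def)
  have mono: "G i x \<le> G j x" if "\<sigma> i x \<le> \<sigma> j x" for i j x
    unfolding G_def using that mu(2)[of x] by (intro mult_left_mono mb) auto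
  have test: "(\<Sum>i\<in>UNIV. \<integral>x. (\<Sum>k\<in>UNIV. W i k x * G' i k x) \<partial>lborel) \<le> 0"
    by (rule monotone_test[OF G bG mono])
  have contb: "continuous_on UNIV \<beta>" using beta(1)
    by (meson DERIV_isCont continuous_at_imp_continuous_on)
  have ct: "continuous_on UNIV (?t i)" for i
    by (intro continuous_intros has_grad_continuous[OF mu(1)] cont_\<sigma>)
  have cb: "continuous_on UNIV (\<lambda>x. \<beta> (?t i x))" "continuous_on UNIV (\<lambda>x. \<beta>' (?t i x))" for i
    by (rule continuous_on_compose2[OF contb ct] continuous_on_compose2[OF beta(2) ct]; simp)+
  note ccc = has_grad_cc[OF chi]
  have ne: "\<mu> x \<noteq> 0" "\<beta>' s \<noteq> 0" for x s using mu(2)[of x] beta(3)[of s] by auto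
  have ccL: "cc (?L i)" for i
    unfolding power2_eq_square
    by (intro cc_mult_right cc_mult_left ccc cc_cont[OF ccc(1)] continuous_intros cb has_grad_continuous[OF mu(1)] cont_P cont_\<sigma>')
  have ccR: "cc (?R i)" for i
    unfolding power2_eq_square
    by (intro cc_mult_left cc_add cc_sum cc_mult_right ccc cc_cont[OF ccc(1)] cc_cont[OF ccc(2)] continuous_intros cb
         has_grad_continuous[OF mu(1)] has_grad_cont_grad[OF mu(1)] cont_P cont_\<sigma>) (auto simp: ne)
  have ccT: "cc (\<lambda>x. \<Sum>k\<in>UNIV. W i k x * G' i k x)" for i
    by (intro cc_sum cc_mult_left has_grad_cc[OF G bG] cont_W)
  have pt: "?L i x / 2 - ?R i x / 2 \<le> (\<Sum>k\<in>UNIV. W i k x * G' i k x)" for i x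
  proof -
    let ?b = "\<beta> (?t i x)" and ?b' = "\<beta>' (?t i x)" and ?m = "\<mu> x" and ?p = "(\<phi> i x)^2"
    have pk: "(\<xi> x)^2 * ?b' * ?m * ?p * (\<sigma>' i k x)^2 / 2
        - (?p / ?m * (8 * ?b^2 / ?b' * (\<xi>' k x)^2 + 2 * (\<xi> x)^2 * ?b' * (?t i x)^2 * (\<mu>' k x / ?m)^2)) / 2
        \<le> W i k x * G' i k x" for k
    proof -
      \<comment> \<open>The weights let each of the two error terms consume a quarter of the main term.\<close>
      have y1: "\<bar>(\<xi> x * \<sigma>' i k x) * (2 * ?b * \<xi>' k x)\<bar> \<le> (?b' * ?m) / 4 * (\<xi> x * \<sigma>' i k x)^2 + (2 * ?b * \<xi>' k x)^2 / (?b' * ?m)"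
        by (rule young_inequality) (simp add: beta(3) mu(2))
      have y2: "\<bar>(\<sigma>' i k x) * (\<mu>' k x * \<sigma> i x)\<bar> \<le> ?m / 4 * (\<sigma>' i k x)^2 + (\<mu>' k x * \<sigma> i x)^2 / ?m"
        by (rule young_inequality) (simp add: beta(3) mu(2))
      have y3: "(\<xi> x)^2 * ?b' * \<bar>(\<sigma>' i k x) * (\<mu>' k x * \<sigma> i x)\<bar> \<le> (\<xi> x)^2 * ?b' * (?m / 4 * (\<sigma>' i k x)^2 + (\<mu>' k x * \<sigma> i x)^2 / ?m)"
        by (rule mult_left_mono[OF y2]) (simp add: less_imp_le[OF beta(3)])
      have "W i k x * G' i k x = ?p * ((\<xi> x * \<sigma>' i k x) * (2 * ?b * \<xi>' k x) + (\<xi> x)^2 * ?b' * ((\<sigma>' i k x) * (\<mu>' k x * \<sigma> i x))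
          + (\<xi> x)^2 * ?b' * ?m * (\<sigma>' i k x)^2)"
        unfolding W_eq G'_def by (simp add: power2_eq_square algebra_simps)
      moreover have "(\<xi> x * \<sigma>' i k x) * (2 * ?b * \<xi>' k x) + (\<xi> x)^2 * ?b' * ((\<sigma>' i k x) * (\<mu>' k x * \<sigma> i x)) + (\<xi> x)^2 * ?b' * ?m * (\<sigma>' i k x)^2
          \<ge> (\<xi> x)^2 * ?b' * ?m * (\<sigma>' i k x)^2 - ((?b' * ?m) / 4 * (\<xi> x * \<sigma>' i k x)^2 + (2 * ?b * \<xi>' k x)^2 / (?b' * ?m))
            - (\<xi> x)^2 * ?b' * (?m / 4 * (\<sigma>' i k x)^2 + (\<mu>' k x * \<sigma> i x)^2 / ?m)"
      proof -
        have "\<bar>(\<xi> x)^2 * ?b' * ((\<sigma>' i k x) * (\<mu>' k x * \<sigma> i x))\<bar> = (\<xi> x)^2 * ?b' * \<bar>(\<sigma>' i k x) * (\<mu>' k x * \<sigma> i x)\<bar>"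
          using beta(3)[of "?t i x"] by (simp add: abs_mult)
        then show ?thesis using y1 y3 by (auto simp: abs_le_iff)
      qed
      ultimately have "W i k x * G' i k x \<ge> ?p * ((\<xi> x)^2 * ?b' * ?m * (\<sigma>' i k x)^2 - ((?b' * ?m) / 4 * (\<xi> x * \<sigma>' i k x)^2 + (2 * ?b * \<xi>' k x)^2 / (?b' * ?m))
            - (\<xi> x)^2 * ?b' * (?m / 4 * (\<sigma>' i k x)^2 + (\<mu>' k x * \<sigma> i x)^2 / ?m))"
        by (metis mult_left_mono zero_le_power2)
      also have "?p * ((\<xi> x)^2 * ?b' * ?m * (\<sigma>' i k x)^2 - ((?b' * ?m) / 4 * (\<xi> x * \<sigma>' i k x)^2 + (2 * ?b * \<xi>' k x)^2 / (?b' * ?m))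
            - (\<xi> x)^2 * ?b' * (?m / 4 * (\<sigma>' i k x)^2 + (\<mu>' k x * \<sigma> i x)^2 / ?m))
         = (\<xi> x)^2 * ?b' * ?m * ?p * (\<sigma>' i k x)^2 / 2
        - (?p / ?m * (8 * ?b^2 / ?b' * (\<xi>' k x)^2 + 2 * (\<xi> x)^2 * ?b' * (?t i x)^2 * (\<mu>' k x / ?m)^2)) / 2"
        using ne(1)[of x] ne(2)[of "?t i x"] by (simp add: field_simps power2_eq_square)
      finally show ?thesis .
    qed
    have "(\<Sum>k\<in>UNIV. (\<xi> x)^2 * ?b' * ?m * ?p * (\<sigma>' i k x)^2 / 2
        - (?p / ?m * (8 * ?b^2 / ?b' * (\<xi>' k x)^2 + 2 * (\<xi> x)^2 * ?b' * (?t i x)^2 * (\<mu>' k x / ?m)^2)) / 2)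
        \<le> (\<Sum>k\<in>UNIV. W i k x * G' i k x)" by (intro sum_mono pk)
    then show ?thesis
      by (simp add: sum_subtractf sum_divide_distrib[symmetric] sum_distrib_left[symmetric] sum.distrib)
  qed
  have half: "1 / 2 * a = a / 2" for a :: real by simp
  have "(\<integral>x. ?L i x / 2 - ?R i x / 2 \<partial>lborel) \<le> (\<integral>x. (\<Sum>k\<in>UNIV. W i k x * G' i k x) \<partial>lborel)" for i
  proof (rule cc_mono[OF _ ccT pt])
    show "cc (\<lambda>x. ?L i x / 2 - ?R i x / 2)"
      by (rule cc_diff[OF cc_cmult[OF ccL, of "1/2"] cc_cmult[OF ccR, of "1/2"], unfolded half])
  qed
  moreover have "(\<integral>x. ?L i x / 2 - ?R i x / 2 \<partial>lborel) = (\<integral>x. ?L i x \<partial>lborel) / 2 - (\<integral>x. ?R i x \<partial>lborel) / 2" for i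
    using integral_cc_diff[OF cc_cmult[OF ccL, of "1/2"] cc_cmult[OF ccR, of "1/2"], unfolded half]
    by (simp only: integral_divide_zero)
  ultimately have "(\<Sum>i\<in>UNIV. (\<integral>x. ?L i x \<partial>lborel) / 2 - (\<integral>x. ?R i x \<partial>lborel) / 2) \<le> 0"
    using test by (smt (verit, best) sum_mono)
  then show ?thesis by (simp add: sum_subtractf sum_divide_distrib[symmetric])
qed

end

section \<open>Cutoff functions\<close>

text \<open>The square makes the positive part continuously differentiable.\<close>

definition pos2 :: "real \<Rightarrow> real" where "pos2 t = (max 0 t)^2"

lemma pos2_deriv: "(pos2 has_real_derivative 2 * max 0 t) (at t)"
proof (cases t "0::real" rule: linorder_cases)
  case less
  have ev: "\<forall>\<^sub>F s in nhds t. pos2 s = 0"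
    using eventually_nhds_in_open[of "{..<0}" t] less by (auto simp: pos2_def elim: eventually_mono)
  show ?thesis using less by (subst DERIV_cong_ev[OF refl ev refl]) simp
next
  case greater
  have ev: "\<forall>\<^sub>F s in nhds t. pos2 s = s^2"
    using eventually_nhds_in_open[of "{0<..}" t] greater by (auto simp: pos2_def max_def elim!: eventually_mono)
  show ?thesis using greater by (subst DERIV_cong_ev[OF refl ev refl]) (auto intro!: derivative_eq_intros)
next
  case equal
  have "((\<lambda>h. (pos2 (0 + h) - pos2 0) / h) \<longlongrightarrow> 0) (at 0)"
  proof (rule Lim_null_comparison)
    show "\<forall>\<^sub>F h in at 0. norm ((pos2 (0 + h) - pos2 0) / h) \<le> \<bar>h\<bar>"
      by (rule always_eventually) (auto simp: pos2_def max_def power2_eq_square)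
    show "((\<lambda>h::real. \<bar>h\<bar>) \<longlongrightarrow> 0) (at 0)" by (rule tendsto_rabs_zero) (rule tendsto_ident_at)
  qed
  then show ?thesis using equal by (simp add: DERIV_def)
qed

text \<open>A continuously differentiable function that is \<open>1\<close> on \<open>[-1, 1]\<close> and \<open>0\<close> outside \<open>[-2, 2]\<close>: the two
  truncated squares have no common zero.\<close>

definition bump :: "real \<Rightarrow> real" where
  "bump t = pos2 (4 - t^2) / (pos2 (4 - t^2) + pos2 (t^2 - 1))"
definition bump' :: "real \<Rightarrow> real" where
  "bump' t = ((2 * max 0 (4 - t^2) * (- 2 * t)) * pos2 (t^2 - 1) - pos2 (4 - t^2) * (2 * max 0 (t^2 - 1) * (2 * t)))
     / (pos2 (4 - t^2) + pos2 (t^2 - 1))^2"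

lemma bump_den: "pos2 (4 - t^2) + pos2 (t^2 - 1) > 0"
proof (cases "t^2 < 4")
  case True
  then have "pos2 (4 - t^2) > 0" by (simp add: pos2_def max_def)
  moreover have "pos2 (t^2 - 1) \<ge> 0" by (simp add: pos2_def)
  ultimately show ?thesis by linarith
next
  case False
  then have "pos2 (t^2 - 1) > 0" by (simp add: pos2_def max_def)
  moreover have "pos2 (4 - t^2) \<ge> 0" by (simp add: pos2_def)
  ultimately show ?thesis by linarith
qed

lemma bump_deriv: "(bump has_real_derivative bump' t) (at t)"
proof -
  have 1: "((\<lambda>t. pos2 (4 - t^2)) has_real_derivative 2 * max 0 (4 - t^2) * (- 2 * t)) (at t)"
    by (rule DERIV_chain2[where f=pos2 and g="\<lambda>t. 4 - t^2", OF pos2_deriv]) (auto intro!: derivative_eq_intros)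
  have 2: "((\<lambda>t. pos2 (t^2 - 1)) has_real_derivative 2 * max 0 (t^2 - 1) * (2 * t)) (at t)"
    by (rule DERIV_chain2[where f=pos2 and g="\<lambda>t. t^2 - 1", OF pos2_deriv]) (auto intro!: derivative_eq_intros)
  have eq: "bump = (\<lambda>t. pos2 (4 - t^2) / (pos2 (4 - t^2) + pos2 (t^2 - 1)))" by (rule ext) (rule bump_def)
  have "pos2 (4 - t^2) + pos2 (t^2 - 1) \<noteq> 0" using bump_den[of t] by linarith
  from DERIV_divide[OF 1 DERIV_add[OF 1 2] this]
  show ?thesis unfolding eq
    by (rule DERIV_cong) (simp add: bump'_def power2_eq_square algebra_simps)
qed

lemma bump_cont': "continuous_on S bump'"
proof -
  have "continuous_on UNIV bump'"
    unfolding bump'_def pos2_def using bump_den[unfolded pos2_def]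
    by (intro continuous_intros) (auto simp: less_imp_neq[symmetric] dest: less_imp_neq)
  then show ?thesis by (rule continuous_on_subset) simp
qed

lemma bump_cont: "continuous_on S bump"
  by (meson DERIV_isCont bump_deriv continuous_at_imp_continuous_on)

lemma bump_range: "0 \<le> bump t" "bump t \<le> 1"
  using bump_den[of t] unfolding bump_def pos2_def by (auto simp: divide_le_eq_1)

lemma bump_one: "\<bar>t\<bar> \<le> 1 \<Longrightarrow> bump t = 1" "\<bar>t\<bar> \<le> 1 \<Longrightarrow> bump' t = 0"
proof -
  assume "\<bar>t\<bar> \<le> 1"
  then have "t^2 \<le> 1" by (simp add: abs_square_le_1)
  then have m: "max 0 (t^2 - 1) = 0" by (intro max_absorb1) linarith
  then have p: "pos2 (t^2 - 1) = 0" unfolding pos2_def by (simp only:) simp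
  have "pos2 (4 - t^2) \<noteq> 0" using bump_den[of t] unfolding p by linarith
  then show "bump t = 1" unfolding bump_def p by simp
  show "bump' t = 0" unfolding bump'_def p m by simp
qed

lemma bump_zero: "2 \<le> \<bar>t\<bar> \<Longrightarrow> bump t = 0" "2 \<le> \<bar>t\<bar> \<Longrightarrow> bump' t = 0"
proof -
  assume "2 \<le> \<bar>t\<bar>"
  then have "2^2 \<le> t^2" by (metis abs_ge_zero abs_le_square_iff abs_numeral power2_abs)
  then have "4 \<le> t^2" by simp
  then have m: "max 0 (4 - t^2) = 0" by (intro max_absorb1) linarith
  then have p: "pos2 (4 - t^2) = 0" unfolding pos2_def by (simp only:) simp
  show "bump t = 0" unfolding bump_def p by simp
  show "bump' t = 0" unfolding bump'_def p m by simp
qed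

lemma bump'_bounded: "\<exists>K>0. \<forall>t. \<bar>bump' t\<bar> \<le> K"
proof -
  have "bounded (bump' ` {-2..2})" by (intro compact_imp_bounded compact_continuous_image bump_cont') simp
  then obtain K where K0: "\<forall>x\<in>bump' ` {-2..2}. norm x \<le> K" unfolding bounded_iff by blast
  have K: "\<bar>bump' t\<bar> \<le> K" if "t \<in> {-2..2}" for t
    using bspec[OF K0 imageI[OF that]] by simp
  show ?thesis
  proof (intro exI[of _ "max K 1"] conjI allI)
    fix t show "\<bar>bump' t\<bar> \<le> max K 1"
    proof (cases "\<bar>t\<bar> \<le> 2")
      case True then show ?thesis using K[of t] by (auto simp: abs_le_iff max_def)
    next
      case False then have "bump' t = 0" by (intro bump_zero(2)) simp
      then show ?thesis by simp
    qed
  qed simp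
qed

definition bumpK :: real where "bumpK = (SOME K. K > 0 \<and> (\<forall>t. \<bar>bump' t\<bar> \<le> K))"
lemma bumpK: "bumpK > 0" "\<bar>bump' t\<bar> \<le> bumpK"
  using someI_ex[OF bump'_bounded] unfolding bumpK_def by auto

text \<open>The cutoff of the box with half-sides \<open>r\<close>, supported in the doubled box. As a product of
  functions of one coordinate it can be scaled separately in each direction.\<close>

definition eta :: "('n::finite \<Rightarrow> real) \<Rightarrow> real^'n \<Rightarrow> real" where
  "eta r x = (\<Prod>j\<in>UNIV. bump (x $ j / r j))"
definition eta' :: "('n::finite \<Rightarrow> real) \<Rightarrow> 'n \<Rightarrow> real^'n \<Rightarrow> real" where
  "eta' r k x = bump' (x $ k / r k) / r k * (\<Prod>j\<in>UNIV-{k}. bump (x $ j / r j))"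

lemma has_grad_prod:
  assumes "\<And>i. i \<in> A \<Longrightarrow> has_grad (f i) (f' i)" "finite A"
  shows "has_grad (\<lambda>x. \<Prod>i\<in>A. f i x) (\<lambda>k x. \<Sum>i\<in>A. f' i k x * (\<Prod>j\<in>A-{i}. f j x))"
  using assms(2,1)
proof (induction rule: finite_induct)
  case empty then show ?case by (simp add: has_grad_const)
next
  case (insert a A)
  have "has_grad (\<lambda>x. f a x * (\<Prod>i\<in>A. f i x))
     (\<lambda>k x. f' a k x * (\<Prod>i\<in>A. f i x) + f a x * (\<Sum>i\<in>A. f' i k x * (\<Prod>j\<in>A-{i}. f j x)))"
    by (intro has_grad_mult insert) auto
  moreover have "f a x * (\<Sum>i\<in>A. f' i k x * (\<Prod>j\<in>A-{i}. f j x)) = (\<Sum>i\<in>A. f' i k x * (\<Prod>j\<in>insert a A-{i}. f j x))" for k x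
    unfolding sum_distrib_left
  proof (rule sum.cong[OF refl])
    fix i assume "i \<in> A"
    then have "insert a A - {i} = insert a (A - {i})" "a \<notin> A - {i}" using insert.hyps by auto
    then show "f a x * (f' i k x * (\<Prod>j\<in>A-{i}. f j x)) = f' i k x * (\<Prod>j\<in>insert a A-{i}. f j x)"
      using insert.hyps(1) by simp
  qed
  moreover have "insert a A - {a} = A" using insert.hyps by auto
  ultimately show ?case using insert.hyps by simp
qed

lemma has_grad_bump_nth: "has_grad (\<lambda>x. bump (x $ j / r)) (\<lambda>k x. bump' (x $ j / r) / r * (if k = j then 1 else 0))"
  using has_grad_compose'[OF has_grad_cmult[OF has_grad_nth[of j], of "1/r"] bump_deriv bump_cont']
  by (simp add: mult.assoc[symmetric])

lemma has_grad_eta: "has_grad (eta r) (eta' r)"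
proof -
  have "has_grad (\<lambda>x. \<Prod>j\<in>UNIV. bump (x $ j / r j))
     (\<lambda>k x. \<Sum>i\<in>UNIV. (bump' (x $ i / r i) / r i * (if k = i then 1 else 0)) * (\<Prod>j\<in>UNIV-{i}. bump (x $ j / r j)))"
    by (intro has_grad_prod has_grad_bump_nth) auto
  moreover have "(\<lambda>x. \<Prod>j\<in>UNIV. bump (x $ j / r j)) = eta r" by (simp add: eta_def fun_eq_iff)
  moreover have "(\<lambda>k x. \<Sum>i\<in>UNIV. (bump' (x $ i / r i) / r i * (if k = i then 1 else 0)) * (\<Prod>j\<in>UNIV-{i}. bump (x $ j / r j))) = eta' r"
  proof (intro ext)
    fix k x
    have "(\<Sum>i\<in>UNIV. (bump' (x $ i / r i) / r i * (if k = i then 1 else 0)) * (\<Prod>j\<in>UNIV-{i}. bump (x $ j / r j)))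
        = (\<Sum>i\<in>UNIV. if k = i then eta' r i x else 0)"
      by (intro sum.cong) (auto simp: eta'_def)
    then show "(\<Sum>i\<in>UNIV. (bump' (x $ i / r i) / r i * (if k = i then 1 else 0)) * (\<Prod>j\<in>UNIV-{i}. bump (x $ j / r j))) = eta' r k x"
      by simp
  qed
  ultimately show ?thesis by simp
qed

lemma eta_range: "0 \<le> eta r x" "eta r x \<le> 1"
  unfolding eta_def by (auto intro!: prod_nonneg prod_le_1 simp: bump_range)

lemma eta_one: assumes "\<And>j. r j > 0" "\<And>j. \<bar>x $ j\<bar> \<le> r j" shows "eta r x = 1"
proof -
  have "bump (x $ j / r j) = 1" for j
    using assms(1)[of j] assms(2)[of j] by (intro bump_one) (simp add: abs_divide divide_le_eq)
  then show ?thesis by (simp add: eta_def)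
qed

lemma eta_zero: assumes "\<And>j. r j > 0" "2 * r j \<le> \<bar>x $ j\<bar>" shows "eta r x = 0"
proof -
  have "bump (x $ j / r j) = 0"
    using assms(1)[of j] assms(2) by (intro bump_zero) (simp add: abs_divide le_divide_eq)
  then show ?thesis unfolding eta_def by (subst prod_zero_iff) auto
qed

lemma eta_mono:
  assumes r: "\<And>j. r j > 0" and s: "\<And>j. 2 * r j \<le> s j" shows "eta r x \<le> eta s x"
proof (cases "\<forall>j. \<bar>x $ j\<bar> < 2 * r j")
  case True
  have "s j > 0" for j using r[of j] s[of j] by linarith
  then have "eta s x = 1"
  proof (rule eta_one)
    fix j show "\<bar>x $ j\<bar> \<le> s j" using True[rule_format, of j] s[of j] by linarith
  qed
  then show ?thesis using eta_range by simp
next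
  case False
  then obtain j where "2 * r j \<le> \<bar>x $ j\<bar>" by (auto simp: not_less)
  then have "eta r x = 0" by (intro eta_zero r)
  then show ?thesis using eta_range by simp
qed

lemma eta'_zero: assumes "\<And>j. r j > 0" "2 * r j \<le> \<bar>x $ j\<bar>" shows "eta' r k x = 0"
proof (cases "j = k")
  case True
  then have "bump' (x $ k / r k) = 0"
    using assms(1)[of k] assms(2) by (intro bump_zero) (simp add: abs_divide le_divide_eq)
  then show ?thesis by (simp add: eta'_def)
next
  case False
  have "bump (x $ j / r j) = 0"
    using assms(1)[of j] assms(2) by (intro bump_zero) (simp add: abs_divide le_divide_eq)
  then have "(\<Prod>j\<in>UNIV-{k}. bump (x $ j / r j)) = 0" using False by (subst prod_zero_iff) auto
  then show ?thesis by (simp add: eta'_def)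
qed

lemma eta'_zero': assumes "r k > 0" "\<bar>x $ k\<bar> \<le> r k" shows "eta' r k x = 0"
proof -
  have "bump' (x $ k / r k) = 0"
    using assms by (intro bump_one) (simp add: abs_divide divide_le_eq)
  then show ?thesis by (simp add: eta'_def)
qed

lemma eta'_bound: assumes r: "\<And>j. r j > 0" and s: "\<And>j. 2 * r j \<le> s j"
  shows "\<bar>eta' r k x\<bar> \<le> bumpK / r k * eta s x"
proof (cases "\<forall>j. \<bar>x $ j\<bar> < 2 * r j")
  case True
  have "s j > 0" for j using r[of j] s[of j] by linarith
  then have 1: "eta s x = 1"
  proof (rule eta_one)
    fix j show "\<bar>x $ j\<bar> \<le> s j" using True[rule_format, of j] s[of j] by linarith
  qed
  have "\<bar>\<Prod>j\<in>UNIV-{k}. bump (x $ j / r j)\<bar> \<le> 1"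
    unfolding abs_prod by (rule prod_le_1) (auto simp: bump_range abs_of_nonneg)
  then have "\<bar>eta' r k x\<bar> \<le> \<bar>bump' (x $ k / r k) / r k\<bar> * 1"
    unfolding eta'_def abs_mult by (intro mult_left_mono) auto
  also have "\<dots> \<le> bumpK / r k" using bumpK(2) r[of k] by (simp add: abs_divide divide_right_mono)
  finally show ?thesis using 1 by simp
next
  case False
  then obtain j where "2 * r j \<le> \<bar>x $ j\<bar>" by (auto simp: not_less)
  then have "eta' r k x = 0" by (intro eta'_zero r)
  then show ?thesis using eta_range[of s x] bumpK r[of k] by (simp add: zero_le_mult_iff less_imp_le)
qed

lemma eta_support: assumes "\<And>j. r j > 0" shows "bounded {x. eta r x \<noteq> 0}"
proof (rule bounded_subset[OF bounded_cbox])
  show "{x. eta r x \<noteq> 0} \<subseteq> cbox (\<chi> j. - 2 * r j) (\<chi> j. 2 * r j)"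
  proof (clarsimp simp: mem_box_cart)
    fix x j assume "eta r x \<noteq> 0"
    then have "\<not> 2 * r j \<le> \<bar>x $ j\<bar>" using eta_zero[of r j x] assms by auto
    then show "- (2 * r j) \<le> x $ j \<and> x $ j \<le> 2 * r j" by auto
  qed
qed

lemma cc_eta: assumes "\<And>j. r j > 0" shows "cc (eta r)" "cc (eta' r k)"
  using has_grad_cc[OF has_grad_eta eta_support[of r]] assms by auto

lemma cont_eta: "continuous_on S (eta r)" by (rule has_grad_continuous[OF has_grad_eta])
lemma integral_eta: assumes r: "\<And>j. r j > 0" shows "(\<integral>x. eta r x \<partial>lborel) \<le> (\<Prod>j\<in>UNIV. 4 * r j)"
proof -
  let ?B = "cbox (\<chi> j. - 2 * r j) (\<chi> j. 2 * r j)"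
  have "(\<integral>x. eta r x \<partial>lborel) \<le> (\<integral>x. indicator ?B x \<partial>lborel)"
  proof (rule integral_mono)
    show "integrable lborel (\<lambda>x. indicator ?B x :: real)"
      using borel_integrable_compact[OF compact_cbox continuous_on_const, of "\<chi> j. - 2 * r j" "\<chi> j. 2 * r j" "1::real"] by simp
    fix x show "eta r x \<le> indicator ?B x"
    proof (cases "x \<in> ?B")
      case False
      then obtain j where "2 * r j \<le> \<bar>x $ j\<bar>" proof -
        from False obtain j where "\<not> (- 2 * r j \<le> x $ j \<and> x $ j \<le> 2 * r j)" by (auto simp: mem_box_cart)
        then have "2 * r j \<le> \<bar>x $ j\<bar>" by auto
        then show thesis by (rule that)
      qed
      then have "eta r x = 0" by (intro eta_zero r)
      then show ?thesis using False by simp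
    qed (simp add: eta_range)
  qed (use cc_integrable[OF cc_eta(1)[of r]] r in simp)
  also have "\<dots> = measure lborel ?B" by simp
  also have "\<dots> = (\<Prod>j\<in>UNIV. 4 * r j)"
  proof -
    have "?B \<noteq> {}" using r by (auto simp: interval_ne_empty_cart less_imp_le)
    then show ?thesis by (simp add: content_cbox_cart)
  qed
  finally show ?thesis .
qed

text \<open>The half-sides of a cylinder around the \<open>N\<close>-axis: height \<open>L\<close> in direction \<open>N\<close>, radius \<open>R\<close> in the
  other directions.\<close>

definition tall :: "'n::finite \<Rightarrow> real \<Rightarrow> real \<Rightarrow> 'n \<Rightarrow> real" where
  "tall N R L j = (if j = N then L else R)"

lemma integral_eta_tall:
  fixes N :: "'n::finite"
  assumes "CARD('n) \<le> 3" "R \<ge> 1" "L > 0"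
  shows "(\<integral>x. eta (tall N R L) x \<partial>lborel) \<le> 64 * R^2 * L"
proof -
  have "(\<integral>x. eta (tall N R L) x \<partial>lborel) \<le> (\<Prod>j\<in>UNIV. 4 * tall N R L j)"
    by (rule integral_eta) (use assms in \<open>auto simp: tall_def\<close>)
  also have "\<dots> = (4 * L) * (\<Prod>j\<in>UNIV-{N}. 4 * tall N R L j)"
    by (subst prod.remove[of UNIV N]) (auto simp: tall_def)
  also have "(\<Prod>j\<in>UNIV-{N}. 4 * tall N R L j) = (4 * R) ^ (CARD('n) - 1)"
    by (simp add: tall_def card_Diff_singleton)
  also have "\<dots> \<le> (4 * R) ^ 2" using assms by (intro power_increasing) auto
  finally show ?thesis using assms by (simp add: power2_eq_square mult_left_mono mult_ac)
qed

lemma integral_eta_lower: assumes r: "\<And>j. r j > 0" shows "(\<Prod>j\<in>UNIV. 2 * r j) \<le> (\<integral>x. eta r x \<partial>lborel)"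
proof -
  let ?B = "cbox (\<chi> j. - r j) (\<chi> j. r j)"
  have "?B \<noteq> {}" using r by (auto simp: interval_ne_empty_cart less_imp_le)
  then have "(\<Prod>j\<in>UNIV. 2 * r j) = measure lborel ?B" by (simp add: content_cbox_cart)
  also have "\<dots> = (\<integral>x. indicator ?B x \<partial>lborel)" by simp
  also have "\<dots> \<le> (\<integral>x. eta r x \<partial>lborel)"
  proof (rule integral_mono)
    show "integrable lborel (\<lambda>x. indicator ?B x :: real)"
      using borel_integrable_compact[OF compact_cbox continuous_on_const, of "\<chi> j. - r j" "\<chi> j. r j" "1::real"] by simp
    fix x show "indicator ?B x \<le> eta r x"
    proof (cases "x \<in> ?B")
      case True
      then have "\<bar>x $ j\<bar> \<le> r j" for j by (auto simp: mem_box_cart abs_le_iff minus_le_iff)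
      then show ?thesis using eta_one[of r x] r by simp
    qed (simp add: eta_range)
  qed (use cc_integrable[OF cc_eta(1)[of r]] r in simp)
  finally show ?thesis .
qed

section \<open>The integral of a function with few sign changes\<close>

text \<open>If \<open>g\<close> stays above \<open>-\<delta>\<close> or below \<open>\<delta>\<close>, then \<open>|g|\<close> differs from \<open>g\<close> or from \<open>-g\<close> by at most \<open>2 \<delta>\<close>.
  Otherwise \<open>g\<close> passes between these two values, so \<open>arsinh (g / \<tau>)\<close> varies by at least
  \<open>2 arsinh (\<delta> / \<tau>)\<close>. Its derivative is the last integrand up to sign, and the last term alone
  is at least the trivial bound \<open>G R\<close>.\<close>

lemma integral_abs_line:
  fixes g g' :: "real \<Rightarrow> real"
  assumes d: "\<And>t. (g has_real_derivative g' t) (at t)" and c: "continuous_on UNIV g'"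
    and G: "\<And>t. \<bar>g t\<bar> \<le> G" and R: "0 \<le> R" and dt: "\<delta> > 0" "\<tau> > 0"
  shows "integral {0..R} (\<lambda>t. \<bar>g t\<bar>) \<le> \<bar>integral {0..R} g\<bar> + 2 * \<delta> * R
     + G * R / (2 * arsinh (\<delta> / \<tau>)) * integral {0..R} (\<lambda>t. \<bar>g' t\<bar> / sqrt ((g t)^2 + \<tau>^2))"
proof -
  have cg: "continuous_on S g" for S by (meson DERIV_isCont d continuous_at_imp_continuous_on)
  have cg': "continuous_on S g'" for S using c continuous_on_subset by blast
  have G0: "0 \<le> G" using G[of 0] by linarith
  have sq: "sqrt ((g t)^2 + \<tau>^2) > 0" for t
  proof -
    have "0 < \<tau>^2" using dt by simp
    then have "0 < (g t)^2 + \<tau>^2" by (intro add_nonneg_pos) auto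
    then show ?thesis by simp
  qed
  have as: "arsinh (\<delta> / \<tau>) > 0" using dt by simp
  let ?H = "\<lambda>t. \<bar>g' t\<bar> / sqrt ((g t)^2 + \<tau>^2)"
  have cH: "continuous_on S ?H" for S using sq by (intro continuous_intros cg cg') (metis less_irrefl)
  have H0: "?H t \<ge> 0" for t by simp
  have IH0: "0 \<le> integral {0..R} ?H" by (rule integral_nonneg) (auto intro: integrable_continuous_real cH)
  have rest: "0 \<le> G * R / (2 * arsinh (\<delta> / \<tau>)) * integral {0..R} ?H"
    using as by (intro mult_nonneg_nonneg divide_nonneg_nonneg IH0 G0 R) linarith+
  have int: "h integrable_on {0..R}" if "continuous_on {0..R} h" for h :: "real \<Rightarrow> real"
    using that by (rule integrable_continuous_real)
  consider "\<forall>t\<in>{0..R}. g t \<ge> - \<delta>" | "\<forall>t\<in>{0..R}. g t \<le> \<delta>" | s t where "s \<in> {0..R}" "t \<in> {0..R}" "g s < - \<delta>" "g t > \<delta>"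
    by (meson not_le)
  then show ?thesis
  proof cases
    case 1
    have "integral {0..R} (\<lambda>t. \<bar>g t\<bar>) \<le> integral {0..R} (\<lambda>t. g t + 2 * \<delta>)"
    proof (rule integral_le)
      show "(\<lambda>t. \<bar>g t\<bar>) integrable_on {0..R}" "(\<lambda>t. g t + 2 * \<delta>) integrable_on {0..R}"
        by (intro int continuous_intros cg)+
      fix t assume "t \<in> {0..R}"
      then have "g t \<ge> - \<delta>" using 1 by blast
      then show "\<bar>g t\<bar> \<le> g t + 2 * \<delta>" using dt by linarith
    qed
    also have "\<dots> = integral {0..R} g + 2 * \<delta> * R"
      using R by (subst integral_add) (auto intro!: int continuous_intros cg simp: mult.commute)
    finally show ?thesis using rest by linarith
  next
    case 2
    have "integral {0..R} (\<lambda>t. \<bar>g t\<bar>) \<le> integral {0..R} (\<lambda>t. - g t + 2 * \<delta>)"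
    proof (rule integral_le)
      show "(\<lambda>t. \<bar>g t\<bar>) integrable_on {0..R}" "(\<lambda>t. - g t + 2 * \<delta>) integrable_on {0..R}"
        by (intro int continuous_intros cg)+
      fix t assume "t \<in> {0..R}"
      then have "g t \<le> \<delta>" using 2 by blast
      then show "\<bar>g t\<bar> \<le> - g t + 2 * \<delta>" using dt by linarith
    qed
    also have "\<dots> = - integral {0..R} g + 2 * \<delta> * R"
      using R by (subst integral_add) (auto intro!: int continuous_intros cg simp: mult.commute)
    finally show ?thesis using rest by linarith
  next
    case 3
    let ?F = "\<lambda>t. arsinh (g t / \<tau>)"
    have dF: "(?F has_real_derivative g' t / sqrt ((g t)^2 + \<tau>^2)) (at t)" for t
    proof -
      have "((\<lambda>t. g t / \<tau>) has_real_derivative g' t / \<tau>) (at t)" by (rule DERIV_cdivide[OF d])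
      from DERIV_chain2[OF arsinh_real_has_field_derivative this]
      have "(?F has_real_derivative 1 / sqrt ((g t / \<tau>)^2 + 1) * (g' t / \<tau>)) (at t)" .
      moreover have "sqrt ((g t)^2 + \<tau>^2) = \<tau> * sqrt ((g t / \<tau>)^2 + 1)"
      proof -
        have "(g t)^2 + \<tau>^2 = \<tau>^2 * ((g t / \<tau>)^2 + 1)" using dt by (simp add: field_simps)
        then show ?thesis using dt by (simp add: real_sqrt_mult)
      qed
      ultimately show ?thesis by (simp add: mult.commute)
    qed
    have cF': "continuous_on S (\<lambda>t. g' t / sqrt ((g t)^2 + \<tau>^2))" for S
      using sq by (intro continuous_intros cg cg') (metis less_irrefl)
    have bd: "\<bar>?F b - ?F a\<bar> \<le> integral {0..R} ?H" if "a \<le> b" "0 \<le> a" "b \<le> R" for a b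
    proof -
      have "((\<lambda>t. g' t / sqrt ((g t)^2 + \<tau>^2)) has_integral ?F b - ?F a) {a..b}"
        by (rule fundamental_theorem_of_calculus[OF that(1)])
           (auto simp: has_real_derivative_iff_has_vector_derivative[symmetric] intro: has_field_derivative_at_within dF)
      then have "?F b - ?F a = integral {a..b} (\<lambda>t. g' t / sqrt ((g t)^2 + \<tau>^2))" by (simp add: integral_unique)
      then have "\<bar>?F b - ?F a\<bar> \<le> integral {a..b} ?H"
        using integral_norm_bound_integral[of "\<lambda>t. g' t / sqrt ((g t)^2 + \<tau>^2)" "{a..b}" ?H]
        by (auto intro!: integrable_continuous_real cF' cH simp: abs_divide)
      also have "\<dots> \<le> integral {0..R} ?H"
        by (rule integral_subset_le) (use that H0 in \<open>auto intro!: integrable_continuous_real cH\<close>)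
      finally show ?thesis .
    qed
    have am: "arsinh a \<le> arsinh b" if "a \<le> b" for a b :: real
      unfolding not_less[symmetric] arsinh_less_iff_real using that by (simp add: not_less)
    have "\<delta> / \<tau> \<le> g t / \<tau>" by (rule divide_right_mono) (use 3 dt in auto)
    then have "?F t \<ge> arsinh (\<delta> / \<tau>)"
      by (rule am)
    moreover have "g s / \<tau> \<le> - (\<delta> / \<tau>)"
      using divide_right_mono[of "g s" "- \<delta>" \<tau>] 3 dt by simp
    then have "?F s \<le> arsinh (- (\<delta> / \<tau>))" by (rule am)
    moreover have "arsinh (- (\<delta> / \<tau>)) = - arsinh (\<delta> / \<tau>)" by (rule arsinh_minus_real)
    ultimately have "2 * arsinh (\<delta> / \<tau>) \<le> \<bar>?F t - ?F s\<bar>" by linarith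
    also have "\<dots> \<le> integral {0..R} ?H" using bd[of s t] bd[of t s] 3 by (cases "s \<le> t") (auto simp: abs_minus_commute)
    finally have "1 \<le> integral {0..R} ?H / (2 * arsinh (\<delta> / \<tau>))" using as by (simp add: le_divide_eq)
    then have "G * R * 1 \<le> G * R * (integral {0..R} ?H / (2 * arsinh (\<delta> / \<tau>)))"
      using G0 R by (intro mult_left_mono) auto
    moreover have "integral {0..R} (\<lambda>t. \<bar>g t\<bar>) \<le> integral {0..R} (\<lambda>t. G)"
      by (rule integral_le) (auto intro!: int continuous_intros cg G)
    moreover have "integral {0..R} (\<lambda>t. G) = G * R" using R by (simp add: mult.commute)
    moreover have "0 \<le> 2 * \<delta> * R" using dt R by simp
    moreover have "G * R * (integral {0..R} ?H / (2 * arsinh (\<delta> / \<tau>))) = G * R / (2 * arsinh (\<delta> / \<tau>)) * integral {0..R} ?H"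
      by simp
    ultimately show ?thesis by linarith
  qed
qed

section \<open>Gradient bounds\<close>

lemma second_derivative_at_max:
  fixes g :: "real \<Rightarrow> real"
  assumes "\<And>t. (g has_real_derivative g' t) (at t)" "(g' has_real_derivative s) (at 0)"
    and "e > 0" "\<And>t. \<bar>t\<bar> < e \<Longrightarrow> g t \<le> g 0"
  shows "s \<le> 0"
proof (rule ccontr)
  assume "\<not> s \<le> 0" then have "s > 0" by simp
  have g0: "g' 0 = 0"
    by (rule DERIV_local_max[OF assms(1) assms(3)]) (use assms(4) in simp)
  obtain d where d: "d > 0" "\<And>h. h > 0 \<Longrightarrow> h < d \<Longrightarrow> g' 0 < g' (0 + h)"
    using DERIV_pos_inc_right[OF assms(2) \<open>s > 0\<close>] by auto
  define h where "h = min d e / 2"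
  have h: "0 < h" "h < d" "h < e" using d assms(3) by (auto simp: h_def)
  have "\<exists>z. z > 0 \<and> z < h \<and> g h - g 0 = (h - 0) * g' z"
    by (rule MVT2) (use h assms(1) in auto)
  then obtain z where z: "z > 0" "z < h" "g h - g 0 = h * g' z" by auto
  have "g' z > 0" using d(2)[of z] z h g0 by simp
  then have "g h > g 0" using z h by (metis diff_gt_0_iff_gt mult_pos_pos)
  then show False using assms(4)[of h] h by simp
qed

text \<open>The comparison argument of the classical proof. On the half box \<open>z\<^sub>k \<ge> 0\<close> the odd part of \<open>v\<close> under
  reflection in the plane \<open>z\<^sub>k = 0\<close> is compared with a quadratic barrier of Laplacian \<open>-B\<close> that
  dominates it on the boundary. As the Laplacian of \<open>v\<close> is strictly between \<open>-B\<close> and \<open>B\<close>, the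
  difference has no interior maximum. Both functions vanish at the centre, so their derivatives
  there are ordered as well.\<close>

lemma gradient_estimate_half:
  fixes v :: "real^'n::finite \<Rightarrow> real"
  assumes P: "has_grad v P" and D: "\<And>k. has_grad (P k) (D k)"
    and d: "d > 0" and A: "\<And>x. (\<And>j. \<bar>x $ j - y $ j\<bar> \<le> d) \<Longrightarrow> \<bar>v x\<bar> \<le> A"
    and B: "\<And>x. (\<And>j. \<bar>x $ j - y $ j\<bar> \<le> d) \<Longrightarrow> \<bar>\<Sum>j\<in>UNIV. D j j x\<bar> < B"
  shows "P k y \<le> real CARD('n) * A / d + B * d / 2"
proof -
  define n where "n = real CARD('n)"
  define a where "a = A / d^2"
  have A0: "A \<ge> 0" using A[of y] d by simp
  have a0: "a \<ge> 0" and ad: "a * d^2 = A" using A0 d by (simp_all add: a_def)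
  have B0: "B > 0" using B[of y] d by simp
  define \<rho> where "\<rho> z = (\<chi> j. if j = k then - z $ j else z $ j)" for z :: "real^'n"
  \<comment> \<open>The barrier is the sum of the functions \<open>q i\<close> of one coordinate each.\<close>
  define q where "q i s = (if i = k then a * (s * (n * d - (n - 1) * s)) + B / 2 * (s * (d - s)) else a * s^2)" for i and s :: real
  define q' where "q' i s = (if i = k then a * (n * d - 2 * (n - 1) * s) + B / 2 * (d - 2 * s) else a * (2 * s))" for i and s :: real
  define q2 where "q2 i = (if i = k then - (2 * (n - 1) * a) - B else 2 * a)" for i :: 'n
  have q1: "(q i has_real_derivative q' i s) (at s)" for i s
    unfolding q_def q'_def by (cases "i = k") (auto intro!: derivative_eq_intros simp: algebra_simps power2_eq_square)
  have q22: "(q' i has_real_derivative q2 i) (at s)" for i s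
    unfolding q2_def q'_def by (cases "i = k") (auto intro!: derivative_eq_intros simp: algebra_simps)
  have q2sum: "(\<Sum>i\<in>UNIV. q2 i) = - B"
  proof -
    have "(\<Sum>i\<in>UNIV. q2 i) = q2 k + (\<Sum>i\<in>UNIV-{k}. q2 i)" by (rule sum.remove) auto
    also have "(\<Sum>i\<in>UNIV-{k}. q2 i) = (n - 1) * (2 * a)"
      by (simp add: q2_def n_def card_Diff_singleton of_nat_diff Suc_leI)
    finally show ?thesis by (simp add: q2_def field_simps)
  qed
  define F where "F z = (v (y + z) - v (y + \<rho> z)) / 2 - (\<Sum>i\<in>UNIV. q i (z $ i))" for z
  define Q where "Q = cbox (\<chi> j. if j = k then 0 else - d) (\<chi> j. d)"
  have memQ: "z \<in> Q \<longleftrightarrow> (\<forall>j. (if j = k then 0 else - d) \<le> z $ j \<and> z $ j \<le> d)" for z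
    by (simp add: Q_def mem_box_cart)
  have inQ: "\<bar>(y + z) $ j - y $ j\<bar> \<le> d" "\<bar>(y + \<rho> z) $ j - y $ j\<bar> \<le> d" if "z \<in> Q" for z j
    using that[unfolded memQ, rule_format, of j] d by (auto simp: \<rho>_def split: if_splits)
  have n1: "n \<ge> 1" by (simp add: n_def Suc_leI)
  have qk0: "q k s \<ge> 0" if "0 \<le> s" "s \<le> d" for s
  proof -
    have "(n - 1) * s \<le> (n - 1) * d" using that n1 by (intro mult_left_mono) auto
    also have "\<dots> \<le> n * d" using d by simp
    finally show ?thesis using that a0 B0 by (auto simp: q_def intro!: add_nonneg_nonneg mult_nonneg_nonneg)
  qed
  have qj0: "q j s \<ge> 0" if "j \<noteq> k" for j s using that a0 by (simp add: q_def)
  have c\<rho>: "continuous_on UNIV \<rho>"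
  proof -
    have "continuous_on UNIV (\<lambda>x::real^'n. if j = k then - x $ j else x $ j)" for j
      by (cases "j = k") (auto intro!: continuous_intros)
    then show ?thesis unfolding \<rho>_def by (intro continuous_on_vec_lambda)
  qed
  have cv: "continuous_on UNIV (\<lambda>z. v (y + z))" "continuous_on UNIV (\<lambda>z. v (y + \<rho> z))"
    by (rule continuous_on_compose2[OF has_grad_continuous[OF P, of UNIV]];
        auto intro!: continuous_intros c\<rho>)+
  have cF: "continuous_on Q F"
  proof (rule continuous_on_subset[of UNIV])
    have "continuous_on UNIV (q i)" for i by (meson q1 DERIV_isCont continuous_at_imp_continuous_on)
    then have "continuous_on UNIV (\<lambda>z. q i (z $ i))" for i
      by (rule continuous_on_compose2) (auto intro!: continuous_intros)
    then show "continuous_on UNIV F" unfolding F_def by (intro continuous_intros cv) auto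
  qed simp
  have "0 \<in> Q" using d by (simp add: memQ)
  then obtain z where z: "z \<in> Q" "\<And>w. w \<in> Q \<Longrightarrow> F w \<le> F z"
    using continuous_attains_sup[of Q F] cF by (auto simp: Q_def)
  have Fz: "F z \<le> 0"
  proof (cases "\<exists>j. \<bar>z $ j\<bar> = d \<or> z $ k = 0")
    case True
    have nn: "q j (z $ j) \<ge> 0" for j
      using z(1)[unfolded memQ, rule_format, of j] qk0[of "z $ k"] qj0[of j] by (cases "j = k") auto
    show ?thesis
    proof (cases "z $ k = 0")
      case True
      then have "\<rho> z = z" by (simp add: \<rho>_def vec_eq_iff)
      then show ?thesis by (simp add: F_def sum_nonneg nn)
    next
      case False
      with \<open>\<exists>j. _\<close> obtain j where j: "\<bar>z $ j\<bar> = d" by auto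
      have "A \<le> q j (z $ j)"
      proof (cases "j = k")
        case True
        then have "z $ j = d" using j z(1)[unfolded memQ, rule_format, of j] by auto
        then show ?thesis using True ad by (simp add: q_def algebra_simps power2_eq_square)
      next
        case False
        have "(z $ j)^2 = d^2" using j by (metis power2_abs)
        then show ?thesis using False ad by (simp add: q_def)
      qed
      also have "\<dots> \<le> (\<Sum>i\<in>UNIV. q i (z $ i))" by (rule member_le_sum) (auto simp: nn)
      finally have "A \<le> (\<Sum>i\<in>UNIV. q i (z $ i))" .
      moreover have "\<bar>v (y + z)\<bar> \<le> A" "\<bar>v (y + \<rho> z)\<bar> \<le> A" by (rule A; rule inQ[OF z(1)])+
      ultimately show ?thesis by (simp add: F_def)
    qed
  next
    case False
    have int: "(if j = k then 0 else - d) < z $ j" "z $ j < d" for j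
    proof -
      have ne: "\<bar>z $ j\<bar> \<noteq> d" "z $ k \<noteq> 0" using False by auto
      have m: "(if j = k then 0 else - d) \<le> z $ j" "z $ j \<le> d" using z(1)[unfolded memQ, rule_format, of j] by auto
      have "z $ j \<noteq> d" "z $ j \<noteq> - d" using ne(1) d by auto
      with m ne(2) show "(if j = k then 0 else - d) < z $ j" "z $ j < d" by (cases "j = k"; simp)+
    qed
    let ?s = "\<lambda>j. if j = k then - 1 else 1 :: real"
    have "(D j j (y + z) - D j j (y + \<rho> z)) / 2 - q2 j \<le> 0" for j
    proof (rule second_derivative_at_max)
      let ?e = "axis j (1::real)"
      let ?g = "\<lambda>t. (v (y + z + t *\<^sub>R ?e) - v (y + \<rho> z + t *\<^sub>R (?s j *\<^sub>R ?e))) / 2 - ((\<Sum>i\<in>UNIV-{j}. q i (z $ i)) + q j (z $ j + t))"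
      let ?g' = "\<lambda>t. (P j (y + z + t *\<^sub>R ?e) - ?s j * P j (y + \<rho> z + t *\<^sub>R (?s j *\<^sub>R ?e))) / 2 - q' j (z $ j + t)"
      have sumsc: "(\<Sum>k'\<in>UNIV. h k' * (?s j *\<^sub>R ?e) $ k') = ?s j * h j" for h :: "'n \<Rightarrow> real"
        using sum_axis[of h j] by (auto simp: sum_negf)
      show "(?g has_real_derivative ?g' t) (at t)" for t
      proof -
        have 1: "((\<lambda>t. v (y + z + t *\<^sub>R ?e)) has_real_derivative P j (y + z + t *\<^sub>R ?e)) (at t)"
          by (rule has_grad_line_axis[OF P])
        have 2: "((\<lambda>t. v (y + \<rho> z + t *\<^sub>R (?s j *\<^sub>R ?e))) has_real_derivative ?s j * P j (y + \<rho> z + t *\<^sub>R (?s j *\<^sub>R ?e))) (at t)"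
          using has_grad_line[OF P, of "y + \<rho> z" "?s j *\<^sub>R ?e" t] unfolding sumsc .
        have 3: "((\<lambda>t. q j (z $ j + t)) has_real_derivative q' j (z $ j + t)) (at t)"
          using DERIV_shift[of "q j" _ t "z $ j"] q1[of j "t + z $ j"] by (simp add: add.commute)
        show ?thesis
          by (rule DERIV_cong[OF DERIV_diff[OF DERIV_cdivide[OF DERIV_diff[OF 1 2]] DERIV_add[OF DERIV_const 3]]]) simp
      qed
      show "(?g' has_real_derivative (D j j (y + z) - D j j (y + \<rho> z)) / 2 - q2 j) (at 0)"
      proof -
        have 1: "((\<lambda>t. P j (y + z + t *\<^sub>R ?e)) has_real_derivative D j j (y + z)) (at 0)"
          using has_grad_line_axis[OF D, of j "y + z" j 0] by simp
        have 2: "((\<lambda>t. P j (y + \<rho> z + t *\<^sub>R (?s j *\<^sub>R ?e))) has_real_derivative ?s j * D j j (y + \<rho> z)) (at 0)"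
          using has_grad_line[OF D, of j "y + \<rho> z" "?s j *\<^sub>R ?e" 0] unfolding sumsc by simp
        have 3: "((\<lambda>t. q' j (z $ j + t)) has_real_derivative q2 j) (at 0)"
          using DERIV_shift[of "q' j" _ 0 "z $ j"] q22[of j "0 + z $ j"] by (simp add: add.commute)
        show ?thesis
          by (rule DERIV_cong[OF DERIV_diff[OF DERIV_cdivide[OF DERIV_diff[OF 1 DERIV_cmult[OF 2]]] 3]]) auto
      qed
      define e where "e = min (d - z $ j) (z $ j - (if j = k then 0 else - d))"
      show "e > 0" using int[of j] by (simp add: e_def)
      have Fg: "F (z + t *\<^sub>R ?e) = ?g t" for t
      proof -
        have "\<rho> (z + t *\<^sub>R ?e) = \<rho> z + t *\<^sub>R (?s j *\<^sub>R ?e)" by (auto simp: \<rho>_def vec_eq_iff axis_def)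
        moreover have "(\<Sum>i\<in>UNIV. q i ((z + t *\<^sub>R ?e) $ i)) = q j (z $ j + t) + (\<Sum>i\<in>UNIV-{j}. q i (z $ i))"
          by (subst sum.remove[of UNIV j]) (auto simp: axis_def intro!: sum.cong)
        ultimately show ?thesis by (simp add: F_def add.assoc)
      qed
      fix t :: real assume t: "\<bar>t\<bar> < e"
      have "z + t *\<^sub>R ?e \<in> Q"
        unfolding memQ
      proof
        fix i show "(if i = k then 0 else - d) \<le> (z + t *\<^sub>R ?e) $ i \<and> (z + t *\<^sub>R ?e) $ i \<le> d"
          using int[of i] t by (cases "i = j") (auto simp: axis_def e_def)
      qed
      then have "F (z + t *\<^sub>R ?e) \<le> F (z + 0 *\<^sub>R ?e)" using z(2) by simp
      then show "?g t \<le> ?g 0" unfolding Fg .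
    qed
    then have "(\<Sum>j\<in>UNIV. (D j j (y + z) - D j j (y + \<rho> z)) / 2 - q2 j) \<le> 0" by (intro sum_nonpos) blast
    then have "(\<Sum>j\<in>UNIV. D j j (y + z)) / 2 - (\<Sum>j\<in>UNIV. D j j (y + \<rho> z)) / 2 + B \<le> 0"
      by (simp add: sum_subtractf q2sum sum_divide_distrib[symmetric] diff_divide_distrib)
    moreover have "\<bar>\<Sum>j\<in>UNIV. D j j (y + z)\<bar> < B" "\<bar>\<Sum>j\<in>UNIV. D j j (y + \<rho> z)\<bar> < B"
      by (rule B; rule inQ[OF z(1)])+
    ultimately show ?thesis by linarith
  qed
  let ?e = "axis k (1::real)"
  let ?G = "\<lambda>t. (v (y + t *\<^sub>R ?e) - v (y + t *\<^sub>R (- ?e))) / 2"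
  have dG: "(?G has_real_derivative P k y) (at 0)"
  proof -
    have 1: "((\<lambda>t. v (y + t *\<^sub>R ?e)) has_real_derivative P k y) (at 0)"
      using has_grad_line_axis[OF P, of y k 0] by simp
    have 2: "((\<lambda>t. v (y + t *\<^sub>R (- ?e))) has_real_derivative - P k y) (at 0)"
      using has_grad_line[OF P, of y "- ?e" 0] sum_axis[of "\<lambda>i. P i y" k] by (simp add: sum_negf)
    show ?thesis by (rule DERIV_cong[OF DERIV_cdivide[OF DERIV_diff[OF 1 2]]]) simp
  qed
  have Gle: "?G t \<le> t * (n * A / d + B * d / 2)" if "0 < t" "t \<le> d" for t
  proof -
    have "t *\<^sub>R ?e \<in> Q" using that d by (auto simp: memQ axis_def)
    then have "F (t *\<^sub>R ?e) \<le> 0" using z(2) Fz by force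
    moreover have "\<rho> (t *\<^sub>R ?e) = t *\<^sub>R (- ?e)" by (auto simp: \<rho>_def vec_eq_iff axis_def)
    moreover have "(\<Sum>i\<in>UNIV. q i ((t *\<^sub>R ?e) $ i)) = q k t + (\<Sum>i\<in>UNIV-{k}. q i 0)"
      by (subst sum.remove[of UNIV k]) (auto simp: axis_def intro!: sum.cong)
    moreover have "(\<Sum>i\<in>UNIV-{k}. q i 0) = 0" by (intro sum.neutral) (auto simp: q_def)
    ultimately have "?G t \<le> q k t" by (simp add: F_def)
    also have "\<dots> \<le> a * (t * (n * d)) + B / 2 * (t * d)"
      unfolding q_def using that a0 B0 n1 by (auto intro!: add_mono mult_left_mono)
    also have "\<dots> = t * (n * A / d + B * d / 2)" using d by (simp add: a_def field_simps power2_eq_square)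
    finally show ?thesis .
  qed
  have "((\<lambda>t. (?G t - ?G 0) / (t - 0)) \<longlongrightarrow> P k y) (at 0)"
    using dG unfolding has_field_derivative_iff .
  then have "((\<lambda>t. (?G t - ?G 0) / (t - 0)) \<longlongrightarrow> P k y) (at_right 0)"
    by (rule tendsto_mono[OF at_le, rotated]) simp
  moreover have "\<forall>\<^sub>F t in at_right 0. (?G t - ?G 0) / (t - 0) \<le> n * A / d + B * d / 2"
  proof -
    have "\<forall>\<^sub>F t in at_right 0. t \<in> {0<..<d}"
      by (rule eventually_at_right_field[THEN iffD2]) (use d in \<open>auto intro: exI[of _ d]\<close>)
    then show ?thesis
    proof eventually_elim
      case (elim t)
      then have "?G t \<le> t * (n * A / d + B * d / 2)" by (intro Gle) auto
      then have "?G t / t \<le> t * (n * A / d + B * d / 2) / t" using elim by (intro divide_right_mono) auto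
      moreover have "t * (n * A / d + B * d / 2) / t = n * A / d + B * d / 2" using elim by simp
      moreover have "(?G t - ?G 0) / (t - 0) = ?G t / t" by simp
      ultimately show ?case by (simp only:)
    qed
  qed
  ultimately show ?thesis unfolding n_def by (intro tendsto_upperbound) auto
qed

lemma gradient_estimate:
  fixes v :: "real^'n::finite \<Rightarrow> real"
  assumes P: "has_grad v P" and D: "\<And>k. has_grad (P k) (D k)"
    and d: "d > 0" and A: "\<And>x. (\<And>j. \<bar>x $ j - y $ j\<bar> \<le> d) \<Longrightarrow> \<bar>v x\<bar> \<le> A"
    and B: "\<And>x. (\<And>j. \<bar>x $ j - y $ j\<bar> \<le> d) \<Longrightarrow> \<bar>\<Sum>j\<in>UNIV. D j j x\<bar> \<le> B"
  shows "\<bar>P k y\<bar> \<le> real CARD('n) * A / d + B * d / 2"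
proof -
  have le: "P k y \<le> real CARD('n) * A / d + B * d / 2"
    if P: "has_grad v P" and D: "\<And>k. has_grad (P k) (D k)"
    and A: "\<And>x. (\<And>j. \<bar>x $ j - y $ j\<bar> \<le> d) \<Longrightarrow> \<bar>v x\<bar> \<le> A"
    and B: "\<And>x. (\<And>j. \<bar>x $ j - y $ j\<bar> \<le> d) \<Longrightarrow> \<bar>\<Sum>j\<in>UNIV. D j j x\<bar> \<le> B" for v P D
  proof (rule field_le_epsilon)
    fix e :: real assume "e > 0"
    have "P k y \<le> real CARD('n) * A / d + (B + 2 * e / d) * d / 2"
    proof (rule gradient_estimate_half[OF P D d A])
      fix x assume "\<And>j. \<bar>x $ j - y $ j\<bar> \<le> d"
      then have "\<bar>\<Sum>j\<in>UNIV. D j j x\<bar> \<le> B" by (rule B)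
      also have "\<dots> < B + 2 * e / d" using \<open>e > 0\<close> d by simp
      finally show "\<bar>\<Sum>j\<in>UNIV. D j j x\<bar> < B + 2 * e / d" .
    qed
    also have "\<dots> = real CARD('n) * A / d + B * d / 2 + e" using d by (simp add: field_simps)
    finally show "P k y \<le> real CARD('n) * A / d + B * d / 2 + e" .
  qed
  have "P k y \<le> real CARD('n) * A / d + B * d / 2" by (rule le[OF P D A B])
  moreover have "- 1 * P k y \<le> real CARD('n) * A / d + B * d / 2"
  proof (rule le[where v="\<lambda>x. - 1 * v x" and P="\<lambda>k x. - 1 * P k x" and D="\<lambda>k l x. - 1 * D k l x"])
    show "has_grad (\<lambda>x. - 1 * v x) (\<lambda>k x. - 1 * P k x)" by (rule has_grad_cmult[OF P])
    show "has_grad (\<lambda>x. - 1 * P k x) (\<lambda>l x. - 1 * D k l x)" for k by (rule has_grad_cmult[OF D])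
    fix x assume x: "\<And>j. \<bar>x $ j - y $ j\<bar> \<le> d"
    show "\<bar>- 1 * v x\<bar> \<le> A" using A[OF x] by simp
    show "\<bar>\<Sum>j\<in>UNIV. - 1 * D j j x\<bar> \<le> B" using B[OF x] by (simp add: sum_negf)
  qed
  ultimately show ?thesis by linarith
qed

context monotone_system
begin

definition "G = 3 * U + F / 2"

lemma P_bound: "\<bar>P i k x\<bar> \<le> G"
proof -
  have "\<bar>P i k x\<bar> \<le> real CARD('n) * U / 1 + F * 1 / 2"
    by (rule gradient_estimate[OF grad_u grad_P]) (auto simp: equation u_bound f_bound)
  also have "real CARD('n) * U \<le> 3 * U" using dim U_nonneg by (intro mult_right_mono) auto
  finally show ?thesis by (simp add: G_def)
qed

lemma G_nonneg: "0 \<le> G" using P_bound[of undefined undefined undefined] by linarith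

lemma sign_\<phi>: "\<exists>s. \<bar>s\<bar> = 1 \<and> (\<forall>x. \<bar>\<phi> i x\<bar> = s * \<phi> i x)"
proof -
  have "connected (range (\<phi> i))" by (rule connected_continuous_image[OF cont_P connected_UNIV])
  moreover have "0 \<notin> range (\<phi> i)" using monotone[of i] by (metis imageE)
  ultimately have *: "\<not> (a \<in> range (\<phi> i) \<and> b \<in> range (\<phi> i) \<and> a < 0 \<and> 0 < b)" for a b
    using connectedD_interval[of "range (\<phi> i)" a b 0] by auto
  show ?thesis
  proof (cases "\<exists>x. \<phi> i x > 0")
    case True
    then have "\<phi> i y \<ge> 0" for y using *[of "\<phi> i y"] by (meson not_le rangeI)
    then show ?thesis by (intro exI[of _ 1]) auto
  next
    case False
    then have "\<phi> i y \<le> 0" for y by (meson not_le)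
    then show ?thesis by (intro exI[of _ "-1"]) auto
  qed
qed

text \<open>The local size of all components together; the coupled equations bound derivatives only in
  terms of this sum.\<close>

definition "\<Phi> x = (\<Sum>i\<in>UNIV. \<bar>\<phi> i x\<bar>)"

lemma cont_\<Phi>: "continuous_on S \<Phi>"
  unfolding \<Phi>_def by (intro continuous_intros cont_P)

lemma \<Phi>_nonneg: "0 \<le> \<Phi> x" unfolding \<Phi>_def by (rule sum_nonneg) auto
lemma \<phi>_le_\<Phi>: "\<bar>\<phi> i x\<bar> \<le> \<Phi> x" unfolding \<Phi>_def by (rule member_le_sum) auto
lemma \<Phi>_bound: "\<Phi> x \<le> real CARD('m) * G"
  unfolding \<Phi>_def using sum_bounded_above[of UNIV "\<lambda>i. \<bar>\<phi> i x\<bar>" G] P_bound by simp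

text \<open>The linearized system does not hold classically, so the gradient estimate is applied to
  difference quotients of \<open>u\<close> in direction \<open>N\<close>. By the mean value theorem their size and their
  Laplacian are controlled by nearby values of \<open>\<phi>\<close>.\<close>

lemma grad_\<phi>_bound:
  assumes M: "\<And>z. (\<And>j. \<bar>z $ j - y $ j\<bar> \<le> 2) \<Longrightarrow> \<Phi> z \<le> M"
  shows "\<bar>D i N k y\<bar> \<le> (real CARD('n) + real CARD('m) * \<Lambda>) * M"
proof -
  let ?e = "axis N (1::real)"
  have M0: "0 \<le> M" using M[of y] \<Phi>_nonneg[of y] by force
  define C where "C = (real CARD('n) + real CARD('m) * \<Lambda>) * M"
  have est: "\<bar>(P i k (y + h *\<^sub>R ?e) - P i k y) / h\<bar> \<le> C" if h: "0 < h" "h \<le> 1" for h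
  proof -
    define v where "v x = 1 / h * (u i (x + h *\<^sub>R ?e) - u i x)" for x
    define v1 where "v1 k x = 1 / h * (P i k (x + h *\<^sub>R ?e) - P i k x)" for k x
    define v2 where "v2 k l x = 1 / h * (D i k l (x + h *\<^sub>R ?e) - D i k l x)" for k l x
    have g1: "has_grad v v1" unfolding v_def v1_def by (intro has_grad_cmult has_grad_diff has_grad_shift grad_u)
    have g2: "has_grad (v1 k) (v2 k)" for k unfolding v1_def v2_def
      by (intro has_grad_cmult has_grad_diff has_grad_shift grad_P)
    have near: "\<Phi> (x + t *\<^sub>R ?e) \<le> M" if "\<And>j. \<bar>x $ j - y $ j\<bar> \<le> 1" "0 < t" "t < h" for x t
    proof (rule M)
      fix j show "\<bar>(x + t *\<^sub>R ?e) $ j - y $ j\<bar> \<le> 2" using that(1)[of j] that(2,3) h by (auto simp: axis_def)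
    qed
    have "\<bar>v1 k y\<bar> \<le> real CARD('n) * M / 1 + (real CARD('m) * \<Lambda> * M) * 1 / 2"
    proof (rule gradient_estimate[OF g1 g2])
      fix x assume x: "\<And>j. \<bar>x $ j - y $ j\<bar> \<le> 1"
      have "\<exists>t. t > 0 \<and> t < h \<and> u i (x + h *\<^sub>R ?e) - u i (x + 0 *\<^sub>R ?e) = (h - 0) * P i N (x + t *\<^sub>R ?e)"
        by (rule MVT2) (use h has_grad_line_axis[OF grad_u] in auto)
      then obtain t where t: "t > 0" "t < h" "u i (x + h *\<^sub>R ?e) - u i x = h * P i N (x + t *\<^sub>R ?e)" by auto
      have "\<bar>v x\<bar> = \<bar>\<phi> i (x + t *\<^sub>R ?e)\<bar>" unfolding v_def t(3) using h by simp
      also have "\<dots> \<le> \<Phi> (x + t *\<^sub>R ?e)" by (rule \<phi>_le_\<Phi>)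
      also have "\<dots> \<le> M" by (rule near[OF x t(1,2)])
      finally show "\<bar>v x\<bar> \<le> M" .
      have "\<exists>t. t > 0 \<and> t < h \<and> f i (x + h *\<^sub>R ?e) - f i (x + 0 *\<^sub>R ?e) = (h - 0) * (\<Sum>j\<in>UNIV. c i j (x + t *\<^sub>R ?e) * P j N (x + t *\<^sub>R ?e))"
        by (rule MVT2) (use h has_grad_line_axis[OF grad_f, of i x N] in auto)
      then obtain t where t: "t > 0" "t < h" "f i (x + h *\<^sub>R ?e) - f i x = h * (\<Sum>j\<in>UNIV. c i j (x + t *\<^sub>R ?e) * P j N (x + t *\<^sub>R ?e))" by auto
      have "(\<Sum>j\<in>UNIV. v2 j j x) = 1 / h * (f i (x + h *\<^sub>R ?e) - f i x)"
        unfolding v2_def equation[symmetric] sum_subtractf[symmetric] sum_distrib_left ..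
      then have "\<bar>\<Sum>j\<in>UNIV. v2 j j x\<bar> = \<bar>\<Sum>j\<in>UNIV. c i j (x + t *\<^sub>R ?e) * P j N (x + t *\<^sub>R ?e)\<bar>" using t h by simp
      also have "\<dots> \<le> (\<Sum>j\<in>(UNIV::'m set). \<Lambda> * M)"
      proof (rule order_trans[OF sum_abs sum_mono])
        fix j
        have "\<bar>P j N (x + t *\<^sub>R ?e)\<bar> \<le> M" using \<phi>_le_\<Phi>[of j "x + t *\<^sub>R ?e"] near[OF x t(1,2)] by linarith
        then show "\<bar>c i j (x + t *\<^sub>R ?e) * P j N (x + t *\<^sub>R ?e)\<bar> \<le> \<Lambda> * M"
          unfolding abs_mult by (intro mult_mono c_bound \<Lambda>_nonneg) auto
      qed
      finally show "\<bar>\<Sum>j\<in>UNIV. v2 j j x\<bar> \<le> real CARD('m) * \<Lambda> * M" by simp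
    qed simp
    also have "\<dots> \<le> C" using M0 \<Lambda>_nonneg by (simp add: C_def algebra_simps)
    finally show ?thesis by (simp add: v1_def)
  qed
  have "((\<lambda>t. P i k (y + t *\<^sub>R ?e)) has_real_derivative D i k N y) (at 0)"
    using has_grad_line_axis[OF grad_P, of i k y N 0] by simp
  then have "((\<lambda>h. (P i k (y + h *\<^sub>R ?e) - P i k y) / h) \<longlongrightarrow> D i k N y) (at 0)"
    unfolding has_field_derivative_iff by simp
  then have "((\<lambda>h. \<bar>(P i k (y + h *\<^sub>R ?e) - P i k y) / h\<bar>) \<longlongrightarrow> \<bar>D i k N y\<bar>) (at_right 0)"
    by (intro tendsto_rabs tendsto_mono[OF at_le[of "{0<..}" UNIV]]) auto
  moreover have "\<forall>\<^sub>F h in at_right 0. \<bar>(P i k (y + h *\<^sub>R ?e) - P i k y) / h\<bar> \<le> C"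
  proof -
    have "\<forall>\<^sub>F t in at_right 0. t \<in> {0<..<1::real}"
      by (rule eventually_at_right_field[THEN iffD2]) (auto intro: exI[of _ 1])
    then show ?thesis by eventually_elim (use est in auto)
  qed
  ultimately have "\<bar>D i k N y\<bar> \<le> C" by (intro tendsto_upperbound) auto
  then show ?thesis by (simp add: C_def D_sym[of i N])
qed

end

section \<open>Averages of the derivative in the monotone direction\<close>

text \<open>The kernel is a product of Cauchy profiles because their logarithmic derivative is bounded:
  averages formed with the kernel at scale \<open>R\<close> have a gradient of at most \<open>1 / R\<close> times their value.\<close>

definition cauchy :: "real \<Rightarrow> real" where "cauchy s = 1 / (1 + s^2)"
definition cauchy' :: "real \<Rightarrow> real" where "cauchy' s = - (2 * s) / (1 + s^2)^2"

lemma cauchy_den: "1 + s^2 > (0::real)" "1 + s^2 \<noteq> (0::real)"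
  using zero_le_power2[of s] by linarith+

lemma cauchy_pos: "cauchy s > 0" using cauchy_den[of s] by (simp add: cauchy_def)
lemma cauchy_le1: "cauchy s \<le> 1" using cauchy_den[of s] by (simp add: cauchy_def)

lemma cauchy_deriv: "(cauchy has_real_derivative cauchy' s) (at s)"
proof -
  have eq: "cauchy = (\<lambda>s. 1 / (1 + s^2))" by (rule ext) (rule cauchy_def)
  show ?thesis unfolding eq cauchy'_def using cauchy_den(2)[of s]
    by (auto intro!: derivative_eq_intros simp: power2_eq_square)
qed

lemma cauchy_cont: "continuous_on S cauchy" "continuous_on S cauchy'"
  unfolding cauchy_def cauchy'_def using cauchy_den(2) by (auto intro!: continuous_intros)

lemma cauchy'_bound: "\<bar>cauchy' s\<bar> \<le> cauchy s"
proof -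
  have "0 \<le> (\<bar>s\<bar> - 1)^2" by simp
  then have "2 * \<bar>s\<bar> \<le> 1 + s^2" by (simp add: power2_eq_square algebra_simps)
  then have "2 * \<bar>s\<bar> / (1 + s^2)^2 \<le> (1 + s^2) / (1 + s^2)^2" by (rule divide_right_mono) simp
  also have "\<dots> = cauchy s" using cauchy_den(2)[of s] by (simp add: cauchy_def power2_eq_square)
  finally show ?thesis by (simp add: cauchy'_def abs_divide abs_mult)
qed

definition ker :: "real \<Rightarrow> real^'n::finite \<Rightarrow> real" where
  "ker R z = (\<Prod>j\<in>UNIV. cauchy (z $ j / R))"
definition ker' :: "real \<Rightarrow> 'n \<Rightarrow> real^'n::finite \<Rightarrow> real" where
  "ker' R k z = cauchy' (z $ k / R) / R * (\<Prod>j\<in>UNIV-{k}. cauchy (z $ j / R))"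

lemma has_grad_cauchy_nth: "has_grad (\<lambda>x. cauchy (x $ j / r)) (\<lambda>k x. cauchy' (x $ j / r) / r * (if k = j then 1 else 0))"
  using has_grad_compose'[OF has_grad_cmult[OF has_grad_nth[of j], of "1/r"] cauchy_deriv cauchy_cont(2)]
  by (simp add: mult.assoc[symmetric])

lemma has_grad_ker: "has_grad (ker R) (ker' R)"
proof -
  have hg: "has_grad (\<lambda>x. \<Prod>j\<in>UNIV. cauchy (x $ j / R))
     (\<lambda>k x. \<Sum>i\<in>UNIV. (cauchy' (x $ i / R) / R * (if k = i then 1 else 0)) * (\<Prod>j\<in>UNIV-{i}. cauchy (x $ j / R)))"
    by (intro has_grad_prod has_grad_cauchy_nth) auto
  have e1: "(\<lambda>x. \<Prod>j\<in>UNIV. cauchy (x $ j / R)) = ker R" by (simp add: ker_def fun_eq_iff)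
  have e2: "(\<lambda>k x. \<Sum>i\<in>UNIV. (cauchy' (x $ i / R) / R * (if k = i then 1 else 0)) * (\<Prod>j\<in>UNIV-{i}. cauchy (x $ j / R))) = ker' R"
  proof (intro ext)
    fix k x
    have "(\<Sum>i\<in>UNIV. (cauchy' (x $ i / R) / R * (if k = i then 1 else 0)) * (\<Prod>j\<in>UNIV-{i}. cauchy (x $ j / R)))
        = (\<Sum>i\<in>UNIV. if k = i then ker' R i x else 0)"
      by (intro sum.cong) (auto simp: ker'_def)
    then show "(\<Sum>i\<in>UNIV. (cauchy' (x $ i / R) / R * (if k = i then 1 else 0)) * (\<Prod>j\<in>UNIV-{i}. cauchy (x $ j / R))) = ker' R k x"
      by simp
  qed
  show ?thesis using hg unfolding e1 e2 .
qed

lemma ker_pos: "ker R z > 0" unfolding ker_def by (intro prod_pos) (simp add: cauchy_pos)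

lemma ker'_bound: assumes "R > 0" shows "\<bar>ker' R k z\<bar> \<le> ker R z / R"
proof -
  have "ker R z = cauchy (z $ k / R) * (\<Prod>j\<in>UNIV-{k}. cauchy (z $ j / R))"
    unfolding ker_def by (rule prod.remove) auto
  moreover have "\<bar>ker' R k z\<bar> = \<bar>cauchy' (z $ k / R)\<bar> / R * (\<Prod>j\<in>UNIV-{k}. cauchy (z $ j / R))"
    using assms by (simp add: ker'_def abs_mult abs_divide abs_prod cauchy_pos less_imp_le)
  moreover have "\<bar>cauchy' (z $ k / R)\<bar> / R * (\<Prod>j\<in>UNIV-{k}. cauchy (z $ j / R)) \<le> cauchy (z $ k / R) / R * (\<Prod>j\<in>UNIV-{k}. cauchy (z $ j / R))"
    using assms by (intro mult_right_mono divide_right_mono cauchy'_bound prod_nonneg) (auto simp: cauchy_pos less_imp_le)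
  ultimately show ?thesis by simp
qed

lemma cont_ker: "continuous_on S (ker R)" by (rule has_grad_continuous[OF has_grad_ker])
lemma cont_ker': "continuous_on S (ker' R k)" by (rule has_grad_cont_grad[OF has_grad_ker])

lemma cauchy_ratio: assumes "\<bar>s - t\<bar> \<le> a" shows "cauchy t \<le> (1 + 2 * a^2 + 2) * cauchy s"
proof -
  have "s^2 = (t + (s - t))^2" by simp
  also have "\<dots> \<le> 2 * t^2 + 2 * (s - t)^2"
    using zero_le_power2[of "t - (s - t)"] by (simp add: power2_eq_square algebra_simps)
  also have "(s - t)^2 \<le> a^2" using assms by (simp add: abs_le_square_iff[symmetric])
  finally have "s^2 \<le> 2 * t^2 + 2 * a^2" by simp
  moreover have "0 \<le> a^2 * t^2" "0 \<le> t^2" by simp_all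
  moreover have "(1 + 2 * a^2 + 2) * (1 + t^2) = 3 + 2 * a^2 + 3 * t^2 + 2 * (a^2 * t^2)"
    by (simp add: algebra_simps)
  ultimately have "1 + s^2 \<le> (1 + 2 * a^2 + 2) * (1 + t^2)" by linarith
  then show ?thesis using cauchy_den[of s] cauchy_den[of t] by (simp add: cauchy_def field_simps)
qed

lemma ker_mono: assumes "R \<ge> 1" shows "ker 1 z \<le> ker R z"
  unfolding ker_def
proof (rule prod_mono, rule conjI)
  fix j
  show "0 \<le> cauchy (z $ j / 1)" by (simp add: cauchy_pos less_imp_le)
  have "(z $ j / R)^2 \<le> (z $ j)^2"
  proof -
    have "\<bar>z $ j / R\<bar> \<le> \<bar>z $ j\<bar>" using assms by (simp add: abs_divide divide_le_eq mult_right_mono mult_le_cancel_left1)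
    then show ?thesis by (simp only: abs_le_square_iff)
  qed
  then show "cauchy (z $ j / 1) \<le> cauchy (z $ j / R)" using cauchy_den[of "z $ j / R"] by (simp add: cauchy_def frac_le)
qed

lemma has_grad_cauchy_nth': "has_grad (\<lambda>x. cauchy ((x $ j - b) / r)) (\<lambda>k x. cauchy' ((x $ j - b) / r) / r * (if k = j then 1 else 0))"
  using has_grad_compose'[OF has_grad_cmult[OF has_grad_diff[OF has_grad_nth[of j] has_grad_const[of b]], of "1/r"] cauchy_deriv cauchy_cont(2)]
  by (simp add: mult.assoc[symmetric])

text \<open>A factor \<open>cauchy ((y\<^sub>k - a\<^sub>k) / R)\<close> is the derivative of the bounded function
  \<open>R arctan ((y\<^sub>k - a\<^sub>k) / R)\<close>. Integration by parts moves this derivative to the cutoff, which costs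
  \<open>R / T\<close> and a doubling of the box, for one coordinate after the other.\<close>

lemma kernel_integral:
  fixes r a :: "'n::finite \<Rightarrow> real"
  assumes R: "R > 0" and T: "T > 0" and r: "\<And>j. r j > 0" "\<And>j. j \<in> S \<Longrightarrow> r j \<ge> T" and S: "finite S"
  shows "(\<integral>y. eta r y * (\<Prod>j\<in>S. cauchy ((y $ j - a j) / R)) \<partial>lborel)
     \<le> (2 * bumpK * R / T) ^ card S * (\<integral>y. eta (\<lambda>j. 2 ^ card S * r j) y \<partial>lborel)"
  using S r
proof (induction S arbitrary: r rule: finite_induct)
  case empty then show ?case by simp
next
  case (insert k S)
  note rp = insert.prems(1)
  define w where "w y = (\<Prod>j\<in>S. cauchy ((y $ j - a j) / R))" for y :: "real^'n"
  define w' where "w' m y = (\<Sum>i\<in>S. (cauchy' ((y $ i - a i) / R) / R * (if m = i then 1 else 0)) * (\<Prod>j\<in>S-{i}. cauchy ((y $ j - a j) / R)))" for m and y :: "real^'n"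
  have gw: "has_grad w w'" unfolding w_def w'_def by (intro has_grad_prod has_grad_cauchy_nth') (rule insert.hyps)
  have w'k: "w' k y = 0" for y
    unfolding w'_def using insert.hyps(2) by (intro sum.neutral) auto
  have w0: "w y \<ge> 0" for y unfolding w_def by (intro prod_nonneg) (simp add: cauchy_pos less_imp_le)
  have ga: "has_grad (\<lambda>x. R * arctan ((x $ k - a k) / R)) (\<lambda>m x. cauchy ((x $ k - a k) / R) * (if m = k then 1 else 0))"
  proof -
    have "has_grad (\<lambda>x. R * arctan (1 / R * (x $ k - a k))) (\<lambda>m x. (R * inverse (1 + (1/R * (x $ k - a k))^2)) * (1/R * ((if m = k then 1 else 0) - 0)))"
    proof (rule has_grad_compose'[where F="\<lambda>s. R * arctan s" and F'="\<lambda>s. R * inverse (1 + s^2)"])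
      show "((\<lambda>s. R * arctan s) has_real_derivative R * inverse (1 + y\<^sup>2)) (at y)" for y
        by (rule DERIV_cmult[OF DERIV_arctan])
      show "continuous_on UNIV (\<lambda>s::real. R * inverse (1 + s^2))" using cauchy_den(2) by (intro continuous_intros) auto
      show "has_grad (\<lambda>x. 1 / R * (x $ k - a k)) (\<lambda>m x. 1 / R * ((if m = k then 1 else 0) - 0))"
        by (intro has_grad_cmult has_grad_diff has_grad_nth has_grad_const)
    qed
    moreover have "(\<lambda>m x. (R * inverse (1 + (1/R * (x $ k - a k))^2)) * (1/R * ((if m = k then 1 else 0) - 0))) = (\<lambda>m x. cauchy ((x $ k - a k) / R) * (if m = k then 1 else 0))"
      using R by (auto simp: fun_eq_iff cauchy_def divide_inverse mult.commute)
    ultimately show ?thesis by simp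
  qed
  have gm: "has_grad (\<lambda>x. (R * arctan ((x $ k - a k) / R)) * w x) (\<lambda>m x. (cauchy ((x $ k - a k) / R) * (if m = k then 1 else 0)) * w x + (R * arctan ((x $ k - a k) / R)) * w' m x)"
    by (rule has_grad_mult[OF ga gw])
  have supp: "bounded {x. eta r x \<noteq> 0}" using eta_support[of r] rp by simp
  have cce: "cc (eta r)" "cc (eta' r k)" for k using cc_eta[of r] rp by auto
  have cce2: "cc (eta (\<lambda>j. 2 * r j))" using cc_eta[of "\<lambda>j. 2 * r j"] rp by auto
  have wi: "(\<Prod>j\<in>insert k S. cauchy ((y $ j - a j) / R)) = cauchy ((y $ k - a k) / R) * w y" for y :: "real^'n"
    using insert.hyps by (simp add: w_def)
  have "(\<integral>y. eta r y * (\<Prod>j\<in>insert k S. cauchy ((y $ j - a j) / R)) \<partial>lborel) = - (\<integral>y. eta' r k y * ((R * arctan ((y $ k - a k) / R)) * w y) \<partial>lborel)"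
    using integral_by_parts[OF has_grad_eta gm supp, of k] by (simp add: wi w'k)
  also have "\<dots> = (\<integral>y. - (eta' r k y * ((R * arctan ((y $ k - a k) / R)) * w y)) \<partial>lborel)" by simp
  also have "\<dots> \<le> (\<integral>y. (2 * bumpK * R / T) * (eta (\<lambda>j. 2 * r j) y * w y) \<partial>lborel)"
  proof (rule cc_mono)
    show "cc (\<lambda>y. - (eta' r k y * ((R * arctan ((y $ k - a k) / R)) * w y)))"
      by (intro cc_uminus cc_mult_right cce has_grad_continuous[OF gm])
    show "cc (\<lambda>y. (2 * bumpK * R / T) * (eta (\<lambda>j. 2 * r j) y * w y))"
      by (intro cc_cmult cc_mult_right cce2 has_grad_continuous[OF gw])
    fix y :: "real^'n"
    have 1: "\<bar>eta' r k y\<bar> \<le> bumpK / r k * eta (\<lambda>j. 2 * r j) y" by (rule eta'_bound) (auto simp: rp)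
    also have "\<dots> \<le> bumpK / T * eta (\<lambda>j. 2 * r j) y"
      using insert.prems(2)[of k] T bumpK(1) by (intro mult_right_mono eta_range frac_le) auto
    finally have e: "\<bar>eta' r k y\<bar> \<le> bumpK / T * eta (\<lambda>j. 2 * r j) y" .
    have "\<bar>arctan ((y $ k - a k) / R)\<bar> \<le> 2" using arctan_bounded[of "(y $ k - a k) / R"] pi_less_4 by (auto simp: abs_le_iff)
    then have a: "\<bar>R * arctan ((y $ k - a k) / R)\<bar> \<le> R * 2" using R by (simp add: abs_mult)
    have "- (eta' r k y * ((R * arctan ((y $ k - a k) / R)) * w y)) \<le> \<bar>eta' r k y\<bar> * (\<bar>R * arctan ((y $ k - a k) / R)\<bar> * w y)"
      using abs_ge_minus_self[of "eta' r k y * ((R * arctan ((y $ k - a k) / R)) * w y)"] w0[of y] by (simp add: abs_mult)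
    also have "\<dots> \<le> (bumpK / T * eta (\<lambda>j. 2 * r j) y) * (R * 2 * w y)"
      by (intro mult_mono e a) (use w0 T R bumpK(1) in \<open>auto intro!: mult_nonneg_nonneg divide_nonneg_nonneg eta_range simp: less_imp_le\<close>)
    finally show "- (eta' r k y * ((R * arctan ((y $ k - a k) / R)) * w y)) \<le> (2 * bumpK * R / T) * (eta (\<lambda>j. 2 * r j) y * w y)"
      by (simp add: mult_ac)
  qed
  also have "\<dots> = (2 * bumpK * R / T) * (\<integral>y. eta (\<lambda>j. 2 * r j) y * w y \<partial>lborel)" by simp
  also have "\<dots> \<le> (2 * bumpK * R / T) * ((2 * bumpK * R / T) ^ card S * (\<integral>y. eta (\<lambda>j. 2 ^ card S * (2 * r j)) y \<partial>lborel))"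
    unfolding w_def
  proof (intro mult_left_mono insert.IH)
    show "0 < 2 * r j" for j using rp[of j] by simp
    show "T \<le> 2 * r j" if "j \<in> S" for j using insert.prems(2)[of j] rp[of j] that by auto
  qed (use R T bumpK(1) in simp)
  also have "(\<lambda>j. 2 ^ card S * (2 * r j)) = (\<lambda>j. 2 ^ card (insert k S) * r j)"
    using insert.hyps by (simp add: fun_eq_iff)
  also have "(2 * bumpK * R / T) * ((2 * bumpK * R / T) ^ card S * (\<integral>y. eta (\<lambda>j. 2 ^ card (insert k S) * r j) y \<partial>lborel))
     = (2 * bumpK * R / T) ^ card (insert k S) * (\<integral>y. eta (\<lambda>j. 2 ^ card (insert k S) * r j) y \<partial>lborel)"
    using insert.hyps by simp
  finally show ?case .
qed

lemma ker_ratio: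
  fixes y z :: "real^'k::finite"
  assumes "\<And>j. \<bar>y $ j - z $ j\<bar> \<le> 3" shows "ker 1 z \<le> 21 ^ CARD('k) * ker 1 y"
proof -
  have "ker 1 z \<le> (\<Prod>j\<in>(UNIV::'k set). 21 * cauchy (y $ j / 1))"
    unfolding ker_def
  proof (rule prod_mono, rule conjI)
    fix j
    show "0 \<le> cauchy (z $ j / 1)" by (simp add: cauchy_pos less_imp_le)
    show "cauchy (z $ j / 1) \<le> 21 * cauchy (y $ j / 1)"
      using cauchy_ratio[of "y $ j" "z $ j" 3] assms[of j] by simp
  qed
  also have "\<dots> = 21 ^ CARD('k) * ker 1 y" by (simp add: prod.distrib ker_def)
  finally show ?thesis .
qed

lemma has_grad_average:
  fixes g :: "real^'k::finite \<Rightarrow> real"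
  assumes g: "cc g"
  shows "has_grad (\<lambda>x. \<integral>y. g y * ker R (x - y) \<partial>lborel) (\<lambda>k x. \<integral>y. g y * ker' R k (x - y) \<partial>lborel)"
proof (rule has_grad_partials)
  have bg: "bounded {y. g y \<noteq> 0}" using g by (simp add: cc_def)
  have cg: "continuous_on UNIV g" by (rule cc_cont[OF g])
  fix k :: 'k
  show "continuous_on UNIV (\<lambda>x. \<integral>y. g y * ker' R k (x - y) \<partial>lborel)"
  proof (rule cont_param_cc[OF _ bg])
    show "continuous_on UNIV (\<lambda>(x, y). g y * ker' R k (x - y))"
      unfolding case_prod_beta
      by (intro continuous_intros continuous_on_compose2[OF cg] continuous_on_compose2[OF cont_ker'[of UNIV]]) auto
  qed simp
  fix x :: "real^'k"
  let ?e = "axis k (1::real)"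
  have "((\<lambda>t. \<integral>y. g y * ker R (x + t *\<^sub>R ?e - y) \<partial>lborel) has_real_derivative (\<integral>y. g y * ker' R k (x + 0 *\<^sub>R ?e - y) \<partial>lborel)) (at 0)"
  proof (rule leibniz_cc[OF _ _ _ bg])
    show "((\<lambda>t. g y * ker R (x + t *\<^sub>R ?e - y)) has_real_derivative g y * ker' R k (x + t *\<^sub>R ?e - y)) (at t)" for t y
      using DERIV_cmult[OF has_grad_line_axis[OF has_grad_ker, of R "x - y" k t], of "g y"] by (simp add: algebra_simps)
    show "continuous_on UNIV (\<lambda>(t, y). g y * ker' R k (x + t *\<^sub>R ?e - y))"
      unfolding case_prod_beta
      by (intro continuous_intros continuous_on_compose2[OF cg] continuous_on_compose2[OF cont_ker'[of UNIV]]) auto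
    show "continuous_on UNIV (\<lambda>y. g y * ker R (x + t *\<^sub>R ?e - y))" for t
      by (intro continuous_intros cg continuous_on_compose2[OF cont_ker[of UNIV]]) auto
  qed simp
  then show "((\<lambda>t. \<integral>y. g y * ker R (x + t *\<^sub>R ?e - y) \<partial>lborel) has_real_derivative (\<integral>y. g y * ker' R k (x - y) \<partial>lborel)) (at 0)"
    by simp
qed

context monotone_system
begin

text \<open>As \<open>\<phi>\<^sub>i\<close> has a constant sign, its modulus is the \<open>N\<close>-derivative of \<open>u\<^sub>i\<close> or \<open>-u\<^sub>i\<close>. Integration by
  parts leaves a bounded function on the cylinder, whose volume is of order \<open>R\<^sup>2 L\<close>, times the
  \<open>N\<close>-derivative of the cutoff, which is of order \<open>1 / L\<close>.\<close>

lemma mass_bound: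
  assumes "R \<ge> 1" "L > 0"
  shows "(\<integral>x. eta (tall N R L) x * \<bar>\<phi> i x\<bar> \<partial>lborel) \<le> 512 * bumpK * U * R^2"
proof -
  have p: "tall N R L j > 0" for j using assms by (simp add: tall_def)
  have p2: "tall N (2*R) (2*L) j > 0" for j using assms by (simp add: tall_def)
  obtain s where s: "\<bar>s\<bar> = 1" "\<And>x. \<bar>\<phi> i x\<bar> = s * \<phi> i x" using sign_\<phi>[of i] by blast
  have "(\<integral>x. eta (tall N R L) x * \<bar>\<phi> i x\<bar> \<partial>lborel) = s * (\<integral>x. eta (tall N R L) x * \<phi> i x \<partial>lborel)"
    unfolding s(2) by (simp add: mult.left_commute)
  also have "\<dots> = - s * (\<integral>x. eta' (tall N R L) N x * u i x \<partial>lborel)"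
    using integral_by_parts[OF has_grad_eta grad_u eta_support, of "tall N R L" N i] p by simp
  also have "\<dots> = (\<integral>x. - s * (eta' (tall N R L) N x * u i x) \<partial>lborel)" by simp
  also have "\<dots> \<le> (\<integral>x. bumpK / L * U * eta (tall N (2*R) (2*L)) x \<partial>lborel)"
  proof (rule cc_mono)
    show "cc (\<lambda>x. - s * (eta' (tall N R L) N x * u i x))"
      by (intro cc_cmult cc_mult_right cc_eta p cont_u)
    show "cc (\<lambda>x. bumpK / L * U * eta (tall N (2*R) (2*L)) x)" by (intro cc_cmult cc_eta p2)
    fix x
    have "\<bar>eta' (tall N R L) N x\<bar> \<le> bumpK / tall N R L N * eta (tall N (2*R) (2*L)) x"
      by (rule eta'_bound) (use assms in \<open>auto simp: tall_def\<close>)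
    then have 1: "\<bar>eta' (tall N R L) N x\<bar> \<le> bumpK / L * eta (tall N (2*R) (2*L)) x" by (simp add: tall_def)
    have "- s * (eta' (tall N R L) N x * u i x) \<le> \<bar>- s * (eta' (tall N R L) N x * u i x)\<bar>" by simp
    also have "\<dots> = \<bar>eta' (tall N R L) N x\<bar> * \<bar>u i x\<bar>" using s(1) by (simp add: abs_mult)
    also have "\<dots> \<le> (bumpK / L * eta (tall N (2*R) (2*L)) x) * U"
      by (intro mult_mono 1 u_bound) (use assms bumpK(1) eta_range in \<open>auto intro!: mult_nonneg_nonneg divide_nonneg_nonneg simp: less_imp_le\<close>)
    finally show "- s * (eta' (tall N R L) N x * u i x) \<le> bumpK / L * U * eta (tall N (2*R) (2*L)) x"
      by (simp add: mult_ac)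
  qed
  also have "\<dots> = bumpK / L * U * (\<integral>x. eta (tall N (2*R) (2*L)) x \<partial>lborel)" by simp
  also have "\<dots> \<le> bumpK / L * U * (64 * (2*R)^2 * (2*L))"
    by (intro mult_left_mono integral_eta_tall dim) (use assms bumpK(1) U_nonneg in \<open>auto intro!: mult_nonneg_nonneg divide_nonneg_nonneg simp: less_imp_le\<close>)
  also have "\<dots> = 512 * bumpK * U * R^2" using assms by (simp add: power2_eq_square)
  finally show ?thesis .
qed

text \<open>This is the linearized equation for \<open>\<phi>\<^sub>i\<close> tested with \<open>\<xi>\<^sup>2 / \<phi>\<^sub>i\<close>. The sign condition on the coupling
  discards all coefficients off the diagonal.\<close>

lemma log_gradient_bound:
  assumes xi: "has_grad \<xi> \<xi>'" "bounded {x. \<xi> x \<noteq> 0}"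
  shows "(\<integral>x. (\<xi> x)^2 * (\<Sum>k\<in>UNIV. (D i N k x / \<phi> i x)^2) \<partial>lborel)
    \<le> (\<integral>x. 4 * (\<Sum>k\<in>UNIV. (\<xi>' k x)^2) + 2 * \<Lambda> * (\<xi> x)^2 \<partial>lborel)"
proof -
  note ccx = has_grad_cc[OF xi]
  have ne: "\<phi> i x \<noteq> 0" for x by (rule monotone)
  define \<zeta> where "\<zeta> x = \<xi> x * \<xi> x / \<phi> i x" for x
  define \<zeta>' where "\<zeta>' k x = ((\<xi>' k x * \<xi> x + \<xi> x * \<xi>' k x) * \<phi> i x - \<xi> x * \<xi> x * D i N k x) / (\<phi> i x)^2" for k x
  have z: "has_grad \<zeta> \<zeta>'" unfolding \<zeta>_def \<zeta>'_def
    by (intro has_grad_divide has_grad_mult xi grad_P monotone)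
  have bz: "bounded {x. \<zeta> x \<noteq> 0}" by (rule bounded_subset[OF xi(2)]) (auto simp: \<zeta>_def)
  note ccz = has_grad_cc[OF z bz]
  have weak: "(\<integral>x. (\<Sum>k\<in>UNIV. D i N k x * \<zeta>' k x) \<partial>lborel) + (\<integral>x. (\<Sum>j\<in>UNIV. c i j x * \<phi> j x) * \<zeta> x \<partial>lborel) = 0"
    using weak_linearized[OF z bz, of i N] by simp
  let ?L = "\<lambda>x. (\<xi> x)^2 * (\<Sum>k\<in>UNIV. (D i N k x / \<phi> i x)^2)"
  let ?R = "\<lambda>x. 4 * (\<Sum>k\<in>UNIV. (\<xi>' k x)^2) + 2 * \<Lambda> * (\<xi> x)^2"
  let ?A = "\<lambda>x. (\<Sum>k\<in>UNIV. D i N k x * \<zeta>' k x)" and ?B = "\<lambda>x. (\<Sum>j\<in>UNIV. c i j x * \<phi> j x) * \<zeta> x"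
  have ccA: "cc ?A" "cc ?B" by (intro cc_sum cc_mult_left ccz cont_D continuous_intros cont_c cont_P)+
  have ccL: "cc ?L" unfolding power2_eq_square
    by (intro cc_mult_right ccx continuous_intros cont_D cont_P cc_cont[OF ccx(1)]) (auto simp: ne)
  have ccR: "cc ?R" unfolding power2_eq_square
    by (intro cc_add cc_cmult cc_sum cc_mult_right ccx cc_cont[OF ccx(1)] cc_cont[OF ccx(2)])
  have pt: "?L x \<le> ?R x - 2 * (?A x + ?B x)" for x
  proof -
    have k: "\<xi> x ^2 * (D i N k x / \<phi> i x)^2 + 2 * (D i N k x * \<zeta>' k x) \<le> 4 * (\<xi>' k x)^2" for k
    proof -
      define q where "q = D i N k x / \<phi> i x"
      have "D i N k x * \<zeta>' k x = 2 * \<xi> x * \<xi>' k x * q - (\<xi> x)^2 * q^2"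
        using ne[of x] by (simp add: q_def \<zeta>'_def field_simps power2_eq_square)
      moreover have "0 \<le> (\<xi> x * q - 2 * \<xi>' k x)^2" by simp
      ultimately show ?thesis unfolding q_def[symmetric] by (simp add: power2_eq_square algebra_simps)
    qed
    have "(\<Sum>k\<in>UNIV. \<xi> x ^2 * (D i N k x / \<phi> i x)^2 + 2 * (D i N k x * \<zeta>' k x)) \<le> (\<Sum>k\<in>UNIV. 4 * (\<xi>' k x)^2)"
      by (intro sum_mono k)
    then have 1: "?L x + 2 * ?A x \<le> 4 * (\<Sum>k\<in>UNIV. (\<xi>' k x)^2)"
      by (simp add: sum.distrib sum_distrib_left[symmetric])
    have "?B x = (\<Sum>j\<in>UNIV. c i j x * \<phi> j x / \<phi> i x) * (\<xi> x)^2"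
      by (simp add: \<zeta>_def power2_eq_square sum_divide_distrib[symmetric])
    also have "\<dots> \<le> \<Lambda> * (\<xi> x)^2"
    proof (rule mult_right_mono)
      have "(\<Sum>j\<in>UNIV. c i j x * \<phi> j x / \<phi> i x) = c i i x * \<phi> i x / \<phi> i x + (\<Sum>j\<in>UNIV-{i}. c i j x * \<phi> j x / \<phi> i x)"
        by (rule sum.remove) auto
      also have "(\<Sum>j\<in>UNIV-{i}. c i j x * \<phi> j x / \<phi> i x) \<le> 0"
      proof (rule sum_nonpos)
        fix j assume "j \<in> UNIV - {i}"
        then have "c i j x * \<phi> i x * \<phi> j x \<le> 0" using coupling[of i j x] by auto
        then have "c i j x * \<phi> i x * \<phi> j x / (\<phi> i x)^2 \<le> 0" by (rule divide_nonpos_nonneg) simp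
        then show "c i j x * \<phi> j x / \<phi> i x \<le> 0" using ne[of x] by (simp add: power2_eq_square)
      qed
      also have "c i i x * \<phi> i x / \<phi> i x \<le> \<Lambda>" using ne[of x] c_bound[of i i x] by simp
      finally show "(\<Sum>j\<in>UNIV. c i j x * \<phi> j x / \<phi> i x) \<le> \<Lambda>" by simp
    qed simp
    finally have 2: "?B x \<le> \<Lambda> * (\<xi> x)^2" .
    from 2 have "2 * ?B x \<le> 2 * \<Lambda> * (\<xi> x)^2" by simp
    with 1 show ?thesis by (simp only: distrib_left)
  qed
  have "(\<integral>x. ?L x \<partial>lborel) \<le> (\<integral>x. ?R x - 2 * (?A x + ?B x) \<partial>lborel)"
    by (rule cc_mono[OF ccL _ pt]) (intro cc_diff ccR cc_cmult cc_add ccA)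
  also have "\<dots> = (\<integral>x. ?R x \<partial>lborel) - (\<integral>x. 2 * (?A x + ?B x) \<partial>lborel)"
    by (rule integral_cc_diff[OF ccR cc_cmult[OF cc_add[OF ccA]]])
  also have "(\<integral>x. 2 * (?A x + ?B x) \<partial>lborel) = 2 * (\<integral>x. ?A x + ?B x \<partial>lborel)" by (rule integral_mult_right_zero)
  also have "(\<integral>x. ?A x + ?B x \<partial>lborel) = (\<integral>x. ?A x \<partial>lborel) + (\<integral>x. ?B x \<partial>lborel)"
    by (rule integral_cc_add[OF ccA])
  finally show ?thesis using weak by simp
qed

text \<open>At a maximum point \<open>y\<^sub>0\<close> of \<open>\<Phi>\<close> times the kernel over a box around \<open>x\<close>, the values of \<open>\<Phi>\<close> within
  distance \<open>3\<close> are bounded by a multiple of \<open>\<Phi> y\<^sub>0\<close>, since the kernel changes by a bounded factor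
  there. The gradient bound then keeps \<open>\<Phi>\<close> above half of \<open>\<Phi> y\<^sub>0\<close> on a cube of fixed size, and the
  integral sees this cube. The last term accounts for maxima close to the boundary of the box,
  where the kernel is small.\<close>

lemma local_sup:
  "\<exists>C>0. \<forall>x \<rho> T. 4 \<le> \<rho> \<longrightarrow> (\<forall>j. \<bar>x $ j\<bar> + \<rho> \<le> T) \<longrightarrow>
     \<Phi> x \<le> C * (\<integral>y. eta (\<lambda>_. T) y * \<Phi> y * ker 1 (x - y) \<partial>lborel) + C / \<rho>"
proof -
  define n where "n = CARD('n)"
  define m where "m = real CARD('m)"
  define C1 where "C1 = real n + m * \<Lambda>"
  define K where "K = (21::real) ^ n"
  \<comment> \<open>The side of the cube on which \<open>\<Phi>\<close> loses at most half of its value.\<close>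
  define r where "r = 1 / (2 * (m * n * C1 * K + 1))"
  have m1: "m \<ge> 1" and n1: "n \<ge> 1" by (auto simp: m_def n_def Suc_leI)
  have C10: "C1 \<ge> 0" using m1 \<Lambda>_nonneg by (simp add: C1_def)
  have K1: "K \<ge> 1" by (simp add: K_def)
  have den: "m * n * C1 * K + 1 \<ge> 1" using m1 C10 K1 by (auto intro!: mult_nonneg_nonneg)
  have r: "0 < r" "r \<le> 1" using den by (auto simp: r_def divide_le_eq)
  have rr: "m * (n * (r * (C1 * K))) \<le> 1 / 2"
  proof -
    have "m * (n * (r * (C1 * K))) = (m * n * C1 * K) / (2 * (m * n * C1 * K + 1))" by (simp add: r_def)
    also have "\<dots> \<le> 1 / 2" using den by (simp add: divide_le_eq)
    finally show ?thesis .
  qed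
  define C where "C = 2 * K / r ^ n + 2 * (m * G) + 1"
  have C: "C > 0" "2 * K / r ^ n \<le> C" "2 * (m * G) \<le> C"
    using K1 r m1 G_nonneg by (auto simp: C_def intro!: add_nonneg_pos add_nonneg_nonneg mult_nonneg_nonneg divide_nonneg_nonneg)
  have main: "\<Phi> x \<le> C * (\<integral>y. eta (\<lambda>_. T) y * \<Phi> y * ker 1 (x - y) \<partial>lborel) + C / \<rho>"
    if \<rho>: "4 \<le> \<rho>" and T: "\<And>j. \<bar>x $ j\<bar> + \<rho> \<le> T" for x \<rho> T
  proof -
    let ?I = "\<integral>y. eta (\<lambda>_. T) y * \<Phi> y * ker 1 (x - y) \<partial>lborel"
    have Tp: "T > 0" using T[of N] \<rho> by linarith
    have cker: "continuous_on S (\<lambda>y. ker 1 (x - y))" for S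
      by (rule continuous_on_compose2[OF cont_ker[of UNIV]]) (auto intro!: continuous_intros)
    have I0: "?I \<ge> 0" by (intro cc_nonneg mult_nonneg_nonneg eta_range \<Phi>_nonneg less_imp_le[OF ker_pos])
    define Q where "Q = cbox (\<chi> j. x $ j - \<rho>) (\<chi> j. x $ j + \<rho>)"
    have memQ: "y \<in> Q \<longleftrightarrow> (\<forall>j. \<bar>y $ j - x $ j\<bar> \<le> \<rho>)" for y
      unfolding Q_def mem_box_cart by (rule all_cong1) (auto simp: abs_le_iff)
    define F where "F y = \<Phi> y * ker 1 (x - y)" for y
    have "x \<in> Q" using \<rho> by (simp add: memQ)
    moreover have "continuous_on Q F" unfolding F_def by (intro continuous_intros cont_\<Phi> cker)
    ultimately obtain y0 where y0: "y0 \<in> Q" "\<And>y. y \<in> Q \<Longrightarrow> F y \<le> F y0"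
      using continuous_attains_sup[of Q F] by (auto simp: Q_def)
    have "ker 1 (0::real^'n) = 1" by (simp add: ker_def cauchy_def)
    then have Fx: "F x = \<Phi> x" by (simp add: F_def)
    have le: "\<Phi> x \<le> F y0" using y0(2)[OF \<open>x \<in> Q\<close>] Fx by simp
    show ?thesis
    proof (cases "\<exists>j. \<bar>y0 $ j - x $ j\<bar> > \<rho> - 3")
      case True
      then obtain j where j: "\<bar>y0 $ j - x $ j\<bar> > \<rho> - 3" by blast
      have "ker 1 (x - y0) = cauchy (x $ j - y0 $ j) * (\<Prod>i\<in>UNIV-{j}. cauchy ((x - y0) $ i / 1))"
        unfolding ker_def by (subst prod.remove[of UNIV j]) auto
      also have "\<dots> \<le> cauchy (x $ j - y0 $ j) * 1"
        by (intro mult_left_mono prod_le_1) (auto simp: cauchy_pos cauchy_le1 less_imp_le)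
      also have "\<dots> \<le> 2 / \<rho>"
      proof -
        have "(\<rho> - 3)^2 \<le> (x $ j - y0 $ j)^2"
          using j \<rho> by (simp add: abs_le_square_iff[symmetric])
        moreover have "0 \<le> (\<rho> - 3 - 1)^2" by simp
        ultimately have "\<rho> / 2 \<le> 1 + (x $ j - y0 $ j)^2" using \<rho> by (simp add: power2_eq_square algebra_simps)
        then have "1 / (1 + (x $ j - y0 $ j)^2) \<le> 1 / (\<rho> / 2)" using \<rho> by (intro divide_left_mono) (auto simp: cauchy_den)
        then show ?thesis by (simp add: cauchy_def)
      qed
      finally have "F y0 \<le> (m * G) * (2 / \<rho>)"
        unfolding F_def m_def using \<Phi>_bound[of y0] \<rho> by (intro mult_mono \<Phi>_nonneg less_imp_le[OF ker_pos]) (auto simp: G_nonneg)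
      also have "\<dots> = 2 * (m * G) / \<rho>" by simp
      also have "\<dots> \<le> C / \<rho>" using C \<rho> by (intro divide_right_mono) auto
      finally show ?thesis using le I0 C(1) by (simp add: add_increasing)
    next
      case False
      then have inner: "\<bar>y0 $ j - x $ j\<bar> \<le> \<rho> - 3" for j by (meson not_le)
      have \<Phi>3: "\<Phi> y \<le> K * \<Phi> y0" if y: "\<And>j. \<bar>y $ j - y0 $ j\<bar> \<le> 3" for y
      proof -
        have "y \<in> Q" unfolding memQ
        proof
          fix j show "\<bar>y $ j - x $ j\<bar> \<le> \<rho>" using inner[of j] y[of j] by linarith
        qed
        then have "F y \<le> F y0" by (rule y0(2))
        also have "F y0 \<le> \<Phi> y0 * (K * ker 1 (x - y))"
          unfolding F_def K_def n_def
        proof (intro mult_left_mono ker_ratio \<Phi>_nonneg)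
          fix j show "\<bar>(x - y) $ j - (x - y0) $ j\<bar> \<le> 3" using y[of j] by simp
        qed
        finally have "\<Phi> y * ker 1 (x - y) \<le> (K * \<Phi> y0) * ker 1 (x - y)" by (simp add: F_def mult_ac)
        then show ?thesis using ker_pos[of 1 "x - y"] by simp
      qed
      define E where "E = C1 * (K * \<Phi> y0)"
      have E0: "E \<ge> 0" using C10 K1 \<Phi>_nonneg[of y0] by (simp add: E_def)
      have grad: "\<bar>D i N k y\<bar> \<le> E" if y: "\<And>j. \<bar>y $ j - y0 $ j\<bar> \<le> 1" for y i k
        unfolding E_def C1_def n_def m_def
      proof (rule grad_\<phi>_bound)
        fix z assume z: "\<And>j. \<bar>z $ j - y $ j\<bar> \<le> 2"
        show "\<Phi> z \<le> K * \<Phi> y0"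
        proof (rule \<Phi>3)
          fix j show "\<bar>z $ j - y0 $ j\<bar> \<le> 3" using y[of j] z[of j] by linarith
        qed
      qed
      have low: "\<Phi> y0 / 2 \<le> \<Phi> y" if y: "\<And>j. \<bar>y $ j - y0 $ j\<bar> \<le> r" for y
      proof -
        have d: "\<bar>\<phi> i y0\<bar> \<le> \<bar>\<phi> i y\<bar> + real n * (r * E)" for i
        proof -
          have "\<exists>z. z > 0 \<and> z < 1 \<and> P i N (y0 + 1 *\<^sub>R (y - y0)) - P i N (y0 + 0 *\<^sub>R (y - y0)) =
             (1 - 0) * (\<Sum>k\<in>UNIV. D i N k (y0 + z *\<^sub>R (y - y0)) * (y - y0) $ k)"
            by (rule MVT2) (use has_grad_line[OF grad_P, of i N y0 "y - y0"] in auto)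
          then obtain z where z: "0 < z" "z < 1" "\<phi> i y - \<phi> i y0 = (\<Sum>k\<in>UNIV. D i N k (y0 + z *\<^sub>R (y - y0)) * (y - y0) $ k)"
            by auto
          have "\<bar>\<phi> i y - \<phi> i y0\<bar> \<le> (\<Sum>k\<in>(UNIV::'n set). E * r)"
            unfolding z(3)
          proof (rule order_trans[OF sum_abs sum_mono])
            fix k
            have "\<bar>D i N k (y0 + z *\<^sub>R (y - y0))\<bar> \<le> E"
            proof (rule grad)
              fix j
              have "\<bar>(y0 + z *\<^sub>R (y - y0)) $ j - y0 $ j\<bar> = z * \<bar>y $ j - y0 $ j\<bar>" using z by (simp add: abs_mult)
              also have "\<dots> \<le> 1 * 1" using z y[of j] r by (intro mult_mono) auto
              finally show "\<bar>(y0 + z *\<^sub>R (y - y0)) $ j - y0 $ j\<bar> \<le> 1" by simp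
            qed
            then show "\<bar>D i N k (y0 + z *\<^sub>R (y - y0)) * (y - y0) $ k\<bar> \<le> E * r"
              unfolding abs_mult using y[of k] E0 by (intro mult_mono) auto
          qed
          then have "\<bar>\<phi> i y - \<phi> i y0\<bar> \<le> real n * (r * E)" by (simp add: n_def mult_ac)
          then show ?thesis by linarith
        qed
        have "\<Phi> y0 \<le> (\<Sum>i\<in>UNIV. \<bar>\<phi> i y\<bar> + real n * (r * E))" unfolding \<Phi>_def by (intro sum_mono d)
        also have "\<dots> = \<Phi> y + m * (real n * (r * E))" by (simp add: sum.distrib \<Phi>_def m_def)
        also have "m * (real n * (r * E)) = (m * (n * (r * (C1 * K)))) * \<Phi> y0" by (simp add: E_def mult_ac)
        also have "\<dots> \<le> 1 / 2 * \<Phi> y0" using rr \<Phi>_nonneg by (intro mult_right_mono)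
        finally show ?thesis by simp
      qed
      let ?c = "\<Phi> y0 / 2 * (ker 1 (x - y0) / K)"
      have e2: "cc (\<lambda>y. eta (\<lambda>_. r/2) (y + (- y0)))" by (rule cc_shift, rule cc_eta) (use r in auto)
      have "?c * r ^ n \<le> ?c * (\<integral>y. eta (\<lambda>_::'n. r/2) y \<partial>lborel)"
      proof (rule mult_left_mono)
        show "r ^ n \<le> (\<integral>y. eta (\<lambda>_::'n. r/2) y \<partial>lborel)"
          using integral_eta_lower[of "\<lambda>_::'n. r/2"] r by (simp add: n_def)
        show "0 \<le> ?c" using \<Phi>_nonneg K1 by (intro mult_nonneg_nonneg divide_nonneg_nonneg less_imp_le[OF ker_pos]) auto
      qed
      also have "\<dots> = ?c * (\<integral>y. eta (\<lambda>_. r/2) (y + (- y0)) \<partial>lborel)"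
        by (subst integral_shift) (use cc_eta(1)[of "\<lambda>_. r/2"] r in auto)
      also have "\<dots> = (\<integral>y. ?c * eta (\<lambda>_. r/2) (y + (- y0)) \<partial>lborel)" by simp
      also have "\<dots> \<le> ?I"
      proof (rule cc_mono)
        show "cc (\<lambda>y. ?c * eta (\<lambda>_. r/2) (y + (- y0)))" by (rule cc_cmult[OF e2])
        show "cc (\<lambda>y. eta (\<lambda>_. T) y * \<Phi> y * ker 1 (x - y))"
          by (intro cc_mult_right cc_eta cont_\<Phi> cker Tp)
        fix y
        show "?c * eta (\<lambda>_. r/2) (y + (- y0)) \<le> eta (\<lambda>_. T) y * \<Phi> y * ker 1 (x - y)"
        proof (cases "\<forall>j. \<bar>y $ j - y0 $ j\<bar> \<le> r")
          case False
          then obtain j where "r < \<bar>y $ j - y0 $ j\<bar>" by (auto simp: not_le)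
          then have z: "eta (\<lambda>_. r/2) (y + (- y0)) = 0" by (intro eta_zero[of _ j]) (use r in auto)
          show ?thesis unfolding z mult_zero_right
            by (intro mult_nonneg_nonneg eta_range \<Phi>_nonneg less_imp_le[OF ker_pos])
        next
          case True
          have "eta (\<lambda>_. T) y = 1"
          proof (rule eta_one)
            fix j show "\<bar>y $ j\<bar> \<le> T" using True[rule_format, of j] inner[of j] T[of j] r \<rho> by linarith
          qed (rule Tp)
          moreover have "?c * eta (\<lambda>_. r/2) (y + (- y0)) \<le> ?c * 1"
            using \<Phi>_nonneg K1 by (intro mult_left_mono eta_range mult_nonneg_nonneg divide_nonneg_nonneg less_imp_le[OF ker_pos]) auto
          moreover have "?c \<le> \<Phi> y * ker 1 (x - y)"
          proof (intro mult_mono \<Phi>_nonneg divide_nonneg_nonneg less_imp_le[OF ker_pos])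
            show "\<Phi> y0 / 2 \<le> \<Phi> y" by (rule low) (use True in blast)
            have "ker 1 (x - y0) \<le> 21 ^ CARD('n) * ker 1 (x - y)"
            proof (rule ker_ratio)
              fix j show "\<bar>(x - y) $ j - (x - y0) $ j\<bar> \<le> 3" using True[rule_format, of j] r by simp
            qed
            then show "ker 1 (x - y0) / K \<le> ker 1 (x - y)"
              using K1 unfolding K_def n_def by (simp add: divide_le_eq mult.commute)
          qed (use K1 in simp)
          ultimately show ?thesis by simp
        qed
      qed
      finally have fin: "?c * r ^ n \<le> ?I" .
      have "F y0 = 2 * K / r ^ n * (?c * r ^ n)" using K1 r by (simp add: F_def field_simps)
      also have "\<dots> \<le> 2 * K / r ^ n * ?I" using fin K1 r by (intro mult_left_mono) auto
      also have "\<dots> \<le> C * ?I" using C(2) I0 by (intro mult_right_mono)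
      finally show ?thesis using le C(1) \<rho> by (simp add: add_increasing2)
    qed
  qed
  show ?thesis using C(1) main by (intro exI[of _ C]) auto
qed

text \<open>The argument of \<open>mass_bound\<close> on a cube, with a weight that is constant in direction \<open>N\<close> and decays
  in the other directions at scale \<open>R\<close>.\<close>

lemma weighted_mass:
  "\<exists>C>0. \<forall>R\<ge>1. \<forall>T>0. (\<integral>y. eta (\<lambda>_. T) y * \<Phi> y * (\<Prod>j\<in>UNIV-{N}. cauchy (y $ j / R)) \<partial>lborel) \<le> C * R^2"
proof -
  define n where "n = CARD('n)"
  define C where "C = real CARD('m) * (U * bumpK * bumpK ^ (n - 1) * (4 * 2 ^ n) ^ n) + 1"
  have C: "C > 0" using U_nonneg bumpK(1) by (auto simp: C_def intro!: add_nonneg_pos mult_nonneg_nonneg)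
  have "(\<integral>y. eta (\<lambda>_. T) y * \<Phi> y * (\<Prod>j\<in>UNIV-{N}. cauchy (y $ j / R)) \<partial>lborel) \<le> C * R^2"
    if R: "R \<ge> 1" and T: "T > 0" for R T
  proof -
    define w where "w y = (\<Prod>j\<in>UNIV-{N}. cauchy (y $ j / R))" for y :: "real^'n"
    define w' where "w' m y = (\<Sum>i\<in>UNIV-{N}. (cauchy' (y $ i / R) / R * (if m = i then 1 else 0)) * (\<Prod>j\<in>UNIV-{N}-{i}. cauchy (y $ j / R)))" for m and y :: "real^'n"
    have gw: "has_grad w w'" unfolding w_def w'_def by (intro has_grad_prod has_grad_cauchy_nth) simp
    have w'N: "w' N y = 0" for y unfolding w'_def by (intro sum.neutral) auto
    have w0: "w y \<ge> 0" for y unfolding w_def by (intro prod_nonneg) (simp add: cauchy_pos less_imp_le)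
    have cw: "continuous_on S w" for S by (rule has_grad_continuous[OF gw])
    have n1: "n \<ge> 1" by (simp add: n_def Suc_leI)
    have cce: "cc (eta (\<lambda>_::'n. T))" "cc (eta' (\<lambda>_. T) k)" "cc (eta (\<lambda>_::'n. 2 * T))" for k using T by (auto intro!: cc_eta)
    have wi: "(\<integral>y. eta (\<lambda>_. 2 * T) y * w y \<partial>lborel) \<le> (bumpK * R / T) ^ (n - 1) * ((4 * 2 ^ n) * T) ^ n"
    proof -
      have "(\<integral>y. eta (\<lambda>_. 2 * T) y * w y \<partial>lborel) \<le> (2 * bumpK * R / (2 * T)) ^ card (UNIV-{N}) * (\<integral>y. eta (\<lambda>_::'n. 2 ^ card (UNIV-{N}) * (2 * T)) y \<partial>lborel)"
        using kernel_integral[of R "2 * T" "\<lambda>_. 2 * T" "UNIV-{N}" "\<lambda>_. 0"] R T by (simp add: w_def)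
      also have "card (UNIV-{N}) = n - 1" by (simp add: n_def card_Diff_singleton)
      also have "(2::real) ^ (n - 1) * (2 * T) = 2 ^ n * T" using n1 by (cases n) auto
      also have "(\<integral>y. eta (\<lambda>_::'n. 2 ^ n * T) y \<partial>lborel) \<le> (\<Prod>j\<in>(UNIV::'n set). 4 * (2 ^ n * T))"
        by (rule integral_eta) (use T in simp)
      also have "\<dots> = (4 * 2 ^ n * T) ^ n" by (simp add: n_def mult_ac)
      finally show ?thesis using R T bumpK(1) by (simp add: mult_left_mono)
    qed
    have each: "(\<integral>y. eta (\<lambda>_. T) y * \<bar>\<phi> i y\<bar> * w y \<partial>lborel) \<le> U * bumpK * bumpK ^ (n - 1) * (4 * 2 ^ n) ^ n * R^2" for i
    proof -
      obtain s where s: "\<bar>s\<bar> = 1" "\<And>x. \<bar>\<phi> i x\<bar> = s * \<phi> i x" using sign_\<phi>[of i] by blast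
      have gg: "has_grad (\<lambda>y. u i y * w y) (\<lambda>k y. P i k y * w y + u i y * w' k y)" by (rule has_grad_mult[OF grad_u gw])
      have "(\<integral>y. eta (\<lambda>_. T) y * \<bar>\<phi> i y\<bar> * w y \<partial>lborel) = s * (\<integral>y. eta (\<lambda>_. T) y * (P i N y * w y + u i y * w' N y) \<partial>lborel)"
        unfolding s(2) w'N by (simp add: mult_ac flip: integral_mult_right_zero)
      also have "\<dots> = - s * (\<integral>y. eta' (\<lambda>_. T) N y * (u i y * w y) \<partial>lborel)"
        using integral_by_parts[OF has_grad_eta gg eta_support, of "\<lambda>_. T" N] T by simp
      also have "\<dots> = (\<integral>y. - s * (eta' (\<lambda>_. T) N y * (u i y * w y)) \<partial>lborel)" by simp
      also have "\<dots> \<le> (\<integral>y. (U * bumpK / T) * (eta (\<lambda>_. 2 * T) y * w y) \<partial>lborel)"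
      proof (rule cc_mono)
        show "cc (\<lambda>y. - s * (eta' (\<lambda>_. T) N y * (u i y * w y)))" by (intro cc_cmult cc_mult_right cce continuous_intros cont_u cw)
        show "cc (\<lambda>y. (U * bumpK / T) * (eta (\<lambda>_. 2 * T) y * w y))" by (intro cc_cmult cc_mult_right cce cw)
        fix y
        have 1: "\<bar>eta' (\<lambda>_. T) N y\<bar> \<le> bumpK / T * eta (\<lambda>_. 2 * T) y" by (rule eta'_bound) (use T in auto)
        have "- s * (eta' (\<lambda>_. T) N y * (u i y * w y)) \<le> \<bar>- s * (eta' (\<lambda>_. T) N y * (u i y * w y))\<bar>" by simp
        also have "\<dots> = \<bar>eta' (\<lambda>_. T) N y\<bar> * (\<bar>u i y\<bar> * w y)" using s(1) w0[of y] by (simp add: abs_mult)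
        also have "\<dots> \<le> (bumpK / T * eta (\<lambda>_. 2 * T) y) * (U * w y)"
          by (intro mult_mono 1 u_bound mult_nonneg_nonneg divide_nonneg_nonneg eta_range w0 abs_ge_zero order_refl) (use T bumpK(1) U_nonneg in auto)
        finally show "- s * (eta' (\<lambda>_. T) N y * (u i y * w y)) \<le> (U * bumpK / T) * (eta (\<lambda>_. 2 * T) y * w y)"
          by (simp add: mult_ac)
      qed
      also have "\<dots> = (U * bumpK / T) * (\<integral>y. eta (\<lambda>_. 2 * T) y * w y \<partial>lborel)" by simp
      also have "\<dots> \<le> (U * bumpK / T) * ((bumpK * R / T) ^ (n - 1) * ((4 * 2 ^ n) * T) ^ n)"
        by (rule mult_left_mono[OF wi]) (use U_nonneg bumpK(1) T in auto)
      also have "\<dots> = U * bumpK * bumpK ^ (n - 1) * (4 * 2 ^ n) ^ n * R ^ (n - 1)"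
      proof -
        obtain k where k: "n = Suc k" using n1 by (cases n) auto
        show ?thesis unfolding k using T by (simp add: power_mult_distrib power_divide)
      qed
      also have "\<dots> \<le> U * bumpK * bumpK ^ (n - 1) * (4 * 2 ^ n) ^ n * R ^ 2"
        using R dim U_nonneg bumpK(1) by (intro mult_left_mono power_increasing) (auto simp: n_def)
      finally show ?thesis .
    qed
    have "(\<integral>y. eta (\<lambda>_. T) y * \<Phi> y * w y \<partial>lborel) = (\<Sum>i\<in>UNIV. \<integral>y. eta (\<lambda>_. T) y * \<bar>\<phi> i y\<bar> * w y \<partial>lborel)"
    proof -
      have "(\<lambda>y. eta (\<lambda>_. T) y * \<Phi> y * w y) = (\<lambda>y. \<Sum>i\<in>UNIV. eta (\<lambda>_. T) y * \<bar>\<phi> i y\<bar> * w y)"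
        by (simp add: \<Phi>_def sum_distrib_left sum_distrib_right fun_eq_iff)
      then show ?thesis by (simp only:) (intro integral_cc_sum cc_mult_right cce continuous_intros cont_P cw)
    qed
    also have "\<dots> \<le> (\<Sum>i\<in>(UNIV::'m set). U * bumpK * bumpK ^ (n - 1) * (4 * 2 ^ n) ^ n * R^2)"
      by (intro sum_mono each)
    also have "\<dots> \<le> C * R^2" by (simp add: C_def algebra_simps)
    finally show ?thesis unfolding w_def .
  qed
  then show ?thesis using C by blast
qed

text \<open>The function \<open>\<mu>\<close> is \<open>1 / L\<close> plus the average of \<open>\<Phi>\<close> over scale \<open>R\<close>. The average dominates \<open>\<Phi>\<close>
  up to a constant factor by \<open>local_sup\<close>, and \<open>1 / L\<close> covers the error term there. The power of \<open>R\<close> in the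
  last bound is far from sharp; it matters only that it does not depend on \<open>L\<close>.\<close>

lemma slowly_varying_majorant:
  "\<exists>C\<ge>1. \<forall>R\<ge>1. \<forall>L\<ge>R. \<exists>\<mu> \<mu>'. has_grad \<mu> \<mu>' \<and> (\<forall>x. 0 < \<mu> x) \<and> (\<forall>k x. \<bar>\<mu>' k x\<bar> \<le> \<mu> x / R)
     \<and> (\<forall>x. (\<forall>j. \<bar>x $ j\<bar> \<le> 4 * tall N R L j) \<longrightarrow> \<Phi> x \<le> C * \<mu> x)
     \<and> (\<integral>x. eta (tall N (2 * R) (2 * L)) x * \<mu> x \<partial>lborel) \<le> C * R^5"
proof -
  obtain C0 where C0: "C0 > 0" and sup: "\<And>x \<rho> T. 4 \<le> \<rho> \<Longrightarrow> (\<And>j. \<bar>x $ j\<bar> + \<rho> \<le> T) \<Longrightarrow>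
     \<Phi> x \<le> C0 * (\<integral>y. eta (\<lambda>_. T) y * \<Phi> y * ker 1 (x - y) \<partial>lborel) + C0 / \<rho>"
    using local_sup by auto
  obtain C2 where C2: "C2 > 0" and wm: "\<And>R T. R \<ge> 1 \<Longrightarrow> T > 0 \<Longrightarrow>
     (\<integral>y. eta (\<lambda>_. T) y * \<Phi> y * (\<Prod>j\<in>UNIV-{N}. cauchy (y $ j / R)) \<partial>lborel) \<le> C2 * R^2"
    using weighted_mass by auto
  define n where "n = CARD('n)"
  define K where "K = (35::real) ^ (n - 1)"
  define C where "C = C0 + 512 + K * (4096 * bumpK) * C2 + 1"
  have K: "K \<ge> 1" by (simp add: K_def)
  have Cge: "C \<ge> 1" "C \<ge> C0" "C \<ge> 512 + K * (4096 * bumpK) * C2"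
    using C0 C2 K bumpK(1) by (auto simp: C_def intro!: mult_nonneg_nonneg)
  show ?thesis
  proof (intro exI[of _ C] conjI allI impI Cge(1))
    fix R L :: real assume R: "R \<ge> 1" and L: "L \<ge> R"
    have L1: "L \<ge> 1" using R L by linarith
    \<comment> \<open>Large enough for \<open>local_sup\<close> with distance \<open>L + 4\<close> at all points of the cylinder of size \<open>4 L\<close>.\<close>
    define T where "T = 4 * R + 5 * L + 4"
    have T: "T > 0" using R L by (simp add: T_def)
    define g where "g y = eta (\<lambda>_. T) y * \<Phi> y" for y
    have g: "cc g" unfolding g_def by (intro cc_mult_right cc_eta T cont_\<Phi>)
    have g0: "g y \<ge> 0" for y unfolding g_def by (intro mult_nonneg_nonneg eta_range \<Phi>_nonneg)
    define I where "I x = (\<integral>y. g y * ker R (x - y) \<partial>lborel)" for x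
    define I' where "I' k x = (\<integral>y. g y * ker' R k (x - y) \<partial>lborel)" for k x
    have gI: "has_grad I I'" unfolding I_def I'_def by (rule has_grad_average[OF g])
    have cker: "continuous_on UNIV (\<lambda>y. ker R' (x - y))" "continuous_on UNIV (\<lambda>y. ker' R' k (x - y))" for R' k and x :: "real^'n"
      by (rule continuous_on_compose2[OF cont_ker[of UNIV]] continuous_on_compose2[OF cont_ker'[of UNIV]]; auto intro!: continuous_intros)+
    have ccI: "cc (\<lambda>y. g y * ker R' (x - y))" for R' x by (rule cc_mult_right[OF g cker(1)])
    have I0: "I x \<ge> 0" for x unfolding I_def by (intro cc_nonneg mult_nonneg_nonneg g0 less_imp_le[OF ker_pos])
    have I'b: "\<bar>I' k x\<bar> \<le> I x / R" for k x
    proof -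
      have "\<bar>I' k x\<bar> \<le> (\<integral>y. \<bar>g y * ker' R k (x - y)\<bar> \<partial>lborel)" unfolding I'_def by (rule integral_abs_bound)
      also have "\<dots> \<le> (\<integral>y. 1 / R * (g y * ker R (x - y)) \<partial>lborel)"
      proof (rule cc_mono)
        show "cc (\<lambda>y. \<bar>g y * ker' R k (x - y)\<bar>)" by (intro cc_abs cc_mult_right g cker)
        show "cc (\<lambda>y. 1 / R * (g y * ker R (x - y)))" by (intro cc_cmult ccI)
        fix y
        have "\<bar>g y * ker' R k (x - y)\<bar> = g y * \<bar>ker' R k (x - y)\<bar>" using g0[of y] by (simp add: abs_mult)
        also have "\<dots> \<le> g y * (ker R (x - y) / R)" by (intro mult_left_mono ker'_bound g0) (use R in simp)
        finally show "\<bar>g y * ker' R k (x - y)\<bar> \<le> 1 / R * (g y * ker R (x - y))" by simp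
      qed
      also have "\<dots> = I x / R" by (simp add: I_def)
      finally show ?thesis .
    qed
    define \<mu> where "\<mu> x = 1 / L + I x" for x
    define \<mu>' where "\<mu>' k x = 0 + I' k x" for k x
    have g\<mu>: "has_grad \<mu> \<mu>'" unfolding \<mu>_def \<mu>'_def by (intro has_grad_add has_grad_const gI)
    have pos: "0 < \<mu> x" for x using I0[of x] L1 unfolding \<mu>_def by (intro add_pos_nonneg) auto
    have b: "\<bar>\<mu>' k x\<bar> \<le> \<mu> x / R" for k x
      using I'b[of k x] L1 R by (simp add: \<mu>'_def \<mu>_def add_divide_distrib add_increasing)
    have dom: "\<Phi> x \<le> C * \<mu> x" if x: "\<And>j. \<bar>x $ j\<bar> \<le> 4 * tall N R L j" for x
    proof -
      have "\<Phi> x \<le> C0 * (\<integral>y. eta (\<lambda>_. T) y * \<Phi> y * ker 1 (x - y) \<partial>lborel) + C0 / (L + 4)"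
      proof (rule sup)
        show "4 \<le> L + 4" using L1 by simp
        fix j
        have "tall N R L j \<le> L" using L by (simp add: tall_def)
        then show "\<bar>x $ j\<bar> + (L + 4) \<le> T" using x[of j] R unfolding T_def by linarith
      qed
      also have "\<dots> \<le> C0 * I x + C0 * (1 / L)"
      proof (intro add_mono mult_left_mono)
        show "(\<integral>y. eta (\<lambda>_. T) y * \<Phi> y * ker 1 (x - y) \<partial>lborel) \<le> I x"
          unfolding I_def g_def[symmetric]
          by (intro cc_mono ccI mult_left_mono ker_mono R g0)
        show "C0 / (L + 4) \<le> C0 * (1 / L)" using C0 L1 by (simp add: frac_le)
      qed (use C0 in simp)
      also have "\<dots> = C0 * \<mu> x" by (simp add: \<mu>_def algebra_simps)
      also have "\<dots> \<le> C * \<mu> x" using Cge(2) pos[of x] by (intro mult_right_mono) auto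
      finally show ?thesis .
    qed
    let ?E = "eta (tall N (2 * R) (2 * L))"
    have Ep: "tall N (2 * R) (2 * L) j > 0" for j using R L by (simp add: tall_def)
    have ccE: "cc ?E" by (intro cc_eta Ep)
    define w where "w y = (\<Prod>j\<in>UNIV-{N}. cauchy (y $ j / R))" for y :: "real^'n"
    have w0: "w y \<ge> 0" for y unfolding w_def by (intro prod_nonneg) (simp add: cauchy_pos less_imp_le)
    have cw: "continuous_on UNIV w" unfolding w_def
      by (intro continuous_on_prod continuous_on_compose2[OF cauchy_cont(1)[of UNIV]]) (use R in \<open>auto intro!: continuous_intros\<close>)
    have inner: "(\<integral>x. ?E x * ker R (x - y) \<partial>lborel) \<le> K * w y * (4096 * bumpK * R^3)" for y
    proof -
      have ckk: "continuous_on UNIV (\<lambda>x::real^'n. cauchy ((x $ N - y $ N) / R))"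
        by (rule continuous_on_compose2[OF cauchy_cont(1)[of UNIV]]) (use R in \<open>auto intro!: continuous_intros\<close>)
      have cker2: "continuous_on UNIV (\<lambda>x. ker R (x - y))"
        by (rule continuous_on_compose2[OF cont_ker[of UNIV]]) (auto intro!: continuous_intros)
      have "(\<integral>x. ?E x * ker R (x - y) \<partial>lborel) \<le> (\<integral>x. K * w y * (?E x * cauchy ((x $ N - y $ N) / R)) \<partial>lborel)"
      proof (rule cc_mono)
        show "cc (\<lambda>x. ?E x * ker R (x - y))" by (rule cc_mult_right[OF ccE cker2])
        show "cc (\<lambda>x. K * w y * (?E x * cauchy ((x $ N - y $ N) / R)))" by (intro cc_cmult cc_mult_right[OF ccE ckk])
        fix x :: "real^'n"
        show "?E x * ker R (x - y) \<le> K * w y * (?E x * cauchy ((x $ N - y $ N) / R))"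
        proof (cases "\<exists>j. 2 * tall N (2 * R) (2 * L) j \<le> \<bar>x $ j\<bar>")
          case True
          then have "?E x = 0" using eta_zero[of "tall N (2 * R) (2 * L)", OF Ep] by blast
          then show ?thesis by simp
        next
          case False
          have xj: "\<bar>x $ j\<bar> \<le> 4 * R" if "j \<noteq> N" for j
          proof -
            have "\<not> 2 * tall N (2 * R) (2 * L) j \<le> \<bar>x $ j\<bar>" using False by blast
            then show ?thesis using that by (simp add: tall_def)
          qed
          have "ker R (x - y) = cauchy ((x $ N - y $ N) / R) * (\<Prod>j\<in>UNIV-{N}. cauchy ((x $ j - y $ j) / R))"
            unfolding ker_def by (subst prod.remove[of UNIV N]) auto
          also have "\<dots> \<le> cauchy ((x $ N - y $ N) / R) * (\<Prod>j\<in>UNIV-{N}. 35 * cauchy (y $ j / R))"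
          proof (intro mult_left_mono prod_mono conjI)
            fix j assume j: "j \<in> UNIV - {N}"
            show "0 \<le> cauchy ((x $ j - y $ j) / R)" by (simp add: cauchy_pos less_imp_le)
            have "cauchy ((x $ j - y $ j) / R) \<le> (1 + 2 * 4^2 + 2) * cauchy (- (y $ j / R))"
            proof (rule cauchy_ratio)
              have "- (y $ j / R) - (x $ j - y $ j) / R = - (x $ j / R)" by (simp add: diff_divide_distrib)
              then show "\<bar>- (y $ j / R) - (x $ j - y $ j) / R\<bar> \<le> 4"
                using xj[of j] j R by (simp add: abs_divide divide_le_eq)
            qed
            then show "cauchy ((x $ j - y $ j) / R) \<le> 35 * cauchy (y $ j / R)" by (simp add: cauchy_def)
          qed (simp add: cauchy_pos less_imp_le)
          also have "(\<Prod>j\<in>UNIV-{N}. 35 * cauchy (y $ j / R)) = K * w y"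
            by (simp add: prod.distrib K_def w_def n_def card_Diff_singleton)
          finally have "?E x * ker R (x - y) \<le> ?E x * (cauchy ((x $ N - y $ N) / R) * (K * w y))"
            by (intro mult_left_mono eta_range)
          then show ?thesis by (simp add: mult_ac)
        qed
      qed
      also have "\<dots> = K * w y * (\<integral>x. ?E x * cauchy ((x $ N - y $ N) / R) \<partial>lborel)" by simp
      also have "\<dots> \<le> K * w y * (4096 * bumpK * R^3)"
      proof (rule mult_left_mono)
        have "(\<integral>x. ?E x * cauchy ((x $ N - y $ N) / R) \<partial>lborel) \<le> (2 * bumpK * R / (2 * L)) ^ 1 * (\<integral>x. eta (\<lambda>j. 2 ^ 1 * tall N (2 * R) (2 * L) j) x \<partial>lborel)"
          using kernel_integral[of R "2 * L" "tall N (2 * R) (2 * L)" "{N}" "\<lambda>j. y $ j"] Ep R L1 by (simp add: tall_def)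
        also have "(\<lambda>j. 2 ^ 1 * tall N (2 * R) (2 * L) j) = tall N (4 * R) (4 * L)" by (auto simp: tall_def)
        also have "(2 * bumpK * R / (2 * L)) ^ 1 * (\<integral>x. eta (tall N (4 * R) (4 * L)) x \<partial>lborel) \<le> (2 * bumpK * R / (2 * L)) ^ 1 * (64 * (4 * R)^2 * (4 * L))"
          by (intro mult_left_mono integral_eta_tall dim) (use R L1 bumpK(1) in auto)
        also have "\<dots> = 4096 * bumpK * R^3" using L1 by (simp add: power2_eq_square power3_eq_cube)
        finally show "(\<integral>x. ?E x * cauchy ((x $ N - y $ N) / R) \<partial>lborel) \<le> 4096 * bumpK * R^3" .
        show "0 \<le> K * w y" using K w0 by simp
      qed
      finally show ?thesis .
    qed
    have bg: "bounded {y. g y \<noteq> 0}" "bounded {x. ?E x \<noteq> 0}" using g ccE by (simp_all add: cc_def)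
    have cF: "continuous_on UNIV (\<lambda>(x, y). ?E x * (g y * ker R (x - y)))"
      unfolding case_prod_beta
      by (intro continuous_intros continuous_on_compose2[OF cc_cont[OF g, of UNIV]] continuous_on_compose2[OF cont_eta[of UNIV]]
         continuous_on_compose2[OF cont_ker[of UNIV]]) auto
    note fub = fubini_cc[OF cF bg(2,1)]
    have cF': "continuous_on UNIV (\<lambda>(y, x). ?E x * (g y * ker R (x - y)))"
      unfolding case_prod_beta
      by (intro continuous_intros continuous_on_compose2[OF cc_cont[OF g, of UNIV]] continuous_on_compose2[OF cont_eta[of UNIV]]
         continuous_on_compose2[OF cont_ker[of UNIV]]) auto
    have EI: "(\<integral>x. ?E x * I x \<partial>lborel) \<le> K * (4096 * bumpK) * C2 * R^5"
    proof -
      have "(\<integral>x. ?E x * I x \<partial>lborel) = (\<integral>x. (\<integral>y. ?E x * (g y * ker R (x - y)) \<partial>lborel) \<partial>lborel)"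
        by (simp add: I_def)
      also have "\<dots> = (\<integral>y. (\<integral>x. ?E x * (g y * ker R (x - y)) \<partial>lborel) \<partial>lborel)" by (rule fub(1)) auto
      also have "\<dots> \<le> (\<integral>y. (K * (4096 * bumpK * R^3)) * (eta (\<lambda>_. T) y * \<Phi> y * w y) \<partial>lborel)"
      proof (rule cc_mono)
        show "cc (\<lambda>y. \<integral>x. ?E x * (g y * ker R (x - y)) \<partial>lborel)" by (rule fubini_cc(2)[OF cF' bg(1,2)]) auto
        show "cc (\<lambda>y. (K * (4096 * bumpK * R^3)) * (eta (\<lambda>_. T) y * \<Phi> y * w y))"
          by (intro cc_cmult cc_mult_right cc_eta T cont_\<Phi> cw)
        fix y
        have "(\<integral>x. ?E x * (g y * ker R (x - y)) \<partial>lborel) = g y * (\<integral>x. ?E x * ker R (x - y) \<partial>lborel)"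
          by (simp add: mult.left_commute)
        also have "\<dots> \<le> g y * (K * w y * (4096 * bumpK * R^3))" by (rule mult_left_mono[OF inner g0])
        finally show "(\<integral>x. ?E x * (g y * ker R (x - y)) \<partial>lborel) \<le> (K * (4096 * bumpK * R^3)) * (eta (\<lambda>_. T) y * \<Phi> y * w y)"
          by (simp add: g_def mult_ac)
      qed
      also have "\<dots> = (K * (4096 * bumpK * R^3)) * (\<integral>y. eta (\<lambda>_. T) y * \<Phi> y * w y \<partial>lborel)" by simp
      also have "\<dots> \<le> (K * (4096 * bumpK * R^3)) * (C2 * R^2)"
        unfolding w_def by (intro mult_left_mono wm R T) (use K R bumpK(1) in auto)
      also have "\<dots> = K * (4096 * bumpK) * C2 * R^5" by (simp add: eval_nat_numeral)
      finally show ?thesis .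
    qed
    have cI: "continuous_on UNIV I" by (rule has_grad_continuous[OF gI])
    have "(\<integral>x. ?E x * \<mu> x \<partial>lborel) = (\<integral>x. 1 / L * ?E x + ?E x * I x \<partial>lborel)"
      by (simp add: \<mu>_def algebra_simps)
    also have "\<dots> = 1 / L * (\<integral>x. ?E x \<partial>lborel) + (\<integral>x. ?E x * I x \<partial>lborel)"
      by (subst integral_cc_add) (auto intro!: cc_cmult[OF ccE, of "1/L", simplified] cc_mult_right[OF ccE cI])
    also have "\<dots> \<le> 1 / L * (64 * (2 * R)^2 * (2 * L)) + K * (4096 * bumpK) * C2 * R^5"
      by (intro add_mono mult_left_mono integral_eta_tall dim EI) (use R L1 in auto)
    also have "1 / L * (64 * (2 * R)^2 * (2 * L)) = 512 * R^2" using L1 by (simp add: power2_eq_square)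
    also have "512 * R^2 \<le> 512 * R^5" using R by (intro mult_left_mono power_increasing) auto
    also have "512 * R^5 + K * (4096 * bumpK) * C2 * R^5 \<le> C * R^5"
      using mult_right_mono[OF Cge(3), of "R^5"] R by (simp add: algebra_simps)
    finally have fin: "(\<integral>x. ?E x * \<mu> x \<partial>lborel) \<le> C * R^5" by simp
    show "\<exists>\<mu> \<mu>'. has_grad \<mu> \<mu>' \<and> (\<forall>x. 0 < \<mu> x) \<and> (\<forall>k x. \<bar>\<mu>' k x\<bar> \<le> \<mu> x / R)
     \<and> (\<forall>x. (\<forall>j. \<bar>x $ j\<bar> \<le> 4 * tall N R L j) \<longrightarrow> \<Phi> x \<le> C * \<mu> x)
     \<and> (\<integral>x. eta (tall N (2 * R) (2 * L)) x * \<mu> x \<partial>lborel) \<le> C * R^5"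
      using g\<mu> pos b dom fin by blast
  qed
qed

end

section \<open>Energy and averages over tall cylinders\<close>

lemma sum_square_disjoint:
  fixes a :: "'k \<Rightarrow> real"
  assumes "finite A" "\<And>k k'. k \<in> A \<Longrightarrow> k' \<in> A \<Longrightarrow> k \<noteq> k' \<Longrightarrow> a k * a k' = 0"
  shows "(\<Sum>k\<in>A. a k)^2 = (\<Sum>k\<in>A. (a k)^2)"
proof -
  have "(\<Sum>k\<in>A. a k)^2 = (\<Sum>k\<in>A. \<Sum>k'\<in>A. a k * a k')"
    by (simp add: power2_eq_square sum_product)
  also have "\<dots> = (\<Sum>k\<in>A. \<Sum>k'\<in>A. if k = k' then (a k)^2 else 0)"
    by (intro sum.cong refl) (use assms(2) in \<open>auto simp: power2_eq_square\<close>)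
  also have "\<dots> = (\<Sum>k\<in>A. (a k)^2)" using assms(1) by simp
  finally show ?thesis .
qed

text \<open>The derivative of a cutoff lives where the coordinate is between one and two half-sides. Squares of
  sums of dyadic cutoff gradients therefore have no mixed terms, which is what makes logarithmic
  cutoffs cheap.\<close>

lemma eta'_dyadic_disjoint:
  fixes r :: "nat \<Rightarrow> 'n::finite \<Rightarrow> real"
  assumes p: "\<And>k j. r k j > 0" and r: "\<And>k. r k j = 2 ^ k * B" and "k \<noteq> k'"
  shows "eta' (r k) j x * eta' (r k') j x = 0"
proof -
  have *: "eta' (r a) j x * eta' (r b) j x = 0" if "a < b" for a b
  proof (rule ccontr)
    assume n: "eta' (r a) j x * eta' (r b) j x \<noteq> 0"
    have B: "B > 0" using p[of 0 j] r[of 0] by simp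
    from n have "\<not> 2 * r a j \<le> \<bar>x $ j\<bar>" using eta'_zero[of "r a" j x j] p by auto
    moreover from n have "\<not> \<bar>x $ j\<bar> \<le> r b j" using eta'_zero'[of "r b" j x] p by auto
    ultimately have "r b j < 2 * r a j" by linarith
    then have "(2::real) ^ b < 2 ^ Suc a" using B by (simp add: r)
    then have "b < Suc a" by (rule power_less_imp_less_exp[rotated]) simp
    then show False using that by simp
  qed
  show ?thesis using *[of k k'] *[of k' k] assms(3) by (cases "k < k'") (auto simp: mult.commute)
qed

lemma eta'_square_bound:
  assumes r: "\<And>j. r j > 0" and s: "\<And>j. 2 * r j \<le> s j"
  shows "(eta' r k x)^2 \<le> (bumpK / r k)^2 * eta s x"
proof -
  have "(eta' r k x)^2 \<le> (bumpK / r k * eta s x)^2"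
    using eta'_bound[of r s k x, OF r s] by (metis abs_ge_zero power2_abs power_mono)
  also have "\<dots> = (bumpK / r k)^2 * (eta s x * eta s x)" by (simp add: power2_eq_square)
  also have "\<dots> \<le> (bumpK / r k)^2 * (eta s x * 1)" by (intro mult_left_mono eta_range) auto
  finally show ?thesis by simp
qed

lemma swap_line:
  fixes h \<xi> :: "'a::euclidean_space \<Rightarrow> real"
  assumes h: "continuous_on UNIV h" and x: "cc \<xi>" and R: "0 \<le> R"
  shows "(\<integral>x. \<xi> x * integral {0..R} (\<lambda>t. h (x + t *\<^sub>R e)) \<partial>lborel) = integral {0..R} (\<lambda>t. \<integral>x. \<xi> x * h (x + t *\<^sub>R e) \<partial>lborel)"
    and "cc (\<lambda>x. \<xi> x * integral {0..R} (\<lambda>t. h (x + t *\<^sub>R e)))"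
    and "continuous_on {0..R} (\<lambda>t. \<integral>x. \<xi> x * h (x + t *\<^sub>R e) \<partial>lborel)"
proof -
  obtain a b where z: "\<And>x. x \<notin> cbox a b \<Longrightarrow> \<xi> x = 0" using cc_box[OF x] by blast
  have cx: "continuous_on S \<xi>" for S by (rule cc_cont[OF x])
  have c1: "continuous_on UNIV (\<lambda>(x, t). h (x + t *\<^sub>R e))"
    unfolding case_prod_beta by (rule continuous_on_compose2[OF h]) (auto intro!: continuous_intros)
  have c2: "continuous_on UNIV (\<lambda>x. integral (cbox 0 R) (\<lambda>t. h (x + t *\<^sub>R e)))"
    by (rule integral_continuous_on_param[OF continuous_on_subset[OF c1]]) simp
  show cc: "cc (\<lambda>x. \<xi> x * integral {0..R} (\<lambda>t. h (x + t *\<^sub>R e)))"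
    using c2 by (intro cc_mult_right x) simp
  have c3: "continuous_on UNIV (\<lambda>(x, t). \<xi> x * h (x + t *\<^sub>R e))"
    unfolding case_prod_beta
    by (intro continuous_intros continuous_on_compose2[OF h] continuous_on_compose2[OF cx[of UNIV]]) auto
  have c3': "continuous_on UNIV (\<lambda>(t, x). \<xi> x * h (x + t *\<^sub>R e))"
    unfolding case_prod_beta
    by (intro continuous_intros continuous_on_compose2[OF h] continuous_on_compose2[OF cx[of UNIV]]) auto
  have c4: "continuous_on UNIV (\<lambda>x. \<xi> x * h (x + t *\<^sub>R e))" for t
    by (intro continuous_intros cx continuous_on_compose2[OF h]) auto
  have i: "(\<integral>x. \<xi> x * h (x + t *\<^sub>R e) \<partial>lborel) = integral (cbox a b) (\<lambda>x. \<xi> x * h (x + t *\<^sub>R e))" for t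
    by (rule cc_integrable_cbox(2)[OF c4]) (use z in auto)
  show "continuous_on {0..R} (\<lambda>t. \<integral>x. \<xi> x * h (x + t *\<^sub>R e) \<partial>lborel)"
    unfolding i by (rule integral_continuous_on_param[OF continuous_on_subset[OF c3']]) simp
  have "(\<integral>x. \<xi> x * integral {0..R} (\<lambda>t. h (x + t *\<^sub>R e)) \<partial>lborel) = integral (cbox a b) (\<lambda>x. \<xi> x * integral {0..R} (\<lambda>t. h (x + t *\<^sub>R e)))"
    by (rule cc_integrable_cbox(2)[OF cc_cont[OF cc]]) (use z in auto)
  also have "\<dots> = integral (cbox a b) (\<lambda>x. integral (cbox 0 R) (\<lambda>t. \<xi> x * h (x + t *\<^sub>R e)))" by simp
  also have "\<dots> = integral (cbox 0 R) (\<lambda>t. integral (cbox a b) (\<lambda>x. \<xi> x * h (x + t *\<^sub>R e)))"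
    by (rule integral_swap_continuous[OF continuous_on_subset[OF c3]]) simp
  finally show "(\<integral>x. \<xi> x * integral {0..R} (\<lambda>t. h (x + t *\<^sub>R e)) \<partial>lborel) = integral {0..R} (\<lambda>t. \<integral>x. \<xi> x * h (x + t *\<^sub>R e) \<partial>lborel)"
    unfolding i by simp
qed

context monotone_system_dir
begin

definition "E i x = (\<phi> i x)^2 * (\<Sum>k\<in>UNIV. (\<sigma>' i k x)^2)"

lemma cont_E: "continuous_on S (E i)" unfolding E_def by (intro continuous_intros cont_P cont_\<sigma>')
lemma E_nonneg: "0 \<le> E i x" unfolding E_def by (intro mult_nonneg_nonneg sum_nonneg) auto

lemma full_energy:
  assumes xi: "has_grad \<xi> \<xi>'" "bounded {x. \<xi> x \<noteq> 0}"
  shows "(\<Sum>i\<in>UNIV. \<integral>x. (\<xi> x)^2 * E i x \<partial>lborel) \<le> 8 * (\<Sum>i\<in>UNIV. \<integral>x. (\<psi> i x)^2 * (\<Sum>k\<in>UNIV. (\<xi>' k x)^2) \<partial>lborel)"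
proof -
  have e1: "(\<xi> x)^2 * 1 * 1 * (\<phi> i x)^2 * (\<Sum>k\<in>UNIV. (\<sigma>' i k x)^2) = (\<xi> x)^2 * E i x" for i x
    by (simp add: E_def mult.assoc)
  have e2: "(\<phi> i x)^2 / 1 * (8 * (1 * \<sigma> i x)^2 / 1 * (\<Sum>k\<in>UNIV. (\<xi>' k x)^2)
        + 2 * (\<xi> x)^2 * 1 * (1 * \<sigma> i x)^2 * (\<Sum>k\<in>(UNIV::'b set). (0 / 1)^2)) = 8 * ((\<psi> i x)^2 * (\<Sum>k\<in>UNIV. (\<xi>' k x)^2))" for i x
    by (simp add: \<psi>_eq power_mult_distrib)
  have "(\<Sum>i\<in>UNIV. \<integral>x. (\<xi> x)^2 * 1 * 1 * (\<phi> i x)^2 * (\<Sum>k\<in>UNIV. (\<sigma>' i k x)^2) \<partial>lborel)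
    \<le> (\<Sum>i\<in>UNIV. \<integral>x. (\<phi> i x)^2 / 1 * (8 * (1 * \<sigma> i x)^2 / 1 * (\<Sum>k\<in>UNIV. (\<xi>' k x)^2)
        + 2 * (\<xi> x)^2 * 1 * (1 * \<sigma> i x)^2 * (\<Sum>k\<in>(UNIV::'b set). (0 / 1)^2)) \<partial>lborel)"
    by (rule caccioppoli[OF xi has_grad_const, where \<beta>="\<lambda>s. s" and \<beta>'="\<lambda>s. 1"]) auto
  then show ?thesis unfolding e1 e2
    by (simp only: integral_mult_right_zero sum_distrib_left[symmetric])
qed

lemma psi_square_bound: "(\<psi> i x)^2 \<le> G^2"
  using P_bound[of i l x] by (simp add: abs_le_square_iff[symmetric] abs_of_nonneg[OF G_nonneg])

text \<open>The cutoff is the mean of \<open>M\<close> cylinder cutoffs with dyadic radii. In the short directions each of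
  them has gradient energy of order \<open>L\<close>, so their mean has \<open>L / M\<close>. The derivative in direction \<open>N\<close>
  contributes a term of order \<open>1 / L\<close>, which a large \<open>L\<close> makes small. The factor \<open>\<psi>\<^sup>2\<close> is bounded.\<close>

lemma tall_energy:
  assumes R: "R \<ge> 1" and \<epsilon>: "\<epsilon> > 0"
  shows "\<exists>L\<ge>R. (\<Sum>i\<in>UNIV. \<integral>x. eta (tall N R L) x * E i x \<partial>lborel) \<le> \<epsilon> * L"
proof -
  define m where "m = real CARD('a)"
  define Q where "Q = 8 * m * G^2 * bumpK^2"
  have Q: "Q \<ge> 0" by (simp add: Q_def m_def)
  obtain M :: nat where M: "M > 0" "Q * 3072 / M \<le> \<epsilon> / 2"
  proof -
    obtain M :: nat where M: "real M > Q * 3072 * 2 / \<epsilon>" using reals_Archimedean2 by blast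
    show thesis
    proof (rule that[of "Suc M"])
      have "Q * 3072 * 2 / \<epsilon> \<le> real (Suc M)" using M by simp
      then show "Q * 3072 / real (Suc M) \<le> \<epsilon> / 2" using \<epsilon> by (simp add: field_simps)
    qed simp
  qed
  define X where "X = Q * 64 * (2 ^ (M + 1) * R)^2"
  have X: "X \<ge> 0" using Q by (simp add: X_def)
  define L where "L = R + 2 * X / \<epsilon>"
  have L: "L \<ge> R" "L \<ge> 1" "X / L \<le> \<epsilon> / 2 * L"
  proof -
    show "L \<ge> R" using X \<epsilon> by (simp add: L_def)
    then show L1: "L \<ge> 1" using R by simp
    have "2 * X / \<epsilon> \<le> L" using R by (simp add: L_def)
    then have "X \<le> \<epsilon> / 2 * L" using \<epsilon> by (simp add: field_simps)
    also have "\<dots> \<le> \<epsilon> / 2 * L * L" using L1 \<epsilon> by simp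
    finally show "X / L \<le> \<epsilon> / 2 * L" using L1 by (simp add: divide_le_eq)
  qed
  define r where "r k = tall N (2 ^ k * R) (2 * L)" for k :: nat
  define s where "s k = tall N (2 ^ (k + 1) * R) (4 * L)" for k :: nat
  have rp: "r k j > 0" for k j using R L by (simp add: r_def tall_def)
  have rs: "2 * r k j \<le> s k j" for k j by (simp add: r_def s_def tall_def)
  define A where "A = {1..M}"
  have A: "finite A" "card A = M" by (auto simp: A_def)
  define \<xi> where "\<xi> x = (\<Sum>k\<in>A. 1 / real M * eta (r k) x)" for x
  define \<xi>' where "\<xi>' j x = (\<Sum>k\<in>A. 1 / real M * eta' (r k) j x)" for j x
  have g: "has_grad \<xi> \<xi>'" unfolding \<xi>_def \<xi>'_def by (intro has_grad_sum has_grad_cmult has_grad_eta A)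
  have ccs: "cc (eta (s k))" "cc (eta (r k))" for k using R L by (auto intro!: cc_eta simp: s_def r_def tall_def)
  have bx: "bounded {x. \<xi> x \<noteq> 0}"
  proof -
    have "cc \<xi>" unfolding \<xi>_def by (intro cc_sum cc_cmult ccs)
    then show ?thesis by (simp add: cc_def)
  qed
  note ccx = has_grad_cc[OF g bx]
  have one: "eta (tall N R L) x \<le> (\<xi> x)^2" for x
  proof (cases "eta (tall N R L) x = 0")
    case False
    have xb: "\<bar>x $ j\<bar> < 2 * tall N R L j" for j
    proof (rule ccontr)
      assume "\<not> \<bar>x $ j\<bar> < 2 * tall N R L j"
      then have "eta (tall N R L) x = 0" by (intro eta_zero[of _ j]) (use R L in \<open>auto simp: tall_def\<close>)
      then show False using False by simp
    qed
    have "eta (r k) x = 1" if "k \<in> A" for k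
    proof (rule eta_one[OF rp])
      fix j
      have "2 * R \<le> 2 ^ k * R" using that R by (auto simp: A_def intro!: mult_right_mono self_le_power dest: power_increasing[of 1 k "2::real"])
      then show "\<bar>x $ j\<bar> \<le> r k j" using xb[of j] by (auto simp: r_def tall_def split: if_splits)
    qed
    then have "\<xi> x = 1" using M A by (simp add: \<xi>_def)
    then show ?thesis by (simp add: eta_range)
  qed simp
  have sq: "(\<xi>' j x)^2 \<le> (\<Sum>k\<in>A. (1 / real M)^2 * ((bumpK / (2 ^ k * R))^2 * eta (s k) x))" if j: "j \<noteq> N" for j x
  proof -
    have "(\<xi>' j x)^2 = (\<Sum>k\<in>A. (1 / real M * eta' (r k) j x)^2)"
      unfolding \<xi>'_def
    proof (rule sum_square_disjoint[OF A(1)])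
      fix k k' :: nat assume "k \<noteq> k'"
      then have "eta' (r k) j x * eta' (r k') j x = 0"
        by (rule eta'_dyadic_disjoint[of r j R, rotated 2]) (use rp j in \<open>auto simp: r_def tall_def\<close>)
      then show "1 / real M * eta' (r k) j x * (1 / real M * eta' (r k') j x) = 0" by auto
    qed
    also have "\<dots> = (\<Sum>k\<in>A. (1 / real M)^2 * (eta' (r k) j x)^2)" by (simp add: power_mult_distrib power_divide)
    also have "\<dots> \<le> (\<Sum>k\<in>A. (1 / real M)^2 * ((bumpK / r k j)^2 * eta (s k) x))"
      by (intro sum_mono mult_left_mono eta'_square_bound rp rs) auto
    finally show ?thesis using j by (simp add: r_def tall_def)
  qed
  have sqN: "(\<xi>' N x)^2 \<le> (bumpK / (2 * L))^2 * eta (s M) x" for x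
  proof -
    have "\<bar>\<xi>' N x\<bar> \<le> (\<Sum>k\<in>A. 1 / real M * (bumpK / (2 * L) * eta (s M) x))"
      unfolding \<xi>'_def
    proof (rule order_trans[OF sum_abs sum_mono])
      fix k assume k: "k \<in> A"
      have "\<bar>eta' (r k) N x\<bar> \<le> bumpK / r k N * eta (s M) x"
      proof (rule eta'_bound[OF rp])
        fix j
        have "(2::real) ^ k \<le> 2 ^ M" using k by (intro power_increasing) (auto simp: A_def)
        then show "2 * r k j \<le> s M j" using R by (auto simp: r_def s_def tall_def mult_right_mono)
      qed
      then have "1 / real M * \<bar>eta' (r k) N x\<bar> \<le> 1 / real M * (bumpK / (2 * L) * eta (s M) x)"
        by (intro mult_left_mono) (auto simp: r_def tall_def)
      then show "\<bar>1 / real M * eta' (r k) N x\<bar> \<le> 1 / real M * (bumpK / (2 * L) * eta (s M) x)" by (simp add: abs_mult)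
    qed
    also have "\<dots> = bumpK / (2 * L) * eta (s M) x" using M A by simp
    finally have "(\<xi>' N x)^2 \<le> (bumpK / (2 * L) * eta (s M) x)^2" by (metis abs_ge_zero power2_abs power_mono)
    also have "\<dots> = (bumpK / (2 * L))^2 * (eta (s M) x * eta (s M) x)" by (simp add: power2_eq_square)
    also have "\<dots> \<le> (bumpK / (2 * L))^2 * (eta (s M) x * 1)" by (intro mult_left_mono eta_range) auto
    finally show ?thesis by simp
  qed
  define Y where "Y x = 3 * (\<Sum>k\<in>A. (1 / real M)^2 * ((bumpK / (2 ^ k * R))^2 * eta (s k) x)) + (bumpK / (2 * L))^2 * eta (s M) x" for x
  have ccY: "cc Y" unfolding Y_def by (intro cc_add cc_cmult cc_sum ccs)
  have Y: "(\<Sum>j\<in>UNIV. (\<xi>' j x)^2) \<le> Y x" for x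
  proof -
    let ?a = "\<Sum>k\<in>A. (1 / real M)^2 * ((bumpK / (2 ^ k * R))^2 * eta (s k) x)"
    have a0: "0 \<le> ?a" by (intro sum_nonneg mult_nonneg_nonneg eta_range) auto
    have "(\<Sum>j\<in>UNIV. (\<xi>' j x)^2) = (\<xi>' N x)^2 + (\<Sum>j\<in>UNIV-{N}. (\<xi>' j x)^2)" by (rule sum.remove) auto
    also have "(\<Sum>j\<in>UNIV-{N}. (\<xi>' j x)^2) \<le> (\<Sum>j\<in>UNIV-{N}. ?a)" by (intro sum_mono sq) auto
    also have "(\<Sum>j\<in>UNIV-{N}. ?a) = real (CARD('b) - 1) * ?a" by (simp add: card_Diff_singleton)
    also have "\<dots> \<le> 3 * ?a" using dim a0 by (intro mult_right_mono) auto
    finally show ?thesis using sqN[of x] by (simp add: Y_def)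
  qed
  have IY: "(\<integral>x. Y x \<partial>lborel) \<le> 3072 * bumpK^2 * L / M + 64 * bumpK^2 * (2 ^ (M + 1) * R)^2 / L"
  proof -
    have ie: "(\<integral>x. eta (s k) x \<partial>lborel) \<le> 64 * (2 ^ (k + 1) * R)^2 * (4 * L)" for k
      unfolding s_def
    proof (rule integral_eta_tall[OF dim])
      have "(1::real) \<le> 2 ^ (k + 1)" by (rule one_le_power) simp
      then have "1 * 1 \<le> 2 ^ (k + 1) * R" using R by (intro mult_mono) auto
      then show "1 \<le> 2 ^ (k + 1) * R" by simp
    qed (use L in simp)
    have "(\<integral>x. Y x \<partial>lborel) = 3 * (\<Sum>k\<in>A. (1 / real M)^2 * ((bumpK / (2 ^ k * R))^2 * (\<integral>x. eta (s k) x \<partial>lborel))) + (bumpK / (2 * L))^2 * (\<integral>x. eta (s M) x \<partial>lborel)"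
      unfolding Y_def
      by (subst integral_cc_add) (auto intro!: cc_cmult cc_sum ccs simp: integral_cc_sum ccs cc_cmult)
    also have "\<dots> \<le> 3 * (\<Sum>k\<in>A. (1 / real M)^2 * ((bumpK / (2 ^ k * R))^2 * (64 * (2 ^ (k + 1) * R)^2 * (4 * L)))) + (bumpK / (2 * L))^2 * (64 * (2 ^ (M + 1) * R)^2 * (4 * L))"
      by (intro add_mono mult_left_mono sum_mono ie) auto
    also have "(\<Sum>k\<in>A. (1 / real M)^2 * ((bumpK / (2 ^ k * R))^2 * (64 * (2 ^ (k + 1) * R)^2 * (4 * L)))) = (\<Sum>k\<in>A. (1 / real M)^2 * (1024 * bumpK^2 * L))"
      using R by (intro sum.cong refl) (simp add: power_divide power_mult_distrib)
    also have "\<dots> = 1024 * bumpK^2 * L / M" using A M by (simp add: power2_eq_square)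
    also have "(bumpK / (2 * L))^2 * (64 * (2 ^ (M + 1) * R)^2 * (4 * L)) = 64 * bumpK^2 * (2 ^ (M + 1) * R)^2 / L"
      using L by (simp add: power_divide power2_eq_square)
    finally show ?thesis by simp
  qed
  have "(\<Sum>i\<in>UNIV. \<integral>x. eta (tall N R L) x * E i x \<partial>lborel) \<le> (\<Sum>i\<in>UNIV. \<integral>x. (\<xi> x)^2 * E i x \<partial>lborel)"
  proof (intro sum_mono cc_mono)
    fix i x
    show "cc (\<lambda>x. eta (tall N R L) x * E i x)" by (intro cc_mult_right cc_eta cont_E) (use R L in \<open>auto simp: tall_def\<close>)
    show "cc (\<lambda>x. (\<xi> x)^2 * E i x)" unfolding power2_eq_square
      by (intro cc_mult_right ccx cc_cont[OF ccx(1)] cont_E)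
    show "eta (tall N R L) x * E i x \<le> (\<xi> x)^2 * E i x" by (intro mult_right_mono one E_nonneg)
  qed
  also have "\<dots> \<le> 8 * (\<Sum>i\<in>UNIV. \<integral>x. (\<psi> i x)^2 * (\<Sum>k\<in>UNIV. (\<xi>' k x)^2) \<partial>lborel)" by (rule full_energy[OF g bx])
  also have "\<dots> \<le> 8 * (\<Sum>i\<in>(UNIV::'a set). G^2 * (\<integral>x. Y x \<partial>lborel))"
  proof (intro mult_left_mono sum_mono)
    fix i
    have "(\<integral>x. (\<psi> i x)^2 * (\<Sum>k\<in>UNIV. (\<xi>' k x)^2) \<partial>lborel) \<le> (\<integral>x. G^2 * Y x \<partial>lborel)"
    proof (rule cc_mono)
      show "cc (\<lambda>x. (\<psi> i x)^2 * (\<Sum>k\<in>UNIV. (\<xi>' k x)^2))" unfolding power2_eq_square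
        by (intro cc_mult_left cc_sum cc_mult_right ccx cc_cont[OF ccx(2)] continuous_intros cont_P)
      show "cc (\<lambda>x. G^2 * Y x)" by (intro cc_cmult ccY)
      show "(\<psi> i x)^2 * (\<Sum>k\<in>UNIV. (\<xi>' k x)^2) \<le> G^2 * Y x" for x
        by (intro mult_mono psi_square_bound Y sum_nonneg) auto
    qed
    then show "(\<integral>x. (\<psi> i x)^2 * (\<Sum>k\<in>UNIV. (\<xi>' k x)^2) \<partial>lborel) \<le> G^2 * (\<integral>x. Y x \<partial>lborel)" by simp
  qed simp
  also have "\<dots> = 8 * m * G^2 * (\<integral>x. Y x \<partial>lborel)" by (simp add: m_def)
  also have "\<dots> \<le> 8 * m * G^2 * (3072 * bumpK^2 * L / M + 64 * bumpK^2 * (2 ^ (M + 1) * R)^2 / L)"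
    by (rule mult_left_mono[OF IY]) (simp add: m_def)
  also have "\<dots> = Q * 3072 / M * L + X / L" by (simp add: Q_def X_def algebra_simps)
  also have "\<dots> \<le> \<epsilon> / 2 * L + \<epsilon> / 2 * L" using M(2) L by (intro add_mono mult_right_mono) auto
  finally have "(\<Sum>i\<in>UNIV. \<integral>x. eta (tall N R L) x * E i x \<partial>lborel) \<le> \<epsilon> * L" by (simp add: mult.commute)
  then show ?thesis using L(1) by blast
qed

text \<open>By the definition of \<open>\<sigma>\<close>, \<open>\<partial>\<^sub>l\<psi> = \<psi> (\<partial>\<^sub>l\<phi> / \<phi>) + \<phi> \<partial>\<^sub>l\<sigma>\<close>. Divided by the square root, the first term
  is at most the logarithmic gradient of \<open>\<phi>\<close>, and the second is at most \<open>|\<phi> \<partial>\<^sub>l\<sigma>| / \<tau>\<close>, whose square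
  is bounded by the energy density over \<open>\<tau>\<^sup>2\<close>.\<close>

lemma line_energy_bound:
  "\<exists>C\<ge>0. \<forall>R\<ge>1. \<forall>L\<ge>R. \<forall>\<tau>>0. \<forall>i.
     (\<integral>x. eta (tall N R L) x * (\<bar>D i l l x\<bar> / sqrt ((\<psi> i x)^2 + \<tau>^2)) \<partial>lborel)
       \<le> C * R^2 * L + (\<integral>x. eta (tall N R L) x * E i x \<partial>lborel) / \<tau>^2"
proof -
  define C where "C = 64 + (12 * bumpK^2 * 4096 + 2 * \<Lambda> * 512)"
  have C: "C \<ge> 0" using \<Lambda>_nonneg by (simp add: C_def)
  have main: "(\<integral>x. eta (tall N R L) x * (\<bar>D i l l x\<bar> / sqrt ((\<psi> i x)^2 + \<tau>^2)) \<partial>lborel)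
       \<le> C * R^2 * L + (\<integral>x. eta (tall N R L) x * E i x \<partial>lborel) / \<tau>^2"
    if R: "R \<ge> 1" and L: "L \<ge> R" and \<tau>: "\<tau> > 0" for R L \<tau> i
  proof -
    let ?e = "eta (tall N R L)" and ?f = "eta (tall N (2 * R) (2 * L))" and ?g = "eta (tall N (4 * R) (4 * L))"
    have L1: "L \<ge> 1" using R L by linarith
    have ccs: "cc ?e" "cc ?f" "cc ?g" by (rule cc_eta; use R L in \<open>auto simp: tall_def\<close>)+
    have ccf': "cc (eta' (tall N (2 * R) (2 * L)) k)" for k by (rule cc_eta; use R L in \<open>auto simp: tall_def\<close>)
    have ne: "\<phi> i x \<noteq> 0" for x by (rule monotone)
    have sq: "sqrt ((\<psi> i x)^2 + \<tau>^2) > 0" for x using \<tau> by (simp add: add_nonneg_pos)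
    define q where "q x = (\<Sum>k\<in>UNIV. (D i N k x / \<phi> i x)^2)" for x
    have q0: "q x \<ge> 0" for x unfolding q_def by (intro sum_nonneg) auto
    have cq: "continuous_on S q" for S unfolding q_def by (intro continuous_intros cont_D cont_P) (auto simp: ne)
    have pt: "\<bar>D i l l x\<bar> / sqrt ((\<psi> i x)^2 + \<tau>^2) \<le> 1 + q x + E i x / \<tau>^2" for x
    proof -
      let ?s = "sqrt ((\<psi> i x)^2 + \<tau>^2)"
      have D: "D i l l x = \<psi> i x * (D i N l x / \<phi> i x) + \<phi> i x * \<sigma>' i l x"
        using ne[of x] by (simp add: \<sigma>'_def W_def field_simps power2_eq_square)
      have s1: "\<bar>\<psi> i x\<bar> \<le> ?s" by (rule real_le_rsqrt) simp
      have s2: "\<tau> \<le> ?s" by (rule real_le_rsqrt) simp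
      have "\<bar>D i l l x\<bar> \<le> \<bar>\<psi> i x\<bar> * \<bar>D i N l x / \<phi> i x\<bar> + \<bar>\<phi> i x * \<sigma>' i l x\<bar>"
        unfolding D using abs_triangle_ineq[of "\<psi> i x * (D i N l x / \<phi> i x)" "\<phi> i x * \<sigma>' i l x"] by (simp only: abs_mult)
      also have "\<dots> \<le> ?s * \<bar>D i N l x / \<phi> i x\<bar> + ?s * (\<bar>\<phi> i x * \<sigma>' i l x\<bar> / \<tau>)"
      proof (intro add_mono mult_right_mono s1)
        have "\<tau> * (\<bar>\<phi> i x * \<sigma>' i l x\<bar> / \<tau>) \<le> ?s * (\<bar>\<phi> i x * \<sigma>' i l x\<bar> / \<tau>)"
          using s2 \<tau> by (intro mult_right_mono) auto
        then show "\<bar>\<phi> i x * \<sigma>' i l x\<bar> \<le> ?s * (\<bar>\<phi> i x * \<sigma>' i l x\<bar> / \<tau>)" using \<tau> by simp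
      qed simp
      also have "\<dots> = (\<bar>D i N l x / \<phi> i x\<bar> + \<bar>\<phi> i x * \<sigma>' i l x\<bar> / \<tau>) * ?s"
        by (simp only: distrib_left mult.commute)
      finally have "\<bar>D i l l x\<bar> / ?s \<le> \<bar>D i N l x / \<phi> i x\<bar> + \<bar>\<phi> i x * \<sigma>' i l x\<bar> / \<tau>"
        using pos_divide_le_eq[OF sq[of x]] by blast
      moreover have "\<bar>a\<bar> \<le> 1 / 2 + a^2" for a :: real
      proof -
        have "0 \<le> (\<bar>a\<bar> - 1/2)^2" by simp
        then show ?thesis by (simp add: power2_eq_square algebra_simps)
      qed
      note this[of "D i N l x / \<phi> i x"] this[of "\<phi> i x * \<sigma>' i l x / \<tau>"]
      moreover have "(D i N l x / \<phi> i x)^2 \<le> q x" unfolding q_def by (rule member_le_sum) auto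
      moreover have "(\<phi> i x * \<sigma>' i l x / \<tau>)^2 \<le> E i x / \<tau>^2"
      proof -
        have "(\<sigma>' i l x)^2 \<le> (\<Sum>k\<in>UNIV. (\<sigma>' i k x)^2)" by (rule member_le_sum) auto
        then have "(\<phi> i x)^2 * (\<sigma>' i l x)^2 \<le> E i x" unfolding E_def by (rule mult_left_mono) simp
        then show ?thesis by (simp add: power_mult_distrib power_divide divide_right_mono)
      qed
      ultimately show ?thesis using \<tau> by (simp add: abs_divide)
    qed
    have lg: "(\<integral>x. (?f x)^2 * q x \<partial>lborel) \<le> (\<integral>x. 4 * (\<Sum>k\<in>UNIV. (eta' (tall N (2 * R) (2 * L)) k x)^2) + 2 * \<Lambda> * (?f x)^2 \<partial>lborel)"
      unfolding q_def by (rule log_gradient_bound[OF has_grad_eta eta_support]) (use R L in \<open>auto simp: tall_def\<close>)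
    also have "\<dots> \<le> (\<integral>x. 12 * bumpK^2 * ?g x + 2 * \<Lambda> * ?f x \<partial>lborel)"
    proof (rule cc_mono)
      show "cc (\<lambda>x. 4 * (\<Sum>k\<in>UNIV. (eta' (tall N (2 * R) (2 * L)) k x)^2) + 2 * \<Lambda> * (?f x)^2)"
        unfolding power2_eq_square by (intro cc_add cc_cmult cc_sum cc_mult_right ccf' ccs cc_cont[OF ccf'] cc_cont[OF ccs(2)])
      show "cc (\<lambda>x. 12 * bumpK^2 * ?g x + 2 * \<Lambda> * ?f x)" by (intro cc_add cc_cmult ccs)
      fix x
      have "(eta' (tall N (2 * R) (2 * L)) k x)^2 \<le> bumpK^2 * ?g x" for k
      proof -
        have "(eta' (tall N (2 * R) (2 * L)) k x)^2 \<le> (bumpK / tall N (2 * R) (2 * L) k)^2 * ?g x"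
          by (rule eta'_square_bound) (use R L in \<open>auto simp: tall_def\<close>)
        also have "\<dots> \<le> bumpK^2 * ?g x"
        proof (intro mult_right_mono eta_range power_mono)
          have "1 \<le> tall N (2 * R) (2 * L) k" using R L1 by (simp add: tall_def)
          then show "bumpK / tall N (2 * R) (2 * L) k \<le> bumpK" using bumpK(1) by (simp add: divide_le_eq)
          show "0 \<le> bumpK / tall N (2 * R) (2 * L) k" using R L bumpK(1) by (simp add: tall_def)
        qed
        finally show ?thesis .
      qed
      then have "(\<Sum>k\<in>UNIV. (eta' (tall N (2 * R) (2 * L)) k x)^2) \<le> (\<Sum>k\<in>(UNIV::'b set). bumpK^2 * ?g x)" by (intro sum_mono)
      also have "\<dots> = real CARD('b) * (bumpK^2 * ?g x)" by simp
      also have "\<dots> \<le> 3 * (bumpK^2 * ?g x)" using dim eta_range by (intro mult_right_mono mult_nonneg_nonneg) auto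
      finally have "4 * (\<Sum>k\<in>UNIV. (eta' (tall N (2 * R) (2 * L)) k x)^2) \<le> 12 * bumpK^2 * ?g x" by simp
      moreover have "(?f x)^2 \<le> ?f x" using eta_range[of _ x] by (simp add: power2_eq_square mult_left_le_one_le)
      then have "2 * \<Lambda> * (?f x)^2 \<le> 2 * \<Lambda> * ?f x" using \<Lambda>_nonneg by (intro mult_left_mono) auto
      ultimately show "4 * (\<Sum>k\<in>UNIV. (eta' (tall N (2 * R) (2 * L)) k x)^2) + 2 * \<Lambda> * (?f x)^2 \<le> 12 * bumpK^2 * ?g x + 2 * \<Lambda> * ?f x"
        by linarith
    qed
    also have "\<dots> = 12 * bumpK^2 * (\<integral>x. ?g x \<partial>lborel) + 2 * \<Lambda> * (\<integral>x. ?f x \<partial>lborel)"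
      by (subst integral_cc_add) (auto intro!: cc_cmult ccs)
    also have "\<dots> \<le> 12 * bumpK^2 * (64 * (4 * R)^2 * (4 * L)) + 2 * \<Lambda> * (64 * (2 * R)^2 * (2 * L))"
      by (intro add_mono mult_left_mono integral_eta_tall dim) (use R L \<Lambda>_nonneg in auto)
    also have "\<dots> = (12 * bumpK^2 * 4096 + 2 * \<Lambda> * 512) * R^2 * L" by (simp add: power2_eq_square algebra_simps)
    finally have lg: "(\<integral>x. (?f x)^2 * q x \<partial>lborel) \<le> (12 * bumpK^2 * 4096 + 2 * \<Lambda> * 512) * R^2 * L" .
    have le: "?e x \<le> (?f x)^2" for x
    proof (cases "?e x = 0")
      case False
      have "\<bar>x $ j\<bar> \<le> tall N (2 * R) (2 * L) j" for j
      proof (rule ccontr)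
        assume "\<not> \<bar>x $ j\<bar> \<le> tall N (2 * R) (2 * L) j"
        then have "?e x = 0" by (intro eta_zero[of _ j]) (use R L in \<open>auto simp: tall_def split: if_splits\<close>)
        then show False using False by simp
      qed
      then have "?f x = 1" by (intro eta_one) (use R L in \<open>auto simp: tall_def\<close>)
      then show ?thesis by (simp add: eta_range)
    qed simp
    have "(\<integral>x. ?e x * (\<bar>D i l l x\<bar> / sqrt ((\<psi> i x)^2 + \<tau>^2)) \<partial>lborel) \<le> (\<integral>x. (?e x + (?f x)^2 * q x) + 1 / \<tau>^2 * (?e x * E i x) \<partial>lborel)"
    proof (rule cc_mono)
      show "cc (\<lambda>x. ?e x * (\<bar>D i l l x\<bar> / sqrt ((\<psi> i x)^2 + \<tau>^2)))"
        using sq by (intro cc_mult_right ccs continuous_intros cont_D cont_P) (metis less_irrefl)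
      show "cc (\<lambda>x. (?e x + (?f x)^2 * q x) + 1 / \<tau>^2 * (?e x * E i x))" unfolding power2_eq_square
        by (intro cc_add cc_cmult cc_mult_right ccs cc_cont[OF ccs(2)] cq cont_E)
      fix x
      have "?e x * (\<bar>D i l l x\<bar> / sqrt ((\<psi> i x)^2 + \<tau>^2)) \<le> ?e x * (1 + q x + E i x / \<tau>^2)"
        by (intro mult_left_mono pt eta_range)
      also have "\<dots> = ?e x + ?e x * q x + 1 / \<tau>^2 * (?e x * E i x)" by (simp add: algebra_simps)
      also have "\<dots> \<le> ?e x + (?f x)^2 * q x + 1 / \<tau>^2 * (?e x * E i x)"
        using mult_right_mono[OF le q0[of x], of x] by simp
      finally show "?e x * (\<bar>D i l l x\<bar> / sqrt ((\<psi> i x)^2 + \<tau>^2)) \<le> ?e x + (?f x)^2 * q x + 1 / \<tau>^2 * (?e x * E i x)" .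
    qed
    also have "\<dots> = (\<integral>x. ?e x + (?f x)^2 * q x \<partial>lborel) + (\<integral>x. 1 / \<tau>^2 * (?e x * E i x) \<partial>lborel)"
      unfolding power2_eq_square
      by (rule integral_cc_add) (intro cc_add cc_cmult cc_mult_right ccs cc_cont[OF ccs(2)] cq cont_E)+
    also have "(\<integral>x. ?e x + (?f x)^2 * q x \<partial>lborel) = (\<integral>x. ?e x \<partial>lborel) + (\<integral>x. (?f x)^2 * q x \<partial>lborel)"
      unfolding power2_eq_square
      by (rule integral_cc_add) (intro cc_mult_right ccs cc_cont[OF ccs(2)] cq)+
    also have "(\<integral>x. 1 / \<tau>^2 * (?e x * E i x) \<partial>lborel) = (\<integral>x. ?e x * E i x \<partial>lborel) / \<tau>^2" by simp
    finally show ?thesis using lg integral_eta_tall[OF dim R, of L N] L1 by (simp add: C_def algebra_simps)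
  qed
  show ?thesis using C main by blast
qed

text \<open>Integrate \<open>integral_abs_line\<close> for \<open>\<psi>\<close> on segments of length \<open>R\<close> in direction \<open>l\<close> over the starting
  points in a cylinder. The first term is bounded because \<open>u\<close> is, the second because \<open>\<delta> = 1 / R\<close>, and
  the third by \<open>line_energy_bound\<close>, once \<open>L\<close> is so large that the energy of \<open>\<sigma>\<close> in the cylinder is
  below \<open>\<tau>\<^sup>2 L\<close>.\<close>

lemma tall_average:
  "\<exists>C\<ge>0. \<forall>R\<ge>1. \<exists>L\<ge>R. \<forall>i. (\<integral>x. eta (tall N R L) x * \<bar>\<psi> i x\<bar> \<partial>lborel) \<le> C * R * L"
proof -
  obtain C0 where C0: "C0 \<ge> 0" and le: "\<And>R L \<tau> i. R \<ge> 1 \<Longrightarrow> L \<ge> R \<Longrightarrow> \<tau> > 0 \<Longrightarrow>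
     (\<integral>x. eta (tall N R L) x * (\<bar>D i l l x\<bar> / sqrt ((\<psi> i x)^2 + \<tau>^2)) \<partial>lborel)
       \<le> C0 * R^2 * L + (\<integral>x. eta (tall N R L) x * E i x \<partial>lborel) / \<tau>^2"
    using line_energy_bound by blast
  define C6 where "C6 = C0 * 49 * 4 + 4"
  define C where "C = (2 * U + 2) * 1152 + G / 2 * C6"
  have C: "C \<ge> 0" using U_nonneg G_nonneg C0 by (simp add: C_def C6_def)
  have "\<exists>L\<ge>R. \<forall>i. (\<integral>x. eta (tall N R L) x * \<bar>\<psi> i x\<bar> \<partial>lborel) \<le> C * R * L" if R: "R \<ge> 1" for R
  proof -
    define \<delta> where "\<delta> = 1 / R"
    \<comment> \<open>With this choice \<open>arsinh (\<delta> / \<tau>) = R\<^sup>2\<close>, which compensates the order \<open>R\<^sup>2 L\<close> of the bound in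
      \<open>line_energy_bound\<close>.\<close>
    define \<tau> where "\<tau> = \<delta> / sinh (R^2)"
    have R2: "R^2 > 0" using R by simp
    then have sh: "sinh (R^2) > 0" by simp
    have \<delta>: "\<delta> > 0" using R by (simp add: \<delta>_def)
    have \<tau>: "\<tau> > 0" using \<delta> sh by (simp add: \<tau>_def)
    have as: "arsinh (\<delta> / \<tau>) = R^2" using \<delta> sh by (simp add: \<tau>_def arsinh_sinh_real)
    have "7 * R \<ge> 1" using R by simp
    \<comment> \<open>The factor \<open>7\<close> makes room for the doubled radius \<open>3 R\<close> and for a shift by \<open>R\<close>.\<close>
    then obtain L' where L': "L' \<ge> 7 * R" "(\<Sum>i\<in>UNIV. \<integral>x. eta (tall N (7 * R) L') x * E i x \<partial>lborel) \<le> \<tau>^2 * L'"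
      using tall_energy[of "7 * R" "\<tau>^2"] \<tau> by auto
    define L where "L = L' / 4"
    have LL: "L' = 4 * L" by (simp add: L_def)
    have L: "L \<ge> R" "L \<ge> 1" using L' R by (auto simp: L_def)
    have "(\<integral>x. eta (tall N R L) x * \<bar>\<psi> i x\<bar> \<partial>lborel) \<le> C * R * L" for i
    proof -
      let ?e = "axis l (1::real)"
      let ?\<eta> = "eta (tall N R L)" and ?\<xi> = "eta (tall N (3 * R) (2 * L))" and ?\<theta> = "eta (tall N (7 * R) (4 * L))"
      define H where "H x = \<bar>D i l l x\<bar> / sqrt ((\<psi> i x)^2 + \<tau>^2)" for x
      have sq: "sqrt ((\<psi> i x)^2 + \<tau>^2) > 0" for x using \<tau> by (simp add: add_nonneg_pos)
      have cH: "continuous_on S H" for S unfolding H_def using sq by (intro continuous_intros cont_D cont_P) (metis less_irrefl)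
      have H0: "H x \<ge> 0" for x unfolding H_def by simp
      have ap: "continuous_on S (\<lambda>x. \<bar>\<psi> i x\<bar>)" for S by (intro continuous_intros cont_P)
      have ccs: "cc ?\<eta>" "cc ?\<xi>" "cc ?\<theta>" by (rule cc_eta; use R L in \<open>auto simp: tall_def\<close>)+
      have R0: "0 \<le> R" using R by simp
      have shift: "(\<integral>x. ?\<xi> x * h (x + t *\<^sub>R ?e) \<partial>lborel) = (\<integral>x. ?\<xi> (x - t *\<^sub>R ?e) * h x \<partial>lborel)"
        and ccshift: "cc (\<lambda>x. ?\<xi> (x - t *\<^sub>R ?e) * h x)" if h: "continuous_on UNIV h" for t h
      proof -
        have c: "cc (\<lambda>x. ?\<xi> (x + - (t *\<^sub>R ?e)) * h x)" by (intro cc_mult_right cc_shift ccs h)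
        then show "cc (\<lambda>x. ?\<xi> (x - t *\<^sub>R ?e) * h x)" by simp
        show "(\<integral>x. ?\<xi> x * h (x + t *\<^sub>R ?e) \<partial>lborel) = (\<integral>x. ?\<xi> (x - t *\<^sub>R ?e) * h x \<partial>lborel)"
          using integral_shift[OF c, of "t *\<^sub>R ?e"] by simp
      qed
      have low: "?\<eta> x \<le> ?\<xi> (x - t *\<^sub>R ?e)" if t: "0 \<le> t" "t \<le> R" for x t
      proof (cases "?\<eta> x = 0")
        case False
        have "\<bar>(x - t *\<^sub>R ?e) $ j\<bar> \<le> tall N (3 * R) (2 * L) j" for j
        proof (rule ccontr)
          assume "\<not> \<bar>(x - t *\<^sub>R ?e) $ j\<bar> \<le> tall N (3 * R) (2 * L) j"
          then have "2 * tall N R L j \<le> \<bar>x $ j\<bar>" using l_ne t by (auto simp: tall_def axis_def split: if_splits)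
          then have "?\<eta> x = 0" by (intro eta_zero[of _ j]) (use R L in \<open>auto simp: tall_def\<close>)
          then show False using False by simp
        qed
        then have "?\<xi> (x - t *\<^sub>R ?e) = 1" by (intro eta_one) (use R L in \<open>auto simp: tall_def\<close>)
        then show ?thesis by (simp add: eta_range)
      qed (simp add: eta_range)
      have up: "?\<xi> (x - t *\<^sub>R ?e) \<le> ?\<theta> x" if t: "0 \<le> t" "t \<le> R" for x t
      proof (cases "?\<xi> (x - t *\<^sub>R ?e) = 0")
        case False
        have "\<bar>x $ j\<bar> \<le> tall N (7 * R) (4 * L) j" for j
        proof (rule ccontr)
          assume "\<not> \<bar>x $ j\<bar> \<le> tall N (7 * R) (4 * L) j"
          then have "2 * tall N (3 * R) (2 * L) j \<le> \<bar>(x - t *\<^sub>R ?e) $ j\<bar>" using l_ne t by (auto simp: tall_def axis_def split: if_splits)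
          then have "?\<xi> (x - t *\<^sub>R ?e) = 0" by (intro eta_zero[of _ j]) (use R L in \<open>auto simp: tall_def\<close>)
          then show False using False by simp
        qed
        then have "?\<theta> x = 1" by (intro eta_one) (use R L in \<open>auto simp: tall_def\<close>)
        then show ?thesis by (simp add: eta_range)
      qed (simp add: eta_range)
      define K where "K = G * R / (2 * R^2)"
      have K: "K \<ge> 0" using G_nonneg R by (simp add: K_def)
      have line: "integral {0..R} (\<lambda>t. \<bar>\<psi> i (x + t *\<^sub>R ?e)\<bar>) \<le> 2 * U + 2 + K * integral {0..R} (\<lambda>t. H (x + t *\<^sub>R ?e))" for x
      proof -
        have "integral {0..R} (\<lambda>t. \<bar>\<psi> i (x + t *\<^sub>R ?e)\<bar>) \<le> \<bar>integral {0..R} (\<lambda>t. \<psi> i (x + t *\<^sub>R ?e))\<bar> + 2 * \<delta> * R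
          + G * R / (2 * arsinh (\<delta> / \<tau>)) * integral {0..R} (\<lambda>t. \<bar>D i l l (x + t *\<^sub>R ?e)\<bar> / sqrt ((\<psi> i (x + t *\<^sub>R ?e))^2 + \<tau>^2))"
          by (rule integral_abs_line) (auto intro: has_grad_line_axis[OF grad_P] P_bound R0 \<delta> \<tau>
              intro!: continuous_on_compose2[OF cont_D[of UNIV]] continuous_intros)
        also have "\<bar>integral {0..R} (\<lambda>t. \<psi> i (x + t *\<^sub>R ?e))\<bar> \<le> 2 * U"
        proof -
          have "((\<lambda>t. \<psi> i (x + t *\<^sub>R ?e)) has_integral (u i (x + R *\<^sub>R ?e) - u i (x + 0 *\<^sub>R ?e))) {0..R}"
            by (rule fundamental_theorem_of_calculus[OF R0])
               (auto simp: has_real_derivative_iff_has_vector_derivative[symmetric] intro: has_field_derivative_at_within has_grad_line_axis[OF grad_u])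
          then have "integral {0..R} (\<lambda>t. \<psi> i (x + t *\<^sub>R ?e)) = u i (x + R *\<^sub>R ?e) - u i x" by (simp add: integral_unique)
          then show ?thesis using u_bound[of i "x + R *\<^sub>R ?e"] u_bound[of i x] by linarith
        qed
        also have "2 * \<delta> * R = 2" using R by (simp add: \<delta>_def)
        finally show ?thesis by (simp add: as H_def K_def)
      qed
      have "R * (\<integral>x. ?\<eta> x * \<bar>\<psi> i x\<bar> \<partial>lborel) = integral {0..R} (\<lambda>t. \<integral>x. ?\<eta> x * \<bar>\<psi> i x\<bar> \<partial>lborel)" using R0 by simp
      also have "\<dots> \<le> integral {0..R} (\<lambda>t. \<integral>x. ?\<xi> x * \<bar>\<psi> i (x + t *\<^sub>R ?e)\<bar> \<partial>lborel)"
      proof (rule integral_le)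
        show "(\<lambda>t. \<integral>x. ?\<xi> x * \<bar>\<psi> i (x + t *\<^sub>R ?e)\<bar> \<partial>lborel) integrable_on {0..R}"
          by (rule integrable_continuous_real, rule swap_line(3)[OF ap ccs(2) R0])
        fix t assume "t \<in> {0..R}"
        then show "(\<integral>x. ?\<eta> x * \<bar>\<psi> i x\<bar> \<partial>lborel) \<le> (\<integral>x. ?\<xi> x * \<bar>\<psi> i (x + t *\<^sub>R ?e)\<bar> \<partial>lborel)"
          unfolding shift[OF ap] by (intro cc_mono cc_mult_right[OF ccs(1) ap] ccshift ap mult_right_mono low) auto
      qed auto
      also have "\<dots> = (\<integral>x. ?\<xi> x * integral {0..R} (\<lambda>t. \<bar>\<psi> i (x + t *\<^sub>R ?e)\<bar>) \<partial>lborel)"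
        by (rule swap_line(1)[OF ap ccs(2) R0, symmetric])
      also have "\<dots> \<le> (\<integral>x. (2 * U + 2) * ?\<xi> x + K * (?\<xi> x * integral {0..R} (\<lambda>t. H (x + t *\<^sub>R ?e))) \<partial>lborel)"
      proof (rule cc_mono)
        show "cc (\<lambda>x. ?\<xi> x * integral {0..R} (\<lambda>t. \<bar>\<psi> i (x + t *\<^sub>R ?e)\<bar>))" by (rule swap_line(2)[OF ap ccs(2) R0])
        show "cc (\<lambda>x. (2 * U + 2) * ?\<xi> x + K * (?\<xi> x * integral {0..R} (\<lambda>t. H (x + t *\<^sub>R ?e))))"
          by (intro cc_add cc_cmult ccs swap_line(2)[OF cH ccs(2) R0])
        fix x
        have "?\<xi> x * integral {0..R} (\<lambda>t. \<bar>\<psi> i (x + t *\<^sub>R ?e)\<bar>) \<le> ?\<xi> x * (2 * U + 2 + K * integral {0..R} (\<lambda>t. H (x + t *\<^sub>R ?e)))"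
          by (intro mult_left_mono line eta_range)
        then show "?\<xi> x * integral {0..R} (\<lambda>t. \<bar>\<psi> i (x + t *\<^sub>R ?e)\<bar>) \<le> (2 * U + 2) * ?\<xi> x + K * (?\<xi> x * integral {0..R} (\<lambda>t. H (x + t *\<^sub>R ?e)))"
          by (simp add: algebra_simps)
      qed
      also have "\<dots> = (2 * U + 2) * (\<integral>x. ?\<xi> x \<partial>lborel) + K * (\<integral>x. ?\<xi> x * integral {0..R} (\<lambda>t. H (x + t *\<^sub>R ?e)) \<partial>lborel)"
        by (subst integral_cc_add) (intro cc_cmult ccs swap_line(2)[OF cH ccs(2) R0], intro cc_cmult ccs swap_line(2)[OF cH ccs(2) R0], simp)
      also have "(\<integral>x. ?\<xi> x * integral {0..R} (\<lambda>t. H (x + t *\<^sub>R ?e)) \<partial>lborel) = integral {0..R} (\<lambda>t. \<integral>x. ?\<xi> x * H (x + t *\<^sub>R ?e) \<partial>lborel)"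
        by (rule swap_line(1)[OF cH ccs(2) R0])
      finally have 1: "R * (\<integral>x. ?\<eta> x * \<bar>\<psi> i x\<bar> \<partial>lborel) \<le> (2 * U + 2) * (\<integral>x. ?\<xi> x \<partial>lborel) + K * integral {0..R} (\<lambda>t. \<integral>x. ?\<xi> x * H (x + t *\<^sub>R ?e) \<partial>lborel)" .
      have "integral {0..R} (\<lambda>t. \<integral>x. ?\<xi> x * H (x + t *\<^sub>R ?e) \<partial>lborel) \<le> integral {0..R} (\<lambda>t. \<integral>x. ?\<theta> x * H x \<partial>lborel)"
      proof (rule integral_le)
        show "(\<lambda>t. \<integral>x. ?\<xi> x * H (x + t *\<^sub>R ?e) \<partial>lborel) integrable_on {0..R}"
          by (rule integrable_continuous_real, rule swap_line(3)[OF cH ccs(2) R0])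
        fix t assume "t \<in> {0..R}"
        then show "(\<integral>x. ?\<xi> x * H (x + t *\<^sub>R ?e) \<partial>lborel) \<le> (\<integral>x. ?\<theta> x * H x \<partial>lborel)"
          unfolding shift[OF cH] by (intro cc_mono ccshift cH cc_mult_right[OF ccs(3) cH] mult_right_mono up H0) auto
      qed auto
      also have "\<dots> = R * (\<integral>x. ?\<theta> x * H x \<partial>lborel)" using R0 by simp
      also have "\<dots> \<le> R * (C6 * R^2 * L)"
      proof (rule mult_left_mono)
        have h1: "(\<integral>x. ?\<theta> x * H x \<partial>lborel) \<le> C0 * (7 * R)^2 * (4 * L) + (\<integral>x. ?\<theta> x * E i x \<partial>lborel) / \<tau>^2"
          unfolding H_def by (rule le) (use R L' \<tau> LL in auto)
        have "(\<integral>x. ?\<theta> x * E i x \<partial>lborel) \<le> (\<Sum>i\<in>UNIV. \<integral>x. ?\<theta> x * E i x \<partial>lborel)"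
          by (rule member_le_sum) (auto intro!: cc_nonneg mult_nonneg_nonneg eta_range E_nonneg)
        then have "(\<integral>x. ?\<theta> x * E i x \<partial>lborel) \<le> \<tau>^2 * (4 * L)" using L'(2) unfolding LL by linarith
        then have h2: "(\<integral>x. ?\<theta> x * E i x \<partial>lborel) / \<tau>^2 \<le> 4 * L" using \<tau> by (simp add: divide_le_eq mult.commute)
        have "4 * L * 1 \<le> 4 * L * R^2" using L R by (intro mult_left_mono) (auto simp: one_le_power)
        moreover have "C0 * (7 * R)^2 * (4 * L) + 4 * L * R^2 = C6 * R^2 * L" by (simp add: C6_def power_mult_distrib algebra_simps)
        ultimately show "(\<integral>x. ?\<theta> x * H x \<partial>lborel) \<le> C6 * R^2 * L" using h1 h2 by linarith
      qed (rule R0)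
      finally have 2: "integral {0..R} (\<lambda>t. \<integral>x. ?\<xi> x * H (x + t *\<^sub>R ?e) \<partial>lborel) \<le> R * (C6 * R^2 * L)" .
      have 3: "(\<integral>x. ?\<xi> x \<partial>lborel) \<le> 1152 * R^2 * L"
        using integral_eta_tall[OF dim, of "3 * R" "2 * L" N] R L by (simp add: power_mult_distrib)
      have "R * (\<integral>x. ?\<eta> x * \<bar>\<psi> i x\<bar> \<partial>lborel) \<le> (2 * U + 2) * (1152 * R^2 * L) + K * (R * (C6 * R^2 * L))"
        by (rule order_trans[OF 1]) (intro add_mono mult_left_mono 2 3 K, use U_nonneg in simp)
      also have "\<dots> = R * (C * R * L)" using R by (simp add: C_def K_def power2_eq_square field_simps)
      finally show ?thesis using R by simp
    qed
    then show ?thesis using L(1) by blast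
  qed
  then show ?thesis using C by blast
qed

end

section \<open>The flux bound\<close>

lemma ln_ge_half: assumes "2 \<le> R" shows "1 / 2 \<le> ln (R::real)"
proof -
  have "ln (1 / 2) \<le> 1 / 2 - (1::real)" by (rule ln_le_minus_one) simp
  then have "1 / 2 \<le> ln (2::real)" by (simp add: ln_div)
  also have "\<dots> \<le> ln R" using assms by simp
  finally show ?thesis .
qed

text \<open>The derivative is chosen as \<open>1 / ((1 + |s|) (1 + B |s|))\<close>. The function then grows like \<open>ln (1 + |s|)\<close>
  up to \<open>|s| = 1 / B\<close> and not much further, so that it is bounded by a multiple of \<open>ln (1 / B)\<close>,
  while the reciprocal of its derivative grows linearly up to that point. For \<open>|s| \<le> 1\<close> the bound by
  \<open>|s|\<close> is used instead of the logarithm.\<close>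

lemma logarithmic_nonlinearity:
  fixes B :: real
  assumes B: "0 < B" "B \<le> 1/8"
  shows "\<exists>\<beta> \<beta>'. (\<forall>s. (\<beta> has_real_derivative \<beta>' s) (at s)) \<and> continuous_on UNIV \<beta>' \<and> (\<forall>s. \<beta>' s > 0)
    \<and> (\<forall>s. (\<beta> s)^2 / \<beta>' s \<le> 8 * (ln (1/B))^2 * (\<bar>s\<bar> + B * s^2))
    \<and> (\<forall>s. \<beta>' s * s^2 \<le> \<bar>s\<bar>) \<and> (\<forall>s. 1 / \<beta>' s \<le> 2 * (1 + \<bar>s\<bar> + B * s^2))"
proof -
  define b where "b s = 1 / ((1 + \<bar>s\<bar>) * (1 + B * \<bar>s\<bar>))" for s :: real
  have d1: "1 + \<bar>s\<bar> > 0" "1 + B * \<bar>s\<bar> > 0" for s :: real using B by (auto intro: add_pos_nonneg)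
  have dn: "(1 + \<bar>s\<bar>) * (1 + B * \<bar>s\<bar>) > 0" for s using d1 by simp
  have bp: "b s > 0" for s using dn[of s] by (simp add: b_def)
  have bc: "continuous_on S b" for S unfolding b_def using dn by (intro continuous_intros) (metis less_irrefl)
  have b1: "b s \<le> 1" for s
  proof -
    have "1 * 1 \<le> (1 + \<bar>s\<bar>) * (1 + B * \<bar>s\<bar>)" using B by (intro mult_mono) auto
    then show ?thesis using dn[of s] by (simp add: b_def divide_le_eq)
  qed
  obtain F where F: "\<And>s. (F has_real_derivative b s) (at s)"
  proof -
    have "\<exists>F. \<forall>x. - \<infinity> < ereal x \<longrightarrow> ereal x < \<infinity> \<longrightarrow> (F has_vector_derivative b x) (at x)"
      by (rule einterval_antiderivative) (use bc[of UNIV] in \<open>auto simp: continuous_on_eq_continuous_at\<close>)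
    then show thesis using that by (auto simp: has_real_derivative_iff_has_vector_derivative)
  qed
  define \<beta> where "\<beta> s = F s - F 0" for s
  have \<beta>: "(\<beta> has_real_derivative b s) (at s)" for s
    unfolding \<beta>_def by (auto intro!: derivative_eq_intros F)
  have "\<bar>\<beta> s\<bar> \<le> \<bar>s\<bar> \<and> \<bar>\<beta> s\<bar> \<le> 2 * ln (1 / B)" for s
  proof -
    \<comment> \<open>The antiderivative on the half-line, by partial fractions.\<close>
    define g where "g s = (ln (1 + s) - ln (1 + B * s)) / (1 - B)" for s
    have dg: "(g has_real_derivative b s) (at s)" if "s \<ge> 0" for s
    proof -
      have p: "1 + s > 0" "1 + B * s > 0" "1 - B > 0" using that B by (auto intro: add_pos_nonneg)
      have "(g has_real_derivative (1 / (1 + s) - B / (1 + B * s)) / (1 - B)) (at s)"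
        unfolding g_def using p by (auto intro!: derivative_eq_intros simp: divide_inverse)
      moreover have "(1 / (1 + s) - B / (1 + B * s)) / (1 - B) = b s"
      proof -
        have "1 / (1 + s) - B / (1 + B * s) = (1 - B) / ((1 + s) * (1 + B * s))" using p by (simp add: field_simps)
        then show ?thesis using that p by (simp add: b_def)
      qed
      ultimately show ?thesis by simp
    qed
    have gb: "0 \<le> g s \<and> g s \<le> s \<and> g s \<le> 2 * ln (1 / B)" if "s \<ge> 0" for s
    proof -
      have p: "1 + s > 0" "1 + B * s > 0" "1 - B > 0" using that B by (auto intro: add_pos_nonneg)
      have mono: "g 0 \<le> g s" by (rule DERIV_nonneg_imp_nondecreasing[OF that]) (use dg bp in \<open>auto intro: less_imp_le\<close>)
      have "g s - s \<le> g 0 - 0"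
      proof (rule DERIV_nonpos_imp_nonincreasing[OF that, of "\<lambda>s. g s - s"])
        fix x assume "0 \<le> x" "x \<le> s"
        then have "((\<lambda>s. g s - s) has_real_derivative b x - 1) (at x)" by (intro DERIV_diff dg DERIV_ident)
        then show "\<exists>y. ((\<lambda>s. g s - s) has_real_derivative y) (at x) \<and> y \<le> 0" using b1[of x] by auto
      qed
      moreover have "g 0 = 0" by (simp add: g_def)
      moreover have "g s \<le> 2 * ln (1 / B)"
      proof -
        have "B * (1 + s) \<le> 1 + B * s" using B by (simp add: algebra_simps)
        then have "(1 + s) / (1 + B * s) \<le> 1 / B" using p B by (simp add: field_simps)
        then have "ln ((1 + s) / (1 + B * s)) \<le> ln (1 / B)" using p B by (intro ln_mono) auto
        then have "ln (1 + s) - ln (1 + B * s) \<le> ln (1 / B)" using p by (simp add: ln_div)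
        then have "g s \<le> ln (1 / B) / (1 - B)" using p unfolding g_def by (intro divide_right_mono) auto
        also have "\<dots> \<le> ln (1 / B) / (1 / 2)" using B by (intro divide_left_mono) (auto intro!: ln_ge_zero)
        finally show ?thesis by simp
      qed
      ultimately show ?thesis using mono by auto
    qed
    have eq: "\<beta> s = g s" if "s \<ge> 0" for s
    proof (cases "s = 0")
      case False
      then have "0 < s" using that by simp
      have "\<exists>z. z > 0 \<and> z < s \<and> (\<beta> s - g s) - (\<beta> 0 - g 0) = (s - 0) * (b z - b z)"
        by (rule MVT2[OF \<open>0 < s\<close>]) (intro DERIV_diff \<beta> dg)
      then have "(\<beta> s - g s) - (\<beta> 0 - g 0) = 0" by auto
      then show ?thesis by (simp add: \<beta>_def g_def)
    qed (simp add: \<beta>_def g_def)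
    have eq': "\<beta> (- s) = - g s" if "s \<ge> 0" for s
    proof (cases "s = 0")
      case False
      then have "0 < s" using that by simp
      have "((\<lambda>s. \<beta> (- s)) has_real_derivative b (- x) * - 1) (at x)" for x
        by (rule DERIV_chain2[OF \<beta>]) (auto intro!: derivative_eq_intros)
      then have "((\<lambda>s. \<beta> (- s)) has_real_derivative - b x) (at x)" for x by (simp add: b_def)
      then have "\<exists>z. z > 0 \<and> z < s \<and> (\<beta> (- s) + g s) - (\<beta> (- 0) + g 0) = (s - 0) * (- b z + b z)"
        by (intro MVT2[OF \<open>0 < s\<close>] DERIV_add dg)
      then have "(\<beta> (- s) + g s) - (\<beta> (- 0) + g 0) = 0" by auto
      then show ?thesis by (simp add: \<beta>_def g_def)
    qed (simp add: \<beta>_def g_def)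
    show ?thesis
    proof (cases "s \<ge> 0")
      case True then show ?thesis using eq[OF True] gb[OF True] by simp
    next
      case False
      then have "- s \<ge> 0" by simp
      from eq'[OF this] gb[OF this] show ?thesis by simp
    qed
  qed
  then have bnd: "\<bar>\<beta> s\<bar> \<le> \<bar>s\<bar>" "\<bar>\<beta> s\<bar> \<le> 2 * ln (1 / B)" for s by auto
  have l1: "ln (1 / B) \<ge> 1"
  proof -
    have "exp 1 \<le> (8::real)" using exp_le by simp
    also have "8 \<le> 1 / B" using B by (simp add: field_simps)
    finally show ?thesis using B by (simp add: ln_ge_iff)
  qed
  have inv: "1 / b s = 1 + \<bar>s\<bar> + B * \<bar>s\<bar> + B * s^2" for s
    by (simp add: b_def algebra_simps power2_eq_square abs_mult_self_eq)
  have A1: "(\<beta> s)^2 / b s \<le> 8 * (ln (1/B))^2 * (\<bar>s\<bar> + B * s^2)" for s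
  proof -
    have eq: "(\<beta> s)^2 / b s = (\<beta> s)^2 * (1 / b s)" by simp
    have Bs: "B * \<bar>s\<bar> \<le> \<bar>s\<bar>" using B by (simp add: mult_left_le_one_le)
    have l2: "1 \<le> (ln (1/B))^2" using l1 by (simp add: one_le_power)
    have nn: "0 \<le> \<bar>s\<bar> + B * s^2" using B by simp
    show ?thesis
    proof (cases "\<bar>s\<bar> \<le> 1")
      case True
      have "(\<beta> s)^2 \<le> \<bar>s\<bar>^2" using bnd(1)[of s] by (metis abs_ge_zero power2_abs power_mono)
      also have "\<dots> \<le> \<bar>s\<bar>" using True by (simp add: power2_eq_square mult_left_le_one_le del: abs_mult_self_eq)
      finally have 1: "(\<beta> s)^2 \<le> \<bar>s\<bar>" .
      have "s^2 \<le> 1" using True by (simp add: abs_square_le_1)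
      then have "B * s^2 \<le> 1" using B mult_mono[of B 1 "s^2" 1] by simp
      then have 2: "1 / b s \<le> 4" unfolding inv using True Bs by linarith
      have "(\<beta> s)^2 * (1 / b s) \<le> \<bar>s\<bar> * 4" by (rule mult_mono[OF 1 2]) (use bp[of s] in auto)
      also have "\<dots> \<le> 8 * 1 * (\<bar>s\<bar> + B * s^2)" using B by simp
      also have "\<dots> \<le> 8 * (ln (1/B))^2 * (\<bar>s\<bar> + B * s^2)" using l2 nn by (intro mult_right_mono) auto
      finally show ?thesis unfolding eq .
    next
      case False
      have 1: "(\<beta> s)^2 \<le> (2 * ln (1 / B))^2" using bnd(2)[of s] by (metis abs_ge_zero power2_abs power_mono)
      have "B * \<bar>s\<bar> \<le> B * s^2"
      proof -
        have "\<bar>s\<bar> * 1 \<le> \<bar>s\<bar> * \<bar>s\<bar>" using False by (intro mult_left_mono) auto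
        then have "\<bar>s\<bar> \<le> s^2" by (simp add: power2_eq_square)
        then show ?thesis using B by simp
      qed
      then have 2: "1 / b s \<le> 2 * (\<bar>s\<bar> + B * s^2)" unfolding inv
      proof -
        assume "B * \<bar>s\<bar> \<le> B * s\<^sup>2"
        moreover have "1 + a + p + q \<le> 2 * (a + q)" if "1 \<le> a" "p \<le> q" for a p q :: real using that by simp
        ultimately show "1 + \<bar>s\<bar> + B * \<bar>s\<bar> + B * s\<^sup>2 \<le> 2 * (\<bar>s\<bar> + B * s\<^sup>2)" using False by simp
      qed
      have "(\<beta> s)^2 * (1 / b s) \<le> (2 * ln (1 / B))^2 * (2 * (\<bar>s\<bar> + B * s^2))"
        by (rule mult_mono[OF 1 2]) (use bp[of s] in auto)
      then show ?thesis unfolding eq by (simp add: power_mult_distrib algebra_simps)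
    qed
  qed
  have A2: "b s * s^2 \<le> \<bar>s\<bar>" for s
  proof -
    have "\<bar>s\<bar> * \<bar>s\<bar> \<le> \<bar>s\<bar> * (1 / b s)" unfolding inv using B by (intro mult_left_mono) auto
    then have "s^2 * b s \<le> \<bar>s\<bar> * (1 / b s) * b s" using bp[of s] by (intro mult_right_mono) (auto simp: power2_eq_square)
    then show ?thesis using bp[of s] by (simp add: mult.commute)
  qed
  have A3: "1 / b s \<le> 2 * (1 + \<bar>s\<bar> + B * s^2)" for s
  proof -
    have "B * \<bar>s\<bar> \<le> \<bar>s\<bar>" using B by (simp add: mult_left_le_one_le)
    moreover have "0 \<le> B * s^2" using B by simp
    ultimately show ?thesis unfolding inv by (simp add: algebra_simps)
  qed
  show ?thesis using \<beta> bc[of UNIV] bp A1 A2 A3 by (intro exI[of _ \<beta>] exI[of _ b]) auto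
qed

context monotone_system_dir
begin

text \<open>By the arithmetic-geometric inequality,
  \<open>|W| = \<phi>\<^sup>2 |\<partial>\<^sub>l\<sigma>| \<le> (a / 2) \<beta>' \<mu> \<phi>\<^sup>2 |\<nabla>\<sigma>|\<^sup>2 + \<phi>\<^sup>2 / (2 a \<mu> \<beta>')\<close>, with \<open>\<beta>'\<close> taken at
  \<open>t = \<mu> \<sigma>\<close>. The properties of \<open>\<beta>\<close>, the inequality \<open>|\<phi>| \<le> C \<mu>\<close> and the slow variation of \<open>\<mu>\<close> reduce
  the last term and the right-hand side of \<open>caccioppoli\<close> to multiples of \<open>|\<phi>|\<close> and of
  \<open>(\<phi>\<^sup>2 / \<mu>) (|t| + B t\<^sup>2) = |\<phi> \<psi>| + B \<mu> \<psi>\<^sup>2\<close>. Both have integrals of order \<open>R\<^sup>2\<close>. The energy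
  term is therefore of order \<open>a (ln R)\<^sup>2\<close> and the other one of order \<open>R\<^sup>2 / a\<close>.\<close>

lemma flux_bound:
  "\<exists>C\<ge>0. \<forall>R\<ge>2. \<forall>L\<ge>R. (\<Sum>i\<in>UNIV. \<integral>x. eta (tall N R L) x * \<bar>W i l x\<bar> \<partial>lborel) \<le> C * R * ln R"
proof -
  obtain C where C: "C \<ge> 1" and av: "\<And>R L. R \<ge> 1 \<Longrightarrow> L \<ge> R \<Longrightarrow> \<exists>\<mu> \<mu>'. has_grad \<mu> \<mu>' \<and> (\<forall>x. 0 < \<mu> x) \<and> (\<forall>k x. \<bar>\<mu>' k x\<bar> \<le> \<mu> x / R)
     \<and> (\<forall>x. (\<forall>j. \<bar>x $ j\<bar> \<le> 4 * tall N R L j) \<longrightarrow> \<Phi> x \<le> C * \<mu> x)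
     \<and> (\<integral>x. eta (tall N (2 * R) (2 * L)) x * \<mu> x \<partial>lborel) \<le> C * R^5"
    using slowly_varying_majorant by blast
  define m where "m = real CARD('a)"
  define C7 where "C7 = 8192 * G * bumpK * U + 32 * C * G^2"
  define C8 where "C8 = (1728 * bumpK^2 + 24) * C7"
  define C9 where "C9 = C7 + C * (512 * bumpK * U)"
  define C' where "C' = m * (C8 / 2 + C9)"
  have nn: "C7 \<ge> 0" "C8 \<ge> 0" "C9 \<ge> 0" "C' \<ge> 0"
    using G_nonneg U_nonneg bumpK(1) C by (auto simp: C7_def C8_def C9_def C'_def m_def)
  have "(\<Sum>i\<in>UNIV. \<integral>x. eta (tall N R L) x * \<bar>W i l x\<bar> \<partial>lborel) \<le> C' * R * ln R"
    if R: "R \<ge> 2" and L: "L \<ge> R" for R L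
  proof -
    \<comment> \<open>The integral of \<open>\<mu>\<close> is of order \<open>R\<^sup>5\<close>, so this \<open>B\<close> reduces it to the order \<open>R\<^sup>2\<close> of the mass of \<open>\<phi>\<close>.\<close>
    define B where "B = 1 / R^3"
    have R3: "R^3 \<ge> 8" using power_mono[of 2 R 3] R by simp
    have B: "0 < B" "B \<le> 1/8" using R R3 by (auto simp: B_def field_simps)
    have lnR: "ln R \<ge> 1 / 2" by (rule ln_ge_half[OF R])
    have lnB: "ln (1 / B) = 3 * ln R" using R by (simp add: B_def ln_realpow)
    obtain \<beta> \<beta>' where \<beta>: "\<And>s. (\<beta> has_real_derivative \<beta>' s) (at s)" "continuous_on UNIV \<beta>'" "\<And>s. \<beta>' s > 0"
      and b1: "\<And>s. (\<beta> s)^2 / \<beta>' s \<le> 8 * (ln (1/B))^2 * (\<bar>s\<bar> + B * s^2)"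
      and b2: "\<And>s. \<beta>' s * s^2 \<le> \<bar>s\<bar>" and b3: "\<And>s. 1 / \<beta>' s \<le> 2 * (1 + \<bar>s\<bar> + B * s^2)"
      using logarithmic_nonlinearity[OF B] by blast
    obtain \<mu> \<mu>' where \<mu>: "has_grad \<mu> \<mu>'" "\<And>x. 0 < \<mu> x" and m1: "\<And>k x. \<bar>\<mu>' k x\<bar> \<le> \<mu> x / (2 * R)"
      and m2: "\<And>x. (\<And>j. \<bar>x $ j\<bar> \<le> 4 * tall N (2 * R) (2 * L) j) \<Longrightarrow> \<Phi> x \<le> C * \<mu> x"
      and m3: "(\<integral>x. eta (tall N (2 * (2 * R)) (2 * (2 * L))) x * \<mu> x \<partial>lborel) \<le> C * (2 * R)^5"
      using av[of "2 * R" "2 * L"] R L by auto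
    let ?\<eta> = "eta (tall N R L)" and ?\<xi> = "eta (tall N (2 * R) (2 * L))" and ?\<theta> = "eta (tall N (4 * R) (4 * L))"
    let ?\<xi>' = "eta' (tall N (2 * R) (2 * L))"
    have ccs: "cc ?\<eta>" "cc ?\<xi>" "cc ?\<theta>" by (rule cc_eta; use R L in \<open>auto simp: tall_def\<close>)+
    have cc': "cc (?\<xi>' k)" for k by (rule cc_eta; use R L in \<open>auto simp: tall_def\<close>)
    have m3': "(\<integral>x. ?\<theta> x * \<mu> x \<partial>lborel) \<le> 32 * C * R^5" using m3 by (simp add: power_mult_distrib)
    have cm: "continuous_on S \<mu>" "continuous_on S (\<mu>' k)" for S k
      by (rule has_grad_continuous[OF \<mu>(1)] has_grad_cont_grad[OF \<mu>(1)])+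
    have ne: "\<mu> x \<noteq> 0" "\<beta>' s \<noteq> 0" for x s using \<mu>(2)[of x] \<beta>(3)[of s] by auto
    let ?t = "\<lambda>i x. \<mu> x * \<sigma> i x"
    have ct: "continuous_on UNIV (?t i)" for i by (intro continuous_intros cm cont_\<sigma>)
    have contb: "continuous_on UNIV \<beta>" using \<beta>(1) by (meson DERIV_isCont continuous_at_imp_continuous_on)
    have cb: "continuous_on UNIV (\<lambda>x. \<beta> (?t i x))" "continuous_on UNIV (\<lambda>x. \<beta>' (?t i x))" for i
      by (rule continuous_on_compose2[OF contb ct] continuous_on_compose2[OF \<beta>(2) ct]; simp)+
    define Z where "Z i x = G * \<bar>\<phi> i x\<bar> + B * G^2 * \<mu> x" for i x
    have Z0: "Z i x \<ge> 0" for i x unfolding Z_def using G_nonneg B \<mu>(2)[of x] by (intro add_nonneg_nonneg mult_nonneg_nonneg) auto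
    have cZ: "continuous_on S (Z i)" for S i unfolding Z_def by (intro continuous_intros cont_P cm)
    have tau: "(\<phi> i x)^2 / \<mu> x * \<bar>?t i x\<bar> = \<bar>\<phi> i x\<bar> * \<bar>\<psi> i x\<bar>" "(\<phi> i x)^2 / \<mu> x * (?t i x)^2 = \<mu> x * (\<psi> i x)^2" for i x
      using \<mu>(2)[of x] by (auto simp: \<psi>_eq abs_mult power2_eq_square field_simps)
    have tauZ: "(\<phi> i x)^2 / \<mu> x * (\<bar>?t i x\<bar> + B * (?t i x)^2) \<le> Z i x" for i x
    proof -
      have "(\<phi> i x)^2 / \<mu> x * (\<bar>?t i x\<bar> + B * (?t i x)^2) = \<bar>\<phi> i x\<bar> * \<bar>\<psi> i x\<bar> + B * ((\<phi> i x)^2 / \<mu> x * (?t i x)^2)"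
        using tau(1)[of i x] by (simp add: distrib_left mult.left_commute)
      also have "\<dots> = \<bar>\<phi> i x\<bar> * \<bar>\<psi> i x\<bar> + B * (\<mu> x * (\<psi> i x)^2)" unfolding tau(2) ..
      also have "\<dots> \<le> \<bar>\<phi> i x\<bar> * G + B * (\<mu> x * G^2)"
        by (intro add_mono mult_left_mono P_bound psi_square_bound) (use B \<mu>(2)[of x] in \<open>auto intro: less_imp_le\<close>)
      finally show ?thesis by (simp add: Z_def mult_ac)
    qed
    have p0: "(\<phi> i x)^2 / \<mu> x \<ge> 0" for i x using \<mu>(2)[of x] by simp
    have RBR: "B * R^5 = R^2" using R by (simp add: B_def field_simps eval_nat_numeral)
    have Z\<theta>: "(\<integral>x. ?\<theta> x * Z i x \<partial>lborel) \<le> C7 * R^2" for i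
    proof -
      have "(\<integral>x. ?\<theta> x * Z i x \<partial>lborel) = (\<integral>x. G * (?\<theta> x * \<bar>\<phi> i x\<bar>) + B * G^2 * (?\<theta> x * \<mu> x) \<partial>lborel)"
        by (simp add: Z_def algebra_simps)
      also have "\<dots> = G * (\<integral>x. ?\<theta> x * \<bar>\<phi> i x\<bar> \<partial>lborel) + B * G^2 * (\<integral>x. ?\<theta> x * \<mu> x \<partial>lborel)"
        by (subst integral_cc_add) (auto intro!: cc_cmult cc_mult_right ccs cm continuous_intros cont_P)
      also have "\<dots> \<le> G * (512 * bumpK * U * (4 * R)^2) + B * G^2 * (32 * C * R^5)"
        by (intro add_mono mult_left_mono mass_bound m3') (use R L B G_nonneg in auto)
      also have "\<dots> = 8192 * G * bumpK * U * R^2 + 32 * C * G^2 * (B * R^5)" by (simp add: power2_eq_square algebra_simps)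
      also have "\<dots> = C7 * R^2" unfolding RBR C7_def by (simp add: algebra_simps)
      finally show ?thesis .
    qed
    define A where "A = (1728 * bumpK^2 + 24) * (ln R)^2 / R^2"
    have A0: "A \<ge> 0" by (simp add: A_def)
    let ?L = "\<lambda>i x. (?\<xi> x)^2 * \<beta>' (?t i x) * \<mu> x * (\<phi> i x)^2 * (\<Sum>k\<in>UNIV. (\<sigma>' i k x)^2)"
    let ?Rr = "\<lambda>i x. (\<phi> i x)^2 / \<mu> x * (8 * (\<beta> (?t i x))^2 / \<beta>' (?t i x) * (\<Sum>k\<in>UNIV. (?\<xi>' k x)^2)
        + 2 * (?\<xi> x)^2 * \<beta>' (?t i x) * (?t i x)^2 * (\<Sum>k\<in>UNIV. (\<mu>' k x / \<mu> x)^2))"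
    have s1: "(\<Sum>k\<in>UNIV. (?\<xi>' k x)^2) \<le> 3 * (bumpK^2 / R^2 * ?\<theta> x)" for x
    proof -
      have "(?\<xi>' k x)^2 \<le> bumpK^2 / R^2 * ?\<theta> x" for k
      proof -
        have "(?\<xi>' k x)^2 \<le> (bumpK / tall N (2 * R) (2 * L) k)^2 * ?\<theta> x"
          by (rule eta'_square_bound) (use R L in \<open>auto simp: tall_def\<close>)
        also have "\<dots> \<le> (bumpK / R)^2 * ?\<theta> x"
          by (intro mult_right_mono eta_range power_mono divide_left_mono) (use R L bumpK(1) in \<open>auto simp: tall_def\<close>)
        finally show ?thesis by (simp add: power_divide)
      qed
      then have "(\<Sum>k\<in>UNIV. (?\<xi>' k x)^2) \<le> (\<Sum>k\<in>(UNIV::'b set). bumpK^2 / R^2 * ?\<theta> x)" by (intro sum_mono)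
      also have "\<dots> = real CARD('b) * (bumpK^2 / R^2 * ?\<theta> x)" by simp
      also have "\<dots> \<le> 3 * (bumpK^2 / R^2 * ?\<theta> x)" using dim eta_range by (intro mult_right_mono mult_nonneg_nonneg) auto
      finally show ?thesis .
    qed
    have s2: "(\<Sum>k\<in>UNIV. (\<mu>' k x / \<mu> x)^2) \<le> 3 * (1 / R^2)" for x
    proof -
      have "(\<mu>' k x / \<mu> x)^2 \<le> 1 / R^2" for k
      proof -
        have "\<bar>\<mu>' k x\<bar> \<le> \<mu> x / R" using m1[of k x] \<mu>(2)[of x] R by (simp add: field_simps)
        then have "\<bar>\<mu>' k x / \<mu> x\<bar> \<le> 1 / R" using \<mu>(2)[of x] R by (simp add: abs_divide field_simps)
        then have "\<bar>\<mu>' k x / \<mu> x\<bar>^2 \<le> (1 / R)^2" by (rule power_mono) simp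
        then show ?thesis by (simp add: power_divide)
      qed
      then have "(\<Sum>k\<in>UNIV. (\<mu>' k x / \<mu> x)^2) \<le> (\<Sum>k\<in>(UNIV::'b set). 1 / R^2)" by (intro sum_mono)
      also have "\<dots> = real CARD('b) * (1 / R^2)" by simp
      also have "\<dots> \<le> 3 * (1 / R^2)" using dim by (intro mult_right_mono) auto
      finally show ?thesis .
    qed
    have xt: "(?\<xi> x)^2 \<le> ?\<theta> x" for x
    proof -
      have "(?\<xi> x)^2 \<le> ?\<xi> x" using eta_range[of _ x] by (simp add: power2_eq_square mult_left_le_one_le)
      also have "\<dots> \<le> ?\<theta> x" by (rule eta_mono) (use R L in \<open>auto simp: tall_def\<close>)
      finally show ?thesis .
    qed
    have Rb: "?Rr i x \<le> A * (?\<theta> x * Z i x)" for i x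
    proof -
      let ?T = "\<bar>?t i x\<bar> + B * (?t i x)^2"
      have T0: "?T \<ge> 0" "\<bar>?t i x\<bar> \<le> ?T" using B by auto
      have h1: "8 * (\<beta> (?t i x))^2 / \<beta>' (?t i x) * (\<Sum>k\<in>UNIV. (?\<xi>' k x)^2) \<le> (8 * (8 * (3 * ln R)^2 * ?T)) * (3 * (bumpK^2 / R^2 * ?\<theta> x))"
      proof (rule mult_mono[OF _ s1])
        show "8 * (\<beta> (?t i x))^2 / \<beta>' (?t i x) \<le> 8 * (8 * (3 * ln R)^2 * ?T)" using b1[of "?t i x"] unfolding lnB by simp
        show "0 \<le> 8 * (8 * (3 * ln R)^2 * ?T)" using T0(1) by simp
      qed (rule sum_nonneg, simp)
      have h2: "2 * (?\<xi> x)^2 * \<beta>' (?t i x) * (?t i x)^2 * (\<Sum>k\<in>UNIV. (\<mu>' k x / \<mu> x)^2) \<le> (2 * ?\<theta> x * ?T) * (3 * (1 / R^2))"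
      proof (rule mult_mono[OF _ s2])
        have "(?\<xi> x)^2 * (\<beta>' (?t i x) * (?t i x)^2) \<le> ?\<theta> x * ?T"
          by (rule mult_mono[OF xt]) (use b2[of "?t i x"] T0(2) eta_range less_imp_le[OF \<beta>(3)] in \<open>auto intro!: mult_nonneg_nonneg\<close>)
        then show "2 * (?\<xi> x)^2 * \<beta>' (?t i x) * (?t i x)^2 \<le> 2 * ?\<theta> x * ?T" by (simp add: mult.assoc)
        show "0 \<le> 2 * ?\<theta> x * ?T" by (intro mult_nonneg_nonneg T0(1) eta_range) simp
      qed (rule sum_nonneg, simp)
      have l4: "6 \<le> 24 * (ln R)^2"
      proof -
        have "(1/2)^2 \<le> (ln R)^2" by (rule power_mono[OF lnR]) simp
        then show ?thesis by (simp add: power_divide)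
      qed
      have "8 * (\<beta> (?t i x))^2 / \<beta>' (?t i x) * (\<Sum>k\<in>UNIV. (?\<xi>' k x)^2) + 2 * (?\<xi> x)^2 * \<beta>' (?t i x) * (?t i x)^2 * (\<Sum>k\<in>UNIV. (\<mu>' k x / \<mu> x)^2)
          \<le> (1728 * bumpK^2 * (ln R)^2 + 6) * (?\<theta> x * ?T / R^2)"
        using h1 h2 by (simp add: power_mult_distrib algebra_simps add_divide_distrib)
      also have "\<dots> \<le> ((1728 * bumpK^2 + 24) * (ln R)^2) * (?\<theta> x * ?T / R^2)"
        proof (rule mult_right_mono)
        show "1728 * bumpK^2 * (ln R)^2 + 6 \<le> (1728 * bumpK^2 + 24) * (ln R)^2" using l4 by (simp add: distrib_right)
        show "0 \<le> ?\<theta> x * ?T / R^2" by (intro divide_nonneg_nonneg mult_nonneg_nonneg T0(1) eta_range) simp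
      qed
      also have "\<dots> = A * (?\<theta> x * ?T)" by (simp add: A_def)
      finally have "?Rr i x \<le> (\<phi> i x)^2 / \<mu> x * (A * (?\<theta> x * ?T))" by (intro mult_left_mono p0)
      also have "\<dots> = A * ?\<theta> x * ((\<phi> i x)^2 / \<mu> x * ?T)" by (simp add: mult_ac)
      also have "\<dots> \<le> A * ?\<theta> x * Z i x" by (intro mult_left_mono tauZ mult_nonneg_nonneg A0 eta_range)
      finally show ?thesis by (simp add: mult.assoc)
    qed
    have ccR: "cc (?Rr i)" for i
      unfolding power2_eq_square
      by (intro cc_mult_left cc_add cc_sum cc_mult_right ccs cc' cc_cont[OF ccs(2)] cc_cont[OF cc'] continuous_intros cb cm cont_P cont_\<sigma>) (auto simp: ne)
    have ccL: "cc (?L i)" for i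
      unfolding power2_eq_square
      by (intro cc_mult_right cc_mult_left ccs cc_cont[OF ccs(2)] continuous_intros cb cm cont_P cont_\<sigma>')
    have "(\<Sum>i\<in>UNIV. \<integral>x. ?L i x \<partial>lborel) \<le> (\<Sum>i\<in>UNIV. \<integral>x. ?Rr i x \<partial>lborel)"
      by (rule caccioppoli[OF has_grad_eta eta_support \<mu> \<beta>]) (use R L in \<open>auto simp: tall_def\<close>)
    also have "\<dots> \<le> (\<Sum>i\<in>(UNIV::'a set). A * (C7 * R^2))"
    proof (rule sum_mono)
      fix i
      have "(\<integral>x. ?Rr i x \<partial>lborel) \<le> (\<integral>x. A * (?\<theta> x * Z i x) \<partial>lborel)"
        by (rule cc_mono[OF ccR _ Rb]) (intro cc_cmult cc_mult_right ccs cZ)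
      also have "\<dots> = A * (\<integral>x. ?\<theta> x * Z i x \<partial>lborel)" by simp
      also have "\<dots> \<le> A * (C7 * R^2)" by (rule mult_left_mono[OF Z\<theta> A0])
      finally show "(\<integral>x. ?Rr i x \<partial>lborel) \<le> A * (C7 * R^2)" .
    qed
    also have "\<dots> = m * (C8 * (ln R)^2)" using R by (simp add: m_def A_def C8_def)
    finally have K: "(\<Sum>i\<in>UNIV. \<integral>x. ?L i x \<partial>lborel) \<le> m * (C8 * (ln R)^2)" .
    \<comment> \<open>This value balances the two terms \<open>a (ln R)\<^sup>2\<close> and \<open>R\<^sup>2 / a\<close>.\<close>
    define a where "a = R / ln R"
    have a: "a > 0" using R lnR by (simp add: a_def)
    let ?Y = "\<lambda>i x. ?\<theta> x * Z i x + ?\<eta> x * (C * \<bar>\<phi> i x\<bar>)"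
    have ccY: "cc (?Y i)" for i by (intro cc_add cc_mult_right ccs cZ continuous_intros cont_P)
    have W: "?\<eta> x * \<bar>W i l x\<bar> \<le> a / 2 * ?L i x + 1 / a * ?Y i x" for i x
    proof (cases "?\<eta> x = 0")
      case True
      have "0 \<le> ?L i x" using \<mu>(2)[of x] less_imp_le[OF \<beta>(3)] by (intro mult_nonneg_nonneg sum_nonneg) auto
      moreover have "0 \<le> ?Y i x" using C Z0 eta_range by (intro add_nonneg_nonneg mult_nonneg_nonneg) auto
      ultimately show ?thesis unfolding True using a by (simp add: add_nonneg_nonneg)
    next
      case False
      have xb: "\<bar>x $ j\<bar> \<le> 2 * tall N R L j" for j
      proof (rule ccontr)
        assume "\<not> \<bar>x $ j\<bar> \<le> 2 * tall N R L j"
        then have "?\<eta> x = 0" by (intro eta_zero[of _ j]) (use R L in \<open>auto simp: tall_def\<close>)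
        then show False using False by simp
      qed
      have x1: "?\<xi> x = 1"
      proof (rule eta_one)
        fix j show "\<bar>x $ j\<bar> \<le> tall N (2 * R) (2 * L) j" using xb[of j] by (auto simp: tall_def split: if_splits)
      qed (use R L in \<open>auto simp: tall_def\<close>)
      have t1: "?\<theta> x = 1"
      proof (rule eta_one)
        fix j show "\<bar>x $ j\<bar> \<le> tall N (4 * R) (4 * L) j" using xb[of j] R L by (auto simp: tall_def split: if_splits)
      qed (use R L in \<open>auto simp: tall_def\<close>)
      have "\<Phi> x \<le> C * \<mu> x"
      proof (rule m2)
        fix j show "\<bar>x $ j\<bar> \<le> 4 * tall N (2 * R) (2 * L) j" using xb[of j] R L by (auto simp: tall_def split: if_splits)
      qed
      then have pm: "\<bar>\<phi> i x\<bar> \<le> C * \<mu> x" using \<phi>_le_\<Phi>[of i x] by linarith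
      have pm2: "(\<phi> i x)^2 / \<mu> x \<le> C * \<bar>\<phi> i x\<bar>"
      proof -
        have "\<bar>\<phi> i x\<bar> * \<bar>\<phi> i x\<bar> \<le> C * \<mu> x * \<bar>\<phi> i x\<bar>" by (rule mult_right_mono[OF pm]) simp
        then show ?thesis using \<mu>(2)[of x] by (simp add: divide_le_eq power2_eq_square mult_ac)
      qed
      let ?b = "\<beta>' (?t i x)"
      have w: "\<bar>\<sigma>' i l x\<bar> \<le> (a * (?b * \<mu> x)) / 2 * (\<sigma>' i l x)^2 + 1 / (2 * (a * (?b * \<mu> x)))"
      proof -
        define e where "e = a * (?b * \<mu> x)"
        have e: "e > 0" using a \<beta>(3)[of "?t i x"] \<mu>(2)[of x] by (simp add: e_def)
        have "0 \<le> (e * \<bar>\<sigma>' i l x\<bar> - 1)^2 / (2 * e)" using e by simp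
        also have "\<dots> = e / 2 * (\<sigma>' i l x)^2 + 1 / (2 * e) - \<bar>\<sigma>' i l x\<bar>"
          using e by (simp add: power2_eq_square field_simps)
        finally show ?thesis unfolding e_def by simp
      qed
      have "\<bar>W i l x\<bar> = (\<phi> i x)^2 * \<bar>\<sigma>' i l x\<bar>" unfolding W_eq by (simp add: abs_mult)
      also have "\<dots> \<le> (\<phi> i x)^2 * ((a * (?b * \<mu> x)) / 2 * (\<sigma>' i l x)^2 + 1 / (2 * (a * (?b * \<mu> x))))"
        by (rule mult_left_mono[OF w]) simp
      also have "\<dots> = a / 2 * (?b * \<mu> x * (\<phi> i x)^2 * (\<sigma>' i l x)^2) + 1 / (2 * a) * ((\<phi> i x)^2 / \<mu> x * (1 / ?b))"
        using a ne(1)[of x] ne(2)[of "?t i x"] by (simp add: field_simps)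
      also have "\<dots> \<le> a / 2 * (?b * \<mu> x * (\<phi> i x)^2 * (\<Sum>k\<in>UNIV. (\<sigma>' i k x)^2)) + 1 / (2 * a) * (2 * (Z i x + C * \<bar>\<phi> i x\<bar>))"
      proof (intro add_mono mult_left_mono)
        show "(\<sigma>' i l x)^2 \<le> (\<Sum>k\<in>UNIV. (\<sigma>' i k x)^2)" by (rule member_le_sum) auto
        show "0 \<le> ?b * \<mu> x * (\<phi> i x)^2" using \<beta>(3)[of "?t i x"] \<mu>(2)[of x] by simp
        have "(\<phi> i x)^2 / \<mu> x * (1 / ?b) \<le> (\<phi> i x)^2 / \<mu> x * (2 * (1 + \<bar>?t i x\<bar> + B * (?t i x)^2))"
          by (intro mult_left_mono b3 p0)
        also have "\<dots> = 2 * ((\<phi> i x)^2 / \<mu> x + (\<phi> i x)^2 / \<mu> x * (\<bar>?t i x\<bar> + B * (?t i x)^2))"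
          by (simp add: algebra_simps)
        also have "\<dots> \<le> 2 * (C * \<bar>\<phi> i x\<bar> + Z i x)" by (intro mult_left_mono add_mono pm2 tauZ) simp
        finally show "(\<phi> i x)^2 / \<mu> x * (1 / ?b) \<le> 2 * (Z i x + C * \<bar>\<phi> i x\<bar>)" by simp
      qed (use a in auto)
      finally have Wb: "\<bar>W i l x\<bar> \<le> a / 2 * (?b * \<mu> x * (\<phi> i x)^2 * (\<Sum>k\<in>UNIV. (\<sigma>' i k x)^2)) + 1 / (2 * a) * (2 * (Z i x + C * \<bar>\<phi> i x\<bar>))" .
      have X0: "0 \<le> ?b * \<mu> x * (\<phi> i x)^2 * (\<Sum>k\<in>UNIV. (\<sigma>' i k x)^2)"
        using \<beta>(3)[of "?t i x"] \<mu>(2)[of x] by (intro mult_nonneg_nonneg sum_nonneg) auto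
      have e1: "?\<eta> x * (a / 2 * (?b * \<mu> x * (\<phi> i x)^2 * (\<Sum>k\<in>UNIV. (\<sigma>' i k x)^2))) \<le> a / 2 * ?L i x"
        unfolding x1 using X0 a eta_range[of "tall N R L" x] by (simp add: mult_left_le_one_le)
      have e2: "?\<eta> x * (1 / (2 * a) * (2 * (Z i x + C * \<bar>\<phi> i x\<bar>))) \<le> 1 / a * ?Y i x"
      proof -
        have "?\<eta> x * Z i x \<le> 1 * Z i x" by (intro mult_right_mono eta_range Z0)
        then have "?\<eta> x * (Z i x + C * \<bar>\<phi> i x\<bar>) \<le> ?Y i x" unfolding t1 by (simp add: distrib_left)
        then have "1 / a * (?\<eta> x * (Z i x + C * \<bar>\<phi> i x\<bar>)) \<le> 1 / a * ?Y i x" using a by (intro mult_left_mono) auto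
        moreover have "?\<eta> x * (1 / (2 * a) * (2 * q)) = 1 / a * (?\<eta> x * q)" for q by simp
        ultimately show ?thesis by (simp only:)
      qed
      have "?\<eta> x * \<bar>W i l x\<bar> \<le> ?\<eta> x * (a / 2 * (?b * \<mu> x * (\<phi> i x)^2 * (\<Sum>k\<in>UNIV. (\<sigma>' i k x)^2)) + 1 / (2 * a) * (2 * (Z i x + C * \<bar>\<phi> i x\<bar>)))"
        by (intro mult_left_mono Wb eta_range)
      then show ?thesis using e1 e2 by (simp only: distrib_left)
    qed
    have IY: "(\<integral>x. ?Y i x \<partial>lborel) \<le> C9 * R^2" for i
    proof -
      have "(\<integral>x. ?Y i x \<partial>lborel) = (\<integral>x. ?\<theta> x * Z i x \<partial>lborel) + (\<integral>x. C * (?\<eta> x * \<bar>\<phi> i x\<bar>) \<partial>lborel)"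
        by (subst integral_cc_add) (auto intro!: cc_cmult cc_mult_right ccs cZ continuous_intros cont_P simp: mult.left_commute)
      also have "\<dots> = (\<integral>x. ?\<theta> x * Z i x \<partial>lborel) + C * (\<integral>x. ?\<eta> x * \<bar>\<phi> i x\<bar> \<partial>lborel)" by simp
      also have "\<dots> \<le> C7 * R^2 + C * (512 * bumpK * U * R^2)"
        by (intro add_mono Z\<theta> mult_left_mono mass_bound) (use R L C in auto)
      finally show ?thesis unfolding C9_def by (simp add: algebra_simps)
    qed
    have "(\<Sum>i\<in>UNIV. \<integral>x. ?\<eta> x * \<bar>W i l x\<bar> \<partial>lborel)
        \<le> (\<Sum>i\<in>UNIV. a / 2 * (\<integral>x. ?L i x \<partial>lborel) + 1 / a * (C9 * R^2))"
    proof (rule sum_mono)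
      fix i
      have "(\<integral>x. ?\<eta> x * \<bar>W i l x\<bar> \<partial>lborel) \<le> (\<integral>x. a / 2 * ?L i x + 1 / a * ?Y i x \<partial>lborel)"
        by (rule cc_mono[OF _ _ W]) (intro cc_add cc_cmult cc_mult_right ccs ccL ccY continuous_intros cont_W)+
      also have "\<dots> = (\<integral>x. a / 2 * ?L i x \<partial>lborel) + (\<integral>x. 1 / a * ?Y i x \<partial>lborel)"
        by (rule integral_cc_add) (intro cc_cmult ccL ccY)+
      also have "\<dots> = a / 2 * (\<integral>x. ?L i x \<partial>lborel) + 1 / a * (\<integral>x. ?Y i x \<partial>lborel)"
        by (simp only: integral_mult_right_zero)
      also have "\<dots> \<le> a / 2 * (\<integral>x. ?L i x \<partial>lborel) + 1 / a * (C9 * R^2)"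
        by (intro add_left_mono mult_left_mono IY) (use a in auto)
      finally show "(\<integral>x. ?\<eta> x * \<bar>W i l x\<bar> \<partial>lborel) \<le> a / 2 * (\<integral>x. ?L i x \<partial>lborel) + 1 / a * (C9 * R^2)" .
    qed
    also have "\<dots> = a / 2 * (\<Sum>i\<in>UNIV. \<integral>x. ?L i x \<partial>lborel) + m * (1 / a * (C9 * R^2))"
      by (simp only: sum.distrib sum_distrib_left sum_constant m_def)
    also have "\<dots> \<le> a / 2 * (m * (C8 * (ln R)^2)) + m * (1 / a * (C9 * R^2))"
      by (intro add_right_mono mult_left_mono K) (use a in auto)
    also have "\<dots> = C' * R * ln R"
      using R lnR unfolding a_def C'_def by (simp add: power2_eq_square field_simps)
    finally show ?thesis .
  qed
  then show ?thesis using nn(4) by blast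
qed

end

section \<open>Growth of the square of a directional derivative\<close>

lemma bump_antiderivative:
  "\<exists>F. (\<forall>t. (F has_real_derivative bump t) (at t)) \<and> (\<forall>t. \<bar>F t\<bar> \<le> 2)
     \<and> (\<forall>t\<ge>2. F t = F 2) \<and> (\<forall>t\<le>-2. F t = F (-2))"
proof -
  obtain F0 where F0: "\<And>s. (F0 has_real_derivative bump s) (at s)"
  proof -
    have "\<exists>F. \<forall>x. - \<infinity> < ereal x \<longrightarrow> ereal x < \<infinity> \<longrightarrow> (F has_vector_derivative bump x) (at x)"
      by (rule einterval_antiderivative) (use bump_cont[of UNIV] in \<open>auto simp: continuous_on_eq_continuous_at\<close>)
    then show thesis using that by (auto simp: has_real_derivative_iff_has_vector_derivative)
  qed
  define F where "F s = F0 s - F0 0" for s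
  have F: "(F has_real_derivative bump s) (at s)" for s
    unfolding F_def by (auto intro!: derivative_eq_intros F0)
  have mv: "\<exists>z. a \<le> z \<and> z \<le> b \<and> F b - F a = (b - a) * bump z" if "a \<le> b" for a b
  proof (cases "a = b")
    case False
    then have "a < b" using that by simp
    from MVT2[OF this F] show ?thesis using less_imp_le by blast
  qed auto
  have up: "F t = F 2" if "t \<ge> 2" for t
    using mv[OF that] bump_zero(1) by force
  have dn: "F t = F (-2)" if "t \<le> -2" for t
    using mv[OF that] bump_zero(1) by force
  have small: "\<bar>F t\<bar> \<le> 2" if "\<bar>t\<bar> \<le> 2" for t
  proof -
    have "\<exists>z. \<bar>F t\<bar> = \<bar>t\<bar> * bump z"
    proof (cases "t \<ge> 0")
      case True
      from mv[OF this] obtain z where "F t - F 0 = (t - 0) * bump z" by blast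
      then show ?thesis using bump_range[of z] True by (intro exI[of _ z]) (simp add: F_def abs_mult)
    next
      case False
      then have "t \<le> 0" by simp
      from mv[OF this] obtain z where "F 0 - F t = (0 - t) * bump z" by blast
      then have "F t = t * bump z" by (simp add: F_def)
      then show ?thesis using bump_range[of z] by (intro exI[of _ z]) (simp add: abs_mult)
    qed
    then obtain z where "\<bar>F t\<bar> = \<bar>t\<bar> * bump z" by blast
    also have "\<dots> \<le> 2 * 1" using bump_range[of z] that by (intro mult_mono) auto
    finally show ?thesis by simp
  qed
  have "\<bar>F t\<bar> \<le> 2" for t
    using small[of t] small[of 2] small[of "-2"] up[of t] dn[of t] by (cases "t \<ge> 2"; cases "t \<le> -2") auto
  then show ?thesis using F up dn by blast
qed

lemma eta_tall_split: "eta (tall N R L) x = bump (x $ N / L) * (\<Prod>j\<in>UNIV-{N}. bump (x $ j / R))"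
proof -
  have "eta (tall N R L) x = bump (x $ N / tall N R L N) * (\<Prod>j\<in>UNIV-{N}. bump (x $ j / tall N R L j))"
    unfolding eta_def by (rule prod.remove) auto
  also have "(\<Prod>j\<in>UNIV-{N}. bump (x $ j / tall N R L j)) = (\<Prod>j\<in>UNIV-{N}. bump (x $ j / R))"
    by (rule prod.cong) (auto simp: tall_def)
  finally show ?thesis unfolding tall_def[of N R L N] by simp
qed

lemma bump_absorb: assumes "0 < a" "2 * a \<le> b" shows "bump (t / a) * bump (t / b) = bump (t / a)"
proof (cases "\<bar>t\<bar> \<le> b")
  case True
  then have "bump (t / b) = 1" using assms by (intro bump_one) (simp add: abs_divide)
  then show ?thesis by simp
next
  case False
  then have "bump (t / a) = 0" using assms by (intro bump_zero) (simp add: abs_divide le_divide_eq)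
  then show ?thesis by simp
qed

context monotone_system_dir
begin

text \<open>The test function \<open>f\<close> below has as \<open>N\<close>-derivative the cutoff of the cube minus \<open>R / L\<close> times the cutoff of the tall
  cylinder. Integration by parts in direction \<open>N\<close> thus bounds the integral of \<open>\<psi>\<^sup>2\<close> over the cube by
  the contribution of the tall cylinder, which \<open>tall_average\<close> controls, and the integral of
  \<open>2 f \<psi> \<partial>\<^sub>N\<psi>\<close>. As \<open>\<partial>\<^sub>N\<psi> = \<partial>\<^sub>l\<phi>\<close>, the identity \<open>2 \<psi> \<partial>\<^sub>l\<phi> = \<partial>\<^sub>l (\<phi> \<psi>) - W\<^sub>l\<close> and a second
  integration by parts, now in direction \<open>l\<close>, turn it into the flux and the mass of \<open>\<phi>\<close>.\<close>

lemma direction_energy: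
  "\<exists>C\<ge>0. \<forall>R\<ge>2. (\<Sum>i\<in>UNIV. \<integral>x. eta (\<lambda>_. R) x * (\<psi> i x)^2 \<partial>lborel) \<le> C * R^2 * ln R"
proof -
  obtain C1 where C1: "C1 \<ge> 0" and avg: "\<And>R. R \<ge> 1 \<Longrightarrow> \<exists>L\<ge>R. \<forall>i. (\<integral>x. eta (tall N R L) x * \<bar>\<psi> i x\<bar> \<partial>lborel) \<le> C1 * R * L"
    using tall_average by blast
  obtain C2 where C2: "C2 \<ge> 0" and flux: "\<And>R L. R \<ge> 2 \<Longrightarrow> L \<ge> R \<Longrightarrow> (\<Sum>i\<in>UNIV. \<integral>x. eta (tall N R L) x * \<bar>W i l x\<bar> \<partial>lborel) \<le> C2 * R * ln R"
    using flux_bound by blast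
  obtain A where A: "\<And>t. (A has_real_derivative bump t) (at t)" "\<And>t. \<bar>A t\<bar> \<le> 2"
    "\<And>t. t \<ge> 2 \<Longrightarrow> A t = A 2" "\<And>t. t \<le> -2 \<Longrightarrow> A t = A (-2)"
    using bump_antiderivative by blast
  define m where "m = real CARD('a)"
  define K where "K = G * C1 + 4 * bumpK * G * (2048 * bumpK * U)"
  have K: "K \<ge> 0" using G_nonneg C1 bumpK(1) U_nonneg by (simp add: K_def)
  define C where "C = 2 * m * K + 4 * C2"
  have "(\<Sum>i\<in>UNIV. \<integral>x. eta (\<lambda>_. R) x * (\<psi> i x)^2 \<partial>lborel) \<le> C * R^2 * ln R" if R: "R \<ge> 2" for R
  proof -
    obtain L where L: "L \<ge> R" and mass: "\<And>i. (\<integral>x. eta (tall N R L) x * \<bar>\<psi> i x\<bar> \<partial>lborel) \<le> C1 * R * L"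
      using avg[of R] R by auto
    have lnR: "ln R \<ge> 1 / 2" by (rule ln_ge_half[OF R])
    \<comment> \<open>The two antiderivatives are scaled so that they cancel beyond the height \<open>2 L\<close>.\<close>
    define \<theta> where "\<theta> s = R * (A (s / R) - A (s / L))" for s
    define \<theta>' where "\<theta>' s = bump (s / R) - R / L * bump (s / L)" for s
    have d\<theta>: "(\<theta> has_real_derivative \<theta>' s) (at s)" for s
    proof -
      have tall: "((\<lambda>s. A (s / r)) has_real_derivative bump (s / r) * (1 / r)) (at s)" if "r > 0" for r
        by (rule DERIV_chain2[OF A(1)]) (use that in \<open>auto intro!: derivative_eq_intros\<close>)
      have "(\<theta> has_real_derivative R * (bump (s / R) * (1 / R) - bump (s / L) * (1 / L))) (at s)"
        unfolding \<theta>_def by (intro DERIV_cmult DERIV_diff tall) (use R L in auto)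
      moreover have "R * (bump (s / R) * (1 / R) - bump (s / L) * (1 / L)) = \<theta>' s"
        using R L by (simp add: \<theta>'_def field_simps)
      ultimately show ?thesis by simp
    qed
    have c\<theta>': "continuous_on UNIV \<theta>'" unfolding \<theta>'_def
      by (intro continuous_intros continuous_on_compose2[OF bump_cont[of UNIV]]) (use R L in auto)
    have \<theta>b: "\<bar>\<theta> s\<bar> \<le> 4 * R" for s
    proof -
      have "\<bar>A (s / R) - A (s / L)\<bar> \<le> 4" using A(2)[of "s / R"] A(2)[of "s / L"] by linarith
      then have "R * \<bar>A (s / R) - A (s / L)\<bar> \<le> R * 4" using R by (intro mult_left_mono) auto
      then show ?thesis using R by (simp add: \<theta>_def abs_mult)
    qed
    have \<theta>0: "\<theta> s = 0" if "2 * L \<le> \<bar>s\<bar>" for s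
    proof (cases "s \<ge> 0")
      case True
      then have "2 \<le> s / R" "2 \<le> s / L" using that R L by (auto simp: le_divide_eq)
      then show ?thesis using A(3)[of "s / R"] A(3)[of "s / L"] by (simp add: \<theta>_def)
    next
      case False
      then have "s / R \<le> -2" "s / L \<le> -2" using that R L by (auto simp: divide_le_eq)
      then show ?thesis using A(4)[of "s / R"] A(4)[of "s / L"] by (simp add: \<theta>_def)
    qed
    let ?r = "tall N R (2 * L)" and ?s = "tall N (2 * R) (4 * L)"
    have rp: "?r j > 0" for j using R L by (auto simp: tall_def)
    define f where "f x = \<theta> (x $ N) * eta ?r x" for x :: "real^'b"
    define f' where "f' k x = (\<theta>' (x $ N) * (if k = N then 1 else 0)) * eta ?r x + \<theta> (x $ N) * eta' ?r k x" for k and x :: "real^'b"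
    have gf: "has_grad f f'"
    proof -
      have "has_grad (\<lambda>x::real^'b. \<theta> (x $ N)) (\<lambda>k x. \<theta>' (x $ N) * (if k = N then 1 else 0))"
        by (rule has_grad_compose'[OF has_grad_nth d\<theta> c\<theta>'])
      from has_grad_mult[OF this has_grad_eta[of ?r]] show ?thesis unfolding f_def f'_def .
    qed
    have bf: "bounded {x. f x \<noteq> 0}"
      by (rule bounded_subset[OF eta_support[of ?r]]) (auto simp: f_def rp)
    have ccf: "cc f" "cc (f' k)" for k using has_grad_cc[OF gf bf] by auto
    have fN: "f' N x = eta (tall N R R) x - R / L * eta (tall N R L) x" for x
    proof -
      have z: "\<theta> (x $ N) * eta' ?r N x = 0"
      proof (cases "\<bar>x $ N\<bar> \<le> ?r N")
        case True then show ?thesis using eta'_zero'[of ?r N x] rp by simp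
      next
        case False then show ?thesis using \<theta>0[of "x $ N"] by (simp add: tall_def)
      qed
      have "\<theta>' s * bump (s / (2 * L)) = \<theta>' s" for s
        using bump_absorb[of R "2 * L" s] bump_absorb[of L "2 * L" s] R L
        by (simp only: \<theta>'_def left_diff_distrib mult.assoc)
      then have "\<theta>' (x $ N) * eta ?r x = \<theta>' (x $ N) * (\<Prod>j\<in>UNIV-{N}. bump (x $ j / R))"
        unfolding eta_tall_split by (simp only: mult.assoc[symmetric])
      then show ?thesis using z by (simp add: f'_def \<theta>'_def eta_tall_split algebra_simps)
    qed
    have fl: "\<bar>f' l x\<bar> \<le> 4 * bumpK * eta ?s x" for x
    proof -
      have "\<bar>f' l x\<bar> = \<bar>\<theta> (x $ N)\<bar> * \<bar>eta' ?r l x\<bar>" using l_ne by (simp add: f'_def abs_mult)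
      also have "\<dots> \<le> (4 * R) * (bumpK / ?r l * eta ?s x)"
        by (intro mult_mono \<theta>b eta'_bound rp) (use R L in \<open>auto simp: tall_def\<close>)
      also have "\<dots> = 4 * bumpK * eta ?s x" using l_ne R by (simp add: tall_def)
      finally show ?thesis .
    qed
    have fb: "\<bar>f x\<bar> \<le> 4 * R * eta ?r x" for x
      unfolding f_def abs_mult using eta_range(1)[of ?r x] \<theta>b by (simp add: mult_right_mono)
    have cce: "cc (eta (tall N R R))" "cc (eta (tall N R L))" "cc (eta ?r)" "cc (eta ?s)"
      by (rule cc_eta; use R L in \<open>auto simp: tall_def\<close>)+
    have c2: "continuous_on S (\<lambda>x. (\<psi> i x)^2)" for S i by (intro continuous_intros cont_P)
    have main: "(\<integral>x. eta (\<lambda>_. R) x * (\<psi> i x)^2 \<partial>lborel)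
        \<le> K * R^2 + 4 * R * (\<integral>x. eta ?r x * \<bar>W i l x\<bar> \<partial>lborel)" for i
    proof -
      have g2: "has_grad (\<lambda>x. \<psi> i x * \<psi> i x) (\<lambda>k x. D i l k x * \<psi> i x + \<psi> i x * D i l k x)"
        by (intro has_grad_mult grad_P)
      have gp: "has_grad (\<lambda>x. \<phi> i x * \<psi> i x) (\<lambda>k x. D i N k x * \<psi> i x + \<phi> i x * D i l k x)"
        by (intro has_grad_mult grad_P)
      have id: "D i l N x * \<psi> i x + \<psi> i x * D i l N x = (D i N l x * \<psi> i x + \<phi> i x * D i l l x) - W i l x" for x
        by (simp add: W_def D_sym[of i N l])
      have cg: "cc (\<lambda>x. f x * (D i N l x * \<psi> i x + \<phi> i x * D i l l x))" "cc (\<lambda>x. f x * W i l x)"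
        by (intro cc_mult_right ccf continuous_intros cont_P cont_D cont_W)+
      have "(\<integral>x. f' N x * (\<psi> i x * \<psi> i x) \<partial>lborel) = - (\<integral>x. f x * (D i l N x * \<psi> i x + \<psi> i x * D i l N x) \<partial>lborel)"
        by (rule integral_by_parts[OF gf g2 bf])
      also have "(\<integral>x. f x * (D i l N x * \<psi> i x + \<psi> i x * D i l N x) \<partial>lborel)
          = (\<integral>x. f x * (D i N l x * \<psi> i x + \<phi> i x * D i l l x) \<partial>lborel) - (\<integral>x. f x * W i l x \<partial>lborel)"
        unfolding id right_diff_distrib by (rule integral_cc_diff[OF cg])
      also have "(\<integral>x. f x * (D i N l x * \<psi> i x + \<phi> i x * D i l l x) \<partial>lborel) = - (\<integral>x. f' l x * (\<phi> i x * \<psi> i x) \<partial>lborel)"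
        using integral_by_parts[OF gf gp bf, of l] by simp
      finally have 1: "(\<integral>x. f' N x * (\<psi> i x * \<psi> i x) \<partial>lborel)
          = (\<integral>x. f' l x * (\<phi> i x * \<psi> i x) \<partial>lborel) + (\<integral>x. f x * W i l x \<partial>lborel)" by simp
      have 2: "(\<integral>x. f' N x * (\<psi> i x * \<psi> i x) \<partial>lborel)
          = (\<integral>x. eta (tall N R R) x * (\<psi> i x)^2 \<partial>lborel) - R / L * (\<integral>x. eta (tall N R L) x * (\<psi> i x)^2 \<partial>lborel)"
      proof -
        have "(\<integral>x. f' N x * (\<psi> i x * \<psi> i x) \<partial>lborel)
           = (\<integral>x. eta (tall N R R) x * (\<psi> i x)^2 - R / L * (eta (tall N R L) x * (\<psi> i x)^2) \<partial>lborel)"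
          unfolding fN by (simp add: power2_eq_square algebra_simps)
        also have "\<dots> = (\<integral>x. eta (tall N R R) x * (\<psi> i x)^2 \<partial>lborel) - (\<integral>x. R / L * (eta (tall N R L) x * (\<psi> i x)^2) \<partial>lborel)"
          by (rule integral_cc_diff) (intro cc_cmult cc_mult_right cce c2)+
        finally show ?thesis by (simp only: integral_mult_right_zero)
      qed
      have 3: "(\<integral>x. eta (tall N R L) x * (\<psi> i x)^2 \<partial>lborel) \<le> G * (C1 * R * L)"
      proof -
        have "(\<integral>x. eta (tall N R L) x * (\<psi> i x)^2 \<partial>lborel) \<le> (\<integral>x. G * (eta (tall N R L) x * \<bar>\<psi> i x\<bar>) \<partial>lborel)"
        proof (rule cc_mono)
          fix x
          have "\<bar>\<psi> i x\<bar> * \<bar>\<psi> i x\<bar> \<le> G * \<bar>\<psi> i x\<bar>" by (rule mult_right_mono[OF P_bound]) simp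
          then have "(\<psi> i x)^2 \<le> G * \<bar>\<psi> i x\<bar>" by (simp add: power2_eq_square)
          then have "eta (tall N R L) x * (\<psi> i x)^2 \<le> eta (tall N R L) x * (G * \<bar>\<psi> i x\<bar>)" by (intro mult_left_mono eta_range)
          then show "eta (tall N R L) x * (\<psi> i x)^2 \<le> G * (eta (tall N R L) x * \<bar>\<psi> i x\<bar>)" by (simp add: mult_ac)
        qed (intro cc_cmult cc_mult_right cce c2 continuous_intros cont_P)+
        also have "\<dots> = G * (\<integral>x. eta (tall N R L) x * \<bar>\<psi> i x\<bar> \<partial>lborel)" by (simp only: integral_mult_right_zero)
        also have "\<dots> \<le> G * (C1 * R * L)" by (intro mult_left_mono mass G_nonneg)
        finally show ?thesis .
      qed
      have 4: "R / L * (\<integral>x. eta (tall N R L) x * (\<psi> i x)^2 \<partial>lborel) \<le> G * C1 * R^2"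
      proof -
        have "R / L * (\<integral>x. eta (tall N R L) x * (\<psi> i x)^2 \<partial>lborel) \<le> R / L * (G * (C1 * R * L))"
          by (rule mult_left_mono[OF 3]) (use R L in auto)
        also have "\<dots> = G * C1 * R^2" using R L by (simp add: power2_eq_square)
        finally show ?thesis .
      qed
      have 5: "(\<integral>x. f' l x * (\<phi> i x * \<psi> i x) \<partial>lborel) \<le> 4 * bumpK * G * (2048 * bumpK * U * R^2)"
      proof -
        have "(\<integral>x. f' l x * (\<phi> i x * \<psi> i x) \<partial>lborel) \<le> (\<integral>x. 4 * bumpK * G * (eta ?s x * \<bar>\<phi> i x\<bar>) \<partial>lborel)"
        proof (rule cc_mono)
          fix x
          have "f' l x * (\<phi> i x * \<psi> i x) \<le> \<bar>f' l x\<bar> * (\<bar>\<phi> i x\<bar> * \<bar>\<psi> i x\<bar>)" by (metis abs_ge_self abs_mult)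
          also have "\<dots> \<le> (4 * bumpK * eta ?s x) * (\<bar>\<phi> i x\<bar> * G)"
            by (intro mult_mono fl mult_left_mono P_bound) (use bumpK(1) eta_range in \<open>auto intro!: mult_nonneg_nonneg\<close>)
          finally show "f' l x * (\<phi> i x * \<psi> i x) \<le> 4 * bumpK * G * (eta ?s x * \<bar>\<phi> i x\<bar>)" by (simp add: mult_ac)
        qed (intro cc_cmult cc_mult_right cce ccf continuous_intros cont_P)+
        also have "\<dots> = 4 * bumpK * G * (\<integral>x. eta ?s x * \<bar>\<phi> i x\<bar> \<partial>lborel)" by (simp only: integral_mult_right_zero)
        also have "\<dots> \<le> 4 * bumpK * G * (512 * bumpK * U * (2 * R)^2)"
          by (intro mult_left_mono mass_bound) (use R L bumpK(1) G_nonneg in auto)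
        finally show ?thesis by (simp add: power_mult_distrib)
      qed
      have 6: "(\<integral>x. f x * W i l x \<partial>lborel) \<le> 4 * R * (\<integral>x. eta ?r x * \<bar>W i l x\<bar> \<partial>lborel)"
      proof -
        have "(\<integral>x. f x * W i l x \<partial>lborel) \<le> (\<integral>x. 4 * R * (eta ?r x * \<bar>W i l x\<bar>) \<partial>lborel)"
        proof (rule cc_mono)
          fix x
          have "f x * W i l x \<le> \<bar>f x\<bar> * \<bar>W i l x\<bar>" by (metis abs_ge_self abs_mult)
          also have "\<dots> \<le> 4 * R * eta ?r x * \<bar>W i l x\<bar>" by (intro mult_right_mono fb) simp
          finally show "f x * W i l x \<le> 4 * R * (eta ?r x * \<bar>W i l x\<bar>)" by (simp add: mult_ac)
        qed (intro cc_cmult cc_mult_right cce ccf continuous_intros cont_W)+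
        then show ?thesis by (simp only: integral_mult_right_zero)
      qed
      have e: "(\<lambda>_. R) = tall N R R" by (simp add: tall_def fun_eq_iff)
      have "K * R^2 = G * C1 * R^2 + 4 * bumpK * G * (2048 * bumpK * U * R^2)" by (simp add: K_def algebra_simps)
      then show ?thesis unfolding e using 1 2 4 5 6 by linarith
    qed
    have "(\<Sum>i\<in>UNIV. \<integral>x. eta (\<lambda>_. R) x * (\<psi> i x)^2 \<partial>lborel)
        \<le> (\<Sum>i\<in>UNIV. K * R^2 + 4 * R * (\<integral>x. eta ?r x * \<bar>W i l x\<bar> \<partial>lborel))" by (intro sum_mono main)
    also have "\<dots> = m * (K * R^2) + 4 * R * (\<Sum>i\<in>UNIV. \<integral>x. eta ?r x * \<bar>W i l x\<bar> \<partial>lborel)"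
      by (simp only: sum.distrib sum_distrib_left sum_constant m_def)
    also have "\<dots> \<le> m * (K * R^2) * (2 * ln R) + 4 * R * (C2 * R * ln R)"
    proof (intro add_mono mult_left_mono flux)
      have "m * (K * R^2) * 1 \<le> m * (K * R^2) * (2 * ln R)" using lnR K by (intro mult_left_mono) (auto simp: m_def)
      then show "m * (K * R^2) \<le> m * (K * R^2) * (2 * ln R)" by simp
    qed (use R L in auto)
    also have "\<dots> = C * R^2 * ln R" by (simp add: C_def power2_eq_square algebra_simps)
    finally show ?thesis .
  qed
  moreover have "C \<ge> 0" using K C2 by (simp add: C_def m_def)
  ultimately show ?thesis by blast
qed

section \<open>The Liouville property\<close>

text \<open>The logarithmic cutoff of the Liouville argument, at a point \<open>x\<^sub>0\<close> in the box of size \<open>2 ^ p\<close>.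
  With weights \<open>1 / k\<close> on the dyadic cutoffs, the growth \<open>R\<^sup>2 ln R\<close> turns the gradient energy into
  the sum of \<open>(1 / k\<^sup>2) k\<close>, up to a constant. After division by the square of the sum of the weights
  it is of order \<open>1 / harm M\<close>.\<close>

lemma energy_zero: "E i x0 = 0"
proof -
  obtain C where C: "C \<ge> 0" and en: "\<And>R. R \<ge> 2 \<Longrightarrow> (\<Sum>i\<in>UNIV. \<integral>x. eta (\<lambda>_. R) x * (\<psi> i x)^2 \<partial>lborel) \<le> C * R^2 * ln R"
    using direction_energy by blast
  obtain p :: nat where p: "norm x0 < 2 ^ p" using real_arch_pow[of 2 "norm x0"] by auto
  define r :: "nat \<Rightarrow> 'b \<Rightarrow> real" where "r k = (\<lambda>_. 2 ^ k)" for k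
  have rp: "r k j > 0" for k j by (simp add: r_def)
  define K where "K = 96 * bumpK^2 * C * (real p + 2)"
  define J where "J = (\<integral>x. eta (r p) x * E i x \<partial>lborel)"
  have J: "J * harm M \<le> K" if M: "M \<ge> 1" for M
  proof -
    have H: "harm M > (0::real)" using M by (simp add: harm_pos)
    define w where "w k = 1 / (real k * harm M)" for k
    define \<xi> where "\<xi> x = (\<Sum>k\<in>{1..M}. w k * eta (r (p + k)) x)" for x
    define \<xi>' where "\<xi>' j x = (\<Sum>k\<in>{1..M}. w k * eta' (r (p + k)) j x)" for j x
    have g: "has_grad \<xi> \<xi>'"
      unfolding \<xi>_def[abs_def] \<xi>'_def[abs_def] by (intro has_grad_sum has_grad_cmult has_grad_eta) auto
    have cx: "cc \<xi>" unfolding \<xi>_def[abs_def] by (intro cc_sum cc_cmult cc_eta rp)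
    have b: "bounded {x. \<xi> x \<noteq> 0}" using cx by (simp add: cc_def)
    have cx': "cc (\<xi>' j)" for j using has_grad_cc[OF g b] by auto
    have sw: "(\<Sum>k\<in>{1..M}. w k) = 1"
    proof -
      have "(\<Sum>k\<in>{1..M}. w k) = (\<Sum>k\<in>{1..M}. inverse (real k)) / harm M"
        unfolding sum_divide_distrib by (intro sum.cong) (auto simp: w_def field_simps)
      then show ?thesis using H by (simp add: harm_def)
    qed
    have low: "eta (r p) x \<le> (\<xi> x)^2" for x
    proof (cases "eta (r p) x = 0")
      case False
      have "eta (r (p + k)) x = 1" if "k \<in> {1..M}" for k
      proof (rule eta_one[OF rp])
        fix j
        have "\<not> 2 * r p j \<le> \<bar>x $ j\<bar>" using eta_zero[of "r p" j x] rp False by blast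
        then have "\<bar>x $ j\<bar> \<le> 2 ^ (p + 1)" by (simp add: r_def)
        also have "\<dots> \<le> 2 ^ (p + k)" by (rule power_increasing) (use that in auto)
        finally show "\<bar>x $ j\<bar> \<le> r (p + k) j" by (simp add: r_def)
      qed
      then have "\<xi> x = 1" using sw by (simp add: \<xi>_def)
      then show ?thesis using eta_range by simp
    qed simp
    have grad: "(\<Sum>j\<in>UNIV. (\<xi>' j x)^2) \<le> (\<Sum>k\<in>{1..M}. 3 * (w k)^2 * (bumpK / 2 ^ (p + k))^2 * eta (\<lambda>_. 2 ^ (p + k + 1)) x)" for x
    proof -
      have e: "(\<xi>' j x)^2 \<le> (\<Sum>k\<in>{1..M}. (w k)^2 * (bumpK / 2 ^ (p + k))^2 * eta (\<lambda>_. 2 ^ (p + k + 1)) x)" for j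
      proof -
        have "(\<xi>' j x)^2 = (\<Sum>k\<in>{1..M}. (w k * eta' (r (p + k)) j x)^2)" unfolding \<xi>'_def
        proof (rule sum_square_disjoint)
          fix k k' :: nat assume "k \<noteq> k'"
          then have "eta' (r (p + k)) j x * eta' (r (p + k')) j x = 0"
            by (intro eta'_dyadic_disjoint[where B=1] rp) (auto simp: r_def)
          then show "w k * eta' (r (p + k)) j x * (w k' * eta' (r (p + k')) j x) = 0" by auto
        qed simp
        also have "\<dots> \<le> (\<Sum>k\<in>{1..M}. (w k)^2 * (bumpK / 2 ^ (p + k))^2 * eta (\<lambda>_. 2 ^ (p + k + 1)) x)"
        proof (rule sum_mono)
          fix k :: nat
          have "(eta' (r (p + k)) j x)^2 \<le> (bumpK / r (p + k) j)^2 * eta (\<lambda>_. 2 ^ (p + k + 1)) x"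
            by (rule eta'_square_bound[OF rp]) (simp add: r_def)
          then have "(w k)^2 * (eta' (r (p + k)) j x)^2 \<le> (w k)^2 * ((bumpK / r (p + k) j)^2 * eta (\<lambda>_. 2 ^ (p + k + 1)) x)"
            by (rule mult_left_mono) simp
          then show "(w k * eta' (r (p + k)) j x)^2 \<le> (w k)^2 * (bumpK / 2 ^ (p + k))^2 * eta (\<lambda>_. 2 ^ (p + k + 1)) x"
            by (simp add: power_mult_distrib r_def mult.assoc)
        qed
        finally show ?thesis .
      qed
      let ?S = "\<Sum>k\<in>{1..M}. (w k)^2 * (bumpK / 2 ^ (p + k))^2 * eta (\<lambda>_::'b. 2 ^ (p + k + 1)) x"
      have S0: "?S \<ge> 0" by (intro sum_nonneg mult_nonneg_nonneg eta_range) auto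
      have "(\<Sum>j\<in>UNIV. (\<xi>' j x)^2) \<le> (\<Sum>j\<in>(UNIV::'b set). ?S)" by (intro sum_mono e)
      also have "\<dots> = real CARD('b) * ?S" by simp
      also have "\<dots> \<le> 3 * ?S" using dim by (intro mult_right_mono S0) auto
      finally show ?thesis by (simp add: sum_distrib_left mult.assoc)
    qed
    have ce: "cc (eta (\<lambda>_::'b. 2 ^ k :: real))" for k by (rule cc_eta) simp
    have c2: "continuous_on S (\<lambda>x. (\<psi> i x)^2)" for S i by (intro continuous_intros cont_P)
    have "J \<le> (\<integral>x. (\<xi> x)^2 * E i x \<partial>lborel)" unfolding J_def
      by (rule cc_mono) (auto intro!: cc_mult_right cc_eta rp cont_E mult_right_mono low[unfolded power2_eq_square] E_nonneg cx cc_cont[OF cx] simp: power2_eq_square)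
    also have "\<dots> \<le> (\<Sum>i\<in>UNIV. \<integral>x. (\<xi> x)^2 * E i x \<partial>lborel)"
      by (rule member_le_sum) (auto intro!: cc_nonneg mult_nonneg_nonneg E_nonneg)
    also have "\<dots> \<le> 8 * (\<Sum>i\<in>UNIV. \<integral>x. (\<psi> i x)^2 * (\<Sum>k\<in>UNIV. (\<xi>' k x)^2) \<partial>lborel)"
      by (rule full_energy[OF g b])
    also have "\<dots> \<le> 8 * (\<Sum>i\<in>UNIV. \<Sum>k\<in>{1..M}. 3 * (w k)^2 * (bumpK / 2 ^ (p + k))^2 * (\<integral>x. eta (\<lambda>_. 2 ^ (p + k + 1)) x * (\<psi> i x)^2 \<partial>lborel))"
    proof (intro mult_left_mono sum_mono)
      fix i
      let ?t = "\<lambda>k x. 3 * (w k)^2 * (bumpK / 2 ^ (p + k))^2 * (eta (\<lambda>_. 2 ^ (p + k + 1)) x * (\<psi> i x)^2)"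
      have ct: "cc (?t k)" for k by (intro cc_cmult cc_mult_right ce c2)
      have "(\<integral>x. (\<psi> i x)^2 * (\<Sum>k\<in>UNIV. (\<xi>' k x)^2) \<partial>lborel) \<le> (\<integral>x. (\<Sum>k\<in>{1..M}. ?t k x) \<partial>lborel)"
      proof (rule cc_mono)
        show "cc (\<lambda>x. (\<psi> i x)^2 * (\<Sum>k\<in>UNIV. (\<xi>' k x)^2))"
          unfolding power2_eq_square by (intro cc_mult_left cc_sum cc_mult_right cx' cc_cont[OF cx'] continuous_intros cont_P)
        show "cc (\<lambda>x. \<Sum>k\<in>{1..M}. ?t k x)" by (intro cc_sum ct)
        fix x
        have "(\<psi> i x)^2 * (\<Sum>k\<in>UNIV. (\<xi>' k x)^2) \<le> (\<psi> i x)^2 * (\<Sum>k\<in>{1..M}. 3 * (w k)^2 * (bumpK / 2 ^ (p + k))^2 * eta (\<lambda>_. 2 ^ (p + k + 1)) x)"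
          by (intro mult_left_mono grad) simp
        then show "(\<psi> i x)^2 * (\<Sum>k\<in>UNIV. (\<xi>' k x)^2) \<le> (\<Sum>k\<in>{1..M}. ?t k x)"
          by (simp add: sum_distrib_left mult_ac)
      qed
      also have "\<dots> = (\<Sum>k\<in>{1..M}. \<integral>x. ?t k x \<partial>lborel)" by (intro integral_cc_sum ct)
      finally show "(\<integral>x. (\<psi> i x)^2 * (\<Sum>k\<in>UNIV. (\<xi>' k x)^2) \<partial>lborel)
          \<le> (\<Sum>k\<in>{1..M}. 3 * (w k)^2 * (bumpK / 2 ^ (p + k))^2 * (\<integral>x. eta (\<lambda>_. 2 ^ (p + k + 1)) x * (\<psi> i x)^2 \<partial>lborel))"
        by (simp only: integral_mult_right_zero)
    qed simp
    also have "\<dots> = 8 * (\<Sum>k\<in>{1..M}. 3 * (w k)^2 * (bumpK / 2 ^ (p + k))^2 * (\<Sum>i\<in>UNIV. \<integral>x. eta (\<lambda>_. 2 ^ (p + k + 1)) x * (\<psi> i x)^2 \<partial>lborel))"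
      by (subst sum.swap) (simp only: sum_distrib_left)
    also have "\<dots> \<le> 8 * (\<Sum>k\<in>{1..M}. 12 * bumpK^2 * C * (real p + 2) / harm M * w k)"
    proof (intro mult_left_mono sum_mono)
      fix k assume k: "k \<in> {1..M}"
      have "(\<Sum>i\<in>UNIV. \<integral>x. eta (\<lambda>_. 2 ^ (p + k + 1)) x * (\<psi> i x)^2 \<partial>lborel) \<le> C * (2 ^ (p + k + 1))^2 * ln (2 ^ (p + k + 1))"
      proof (rule en)
        show "(2::real) \<le> 2 ^ (p + k + 1)" using power_increasing[of 1 "p + k + 1" "2::real"] by simp
      qed
      also have "\<dots> \<le> C * (2 ^ (p + k + 1))^2 * ((real p + 2) * k)"
      proof (rule mult_left_mono)
        have "ln (2 ^ (p + k + 1) :: real) = real (p + k + 1) * ln 2" by (rule ln_realpow)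
        also have "\<dots> \<le> real (p + k + 1) * 1" using ln_le_minus_one[of "2::real"] by (intro mult_left_mono) auto
        also have "\<dots> \<le> (real p + 2) * k"
        proof -
          have "0 \<le> (real p + 1) * (real k - 1)" using k by (intro mult_nonneg_nonneg) auto
          then show ?thesis by (simp add: algebra_simps)
        qed
        finally show "ln (2 ^ (p + k + 1)) \<le> (real p + 2) * k" .
      qed (use C in simp)
      also have "\<dots> = 4 * C * (2 ^ (p + k))^2 * ((real p + 2) * k)" by (simp add: power2_eq_square)
      finally have "3 * (w k)^2 * (bumpK / 2 ^ (p + k))^2 * (\<Sum>i\<in>UNIV. \<integral>x. eta (\<lambda>_. 2 ^ (p + k + 1)) x * (\<psi> i x)^2 \<partial>lborel)
          \<le> 3 * (w k)^2 * (bumpK / 2 ^ (p + k))^2 * (4 * C * (2 ^ (p + k))^2 * ((real p + 2) * k))"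
        by (rule mult_left_mono) simp
      also have "\<dots> = 12 * bumpK^2 * C * (real p + 2) * ((w k)^2 * k)"
        by (simp add: power_divide)
      also have "(w k)^2 * k = w k / harm M" using k H by (simp add: w_def power2_eq_square field_simps)
      finally show "3 * (w k)^2 * (bumpK / 2 ^ (p + k))^2 * (\<Sum>i\<in>UNIV. \<integral>x. eta (\<lambda>_. 2 ^ (p + k + 1)) x * (\<psi> i x)^2 \<partial>lborel)
          \<le> 12 * bumpK^2 * C * (real p + 2) / harm M * w k" by simp
    qed simp
    also have "\<dots> = K / harm M" unfolding sum_distrib_left[symmetric] sw by (simp add: K_def)
    finally show ?thesis using H by (simp add: le_divide_eq)
  qed
  have "J \<le> 0"
  proof (rule ccontr)
    assume "\<not> J \<le> 0"
    then have Jp: "J > 0" by simp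
    have "\<forall>\<^sub>F M in sequentially. harm M > K / J"
      using harm_at_top by (auto simp: filterlim_at_top_dense)
    then obtain M where "M \<ge> 1" "harm M > K / J"
      using eventually_ge_at_top[of 1] by (metis (mono_tags, lifting) eventually_sequentially nle_le)
    then show False using J[of M] Jp by (simp add: divide_less_eq mult.commute)
  qed
  moreover have ccE: "cc (\<lambda>x. eta (r p) x * E i x)" by (intro cc_mult_right cc_eta rp cont_E)
  have nn: "0 \<le> eta (r p) x * E i x" for x by (intro mult_nonneg_nonneg eta_range E_nonneg)
  have "J \<ge> 0" unfolding J_def by (rule cc_nonneg[OF nn])
  ultimately have J0: "J = 0" by simp
  obtain a b where ab: "\<And>x. x \<notin> cbox a b \<Longrightarrow> eta (r p) x * E i x = 0" "box a b \<noteq> {}"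
  proof -
    have "bounded ({x. eta (r p) x * E i x \<noteq> 0} \<union> ball 0 1)" using ccE by (simp add: cc_def)
    then obtain a where a: "{x. eta (r p) x * E i x \<noteq> 0} \<union> ball 0 1 \<subseteq> cbox (-a) a" by (rule bounded_subset_cbox_symmetric)
    then have "ball 0 1 \<subseteq> interior (cbox (-a) a)" by (intro interior_maximal) auto
    then have "0 \<in> box (-a) a" by (simp add: interior_cbox subset_iff)
    then have "box (-a) a \<noteq> {}" by blast
    then show thesis using that[of "-a" a] a by blast
  qed
  have "integral (cbox a b) (\<lambda>x. eta (r p) x * E i x) = 0"
    using J0 cc_integrable_cbox(2)[OF cc_cont[OF ccE] ab(1)] unfolding J_def by simp
  then have "eta (r p) x0 * E i x0 = 0"
    using integral_cbox_eq_0_iff[of a b "\<lambda>x. eta (r p) x * E i x"] ab nn cc_cont[OF ccE] by blast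
  moreover have "eta (r p) x0 = 1"
  proof (rule eta_one[OF rp])
    fix j show "\<bar>x0 $ j\<bar> \<le> r p j" using component_le_norm_cart[of x0 j] p by (simp add: r_def)
  qed
  ultimately show ?thesis by simp
qed

lemma quotient_constant: "\<exists>b. \<forall>x. \<psi> i x = b * \<phi> i x"
proof -
  have s0: "\<sigma>' i k x = 0" for k x
  proof -
    have "(\<phi> i x)^2 * (\<Sum>k\<in>UNIV. (\<sigma>' i k x)^2) = 0" using energy_zero[of i x] by (simp add: E_def)
    then have "(\<Sum>k\<in>UNIV. (\<sigma>' i k x)^2) = 0" using monotone by simp
    then show ?thesis by (subst (asm) sum_nonneg_eq_0_iff) auto
  qed
  have "\<exists>b. \<forall>x\<in>UNIV. \<sigma> i x = b"
  proof (rule has_derivative_zero_constant)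
    fix x show "(\<sigma> i has_derivative (\<lambda>h. 0)) (at x within UNIV)" using has_gradD[OF grad_\<sigma>, of i x] by (simp add: s0)
  qed simp
  then obtain b where "\<And>x. \<sigma> i x = b" by blast
  then show ?thesis by (intro exI[of _ b]) (simp add: \<psi>_eq mult.commute)
qed

end

section \<open>Level sets\<close>

lemma C_2_grad:
  assumes "C_k 2 f"
  shows "has_grad f (\<lambda>i. partial_deriv i f)"
    and "has_grad (partial_deriv i f) (\<lambda>j. partial_deriv j (partial_deriv i f))"
proof -
  have C: "C_k (Suc (Suc 0)) f" using assms by (simp only: numeral_2_eq_2)
  then show "has_grad f (\<lambda>i. partial_deriv i f)" by (rule C_k_Suc_has_grad)
  have "C_k (Suc 0) (partial_deriv i f)" using C C_k.simps(2)[of "Suc 0" f] by blast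
  then show "has_grad (partial_deriv i f) (\<lambda>j. partial_deriv j (partial_deriv i f))" by (rule C_k_Suc_has_grad)
qed

lemma continuous_on_components:
  fixes u :: "'a::topological_space \<Rightarrow> real^'m::finite"
  assumes "\<And>j. continuous_on S (\<lambda>x. u x $ j)" shows "continuous_on S u"
  using continuous_on_vec_lambda[of S "\<lambda>j x. u x $ j"] assms by simp

lemma has_grad_compose_vector:
  fixes u :: "real^'n::finite \<Rightarrow> real^'m::finite"
  assumes F: "has_grad F F'" and u: "\<And>j. has_grad (\<lambda>x. u x $ j) (u' j)"
  shows "has_grad (\<lambda>x. F (u x)) (\<lambda>k x. \<Sum>j\<in>UNIV. F' j (u x) * u' j k x)"
proof (rule has_gradI)
  have cu: "continuous_on UNIV u" by (rule continuous_on_components[OF has_grad_continuous[OF u]])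
  show "continuous_on UNIV (\<lambda>x. \<Sum>j\<in>UNIV. F' j (u x) * u' j k x)" for k
    by (intro continuous_intros has_grad_cont_grad[OF u] continuous_on_compose2[OF has_grad_cont_grad[OF F, of UNIV] cu]) auto
  fix x
  let ?u' = "\<lambda>h. \<chi> j. \<Sum>k\<in>UNIV. u' j k x * h $ k"
  have d: "(u has_derivative ?u') (at x)"
  proof (subst has_derivative_componentwise_within, rule ballI)
    fix e :: "real^'m" assume "e \<in> Basis"
    then obtain j where "e = axis j 1" by (auto simp: Basis_vec_def)
    then show "((\<lambda>x. u x \<bullet> e) has_derivative (\<lambda>h. ?u' h \<bullet> e)) (at x)"
      using has_gradD[OF u[of j], of x] by (simp add: inner_axis)
  qed
  have eq: "(\<Sum>j\<in>UNIV. F' j (u x) * ?u' h $ j) = (\<Sum>k\<in>UNIV. (\<Sum>j\<in>UNIV. F' j (u x) * u' j k x) * h $ k)" for h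
    unfolding sum_distrib_right by (subst sum.swap) (simp add: sum_distrib_left mult.assoc)
  show "((\<lambda>x. F (u x)) has_derivative (\<lambda>h. \<Sum>k\<in>UNIV. (\<Sum>j\<in>UNIV. F' j (u x) * u' j k x) * h $ k)) (at x)"
    by (rule has_derivative_eq_rhs[OF has_derivative_compose[OF d has_gradD[OF F]]]) (rule ext, rule eq)
qed

text \<open>The range of \<open>u\<close> has compact closure, on which continuous functions are bounded; the sum of the
  bounds of finitely many of them is a common bound.\<close>

lemma bounded_composition:
  fixes u :: "'a \<Rightarrow> 'b::euclidean_space" and g :: "'k::finite \<Rightarrow> 'b \<Rightarrow> real"
  assumes "\<And>i. continuous_on UNIV (g i)" "bounded (range u)"
  shows "\<exists>B. \<forall>i x. \<bar>g i (u x)\<bar> \<le> B"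
proof -
  have "\<exists>B. \<forall>x. \<bar>g i (u x)\<bar> \<le> B" for i
  proof -
    have "compact (g i ` closure (range u))"
      by (rule compact_continuous_image) (use assms in \<open>auto intro: continuous_on_subset simp: compact_closure\<close>)
    then obtain B where "\<forall>y\<in>g i ` closure (range u). norm y \<le> B"
      using compact_imp_bounded bounded_iff by blast
    moreover have "u x \<in> closure (range u)" for x by (rule subsetD[OF closure_subset]) simp
    ultimately show ?thesis by (intro exI[of _ B]) auto
  qed
  then obtain B where B: "\<And>i x. \<bar>g i (u x)\<bar> \<le> B i" by metis
  have "\<bar>g i (u x)\<bar> \<le> (\<Sum>i\<in>UNIV. B i)" for i x
  proof -
    have "0 \<le> B j" for j using B[of j x] by linarith
    then have "B i \<le> (\<Sum>i\<in>UNIV. B i)" by (intro member_le_sum) auto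
    then show ?thesis using B[of i x] by linarith
  qed
  then show ?thesis by blast
qed

text \<open>Along the segment from \<open>x\<^sub>0\<close> to \<open>x\<close> the derivative of \<open>v\<close> is \<open>\<rho>\<close> times the constant
  \<open>b \<bullet> (x - x\<^sub>0)\<close>. By the mean value theorem \<open>v x = v x\<^sub>0\<close> exactly when this constant vanishes.\<close>

lemma level_set_hyperplane:
  fixes v :: "real^'n::finite \<Rightarrow> real"
  assumes g: "has_grad v g" and b: "\<And>k x. g k x = b $ k * \<rho> x" and \<rho>: "\<And>x. \<rho> x \<noteq> 0" and "b \<noteq> 0"
    and c: "c \<in> range v"
  shows "hyperplane {x. v x = c}"
proof -
  obtain x0 where x0: "v x0 = c" using c by auto
  have "v x = c \<longleftrightarrow> b \<bullet> x = b \<bullet> x0" for x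
  proof -
    have d: "((\<lambda>t. v (x0 + t *\<^sub>R (x - x0))) has_real_derivative \<rho> (x0 + t *\<^sub>R (x - x0)) * (b \<bullet> (x - x0))) (at t)" for t
      using has_grad_line[OF g, of x0 "x - x0" t] unfolding b
      by (simp add: inner_vec_def sum_distrib_left mult_ac)
    from MVT2[of 0 1, OF _ this]
    obtain z where "v (x0 + 1 *\<^sub>R (x - x0)) - v (x0 + 0 *\<^sub>R (x - x0)) = (1 - 0) * (\<rho> (x0 + z *\<^sub>R (x - x0)) * (b \<bullet> (x - x0)))"
      by auto
    then have "v x - c = \<rho> (x0 + z *\<^sub>R (x - x0)) * (b \<bullet> (x - x0))" by (simp add: x0)
    then have "v x = c \<longleftrightarrow> b \<bullet> (x - x0) = 0" using \<rho>[of "x0 + z *\<^sub>R (x - x0)"] by auto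
    then show ?thesis by (simp add: inner_diff_right)
  qed
  then have "{x. v x = c} = {x. b \<bullet> x = b \<bullet> x0}" by simp
  then show ?thesis unfolding hyperplane_def using \<open>b \<noteq> 0\<close> by blast
qed

theorem theorem5:
  fixes H :: "real^'m::{finite,linorder} \<Rightarrow> real"
    and u :: "real^'n::{finite,linorder} \<Rightarrow> real^'m::{finite,linorder}"
  assumes "CARD('n) \<le> 3"
    and "C_k 2 H"
    and "bounded (range u)"
    and "classical_solution H u"
    and "H_monotone H u"
  shows "\<forall>i. \<forall>c \<in> range (\<lambda>x. u x $ i). hyperplane {x. u x $ i = c}"
proof (intro allI ballI)
  fix i c assume c: "c \<in> range (\<lambda>x. u x $ i)"
  let ?N = "Max UNIV :: 'n"
  define v where "v i = (\<lambda>x. u x $ i)" for i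
  define P where "P i k = partial_deriv k (v i)" for i k
  define D where "D i k l = partial_deriv l (P i k)" for i k l
  define h where "h i j = partial_deriv j (partial_deriv i H)" for i j
  have C2: "C_k 2 (v i)" for i using assms(4) by (simp add: classical_solution_def v_def)
  have gv: "has_grad (v i) (P i)" for i using C_2_grad(1)[OF C2] by (simp add: P_def[abs_def])
  have gP: "has_grad (P i k) (D i k)" for i k using C_2_grad(2)[OF C2] by (simp add: P_def D_def[abs_def])
  have gH: "has_grad H (\<lambda>i. partial_deriv i H)" by (rule C_2_grad(1)[OF assms(2)])
  have gH2: "has_grad (partial_deriv i H) (h i)" for i using C_2_grad(2)[OF assms(2)] by (simp add: h_def[abs_def])
  have hs: "h i j y = h j i y" for i j y by (rule has_grad_symmetric[OF gH gH2])
  have gu: "has_grad (\<lambda>x. u x $ j) (P j)" for j using gv[of j] by (simp add: v_def)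
  have cu: "continuous_on UNIV u" by (rule continuous_on_components[OF has_grad_continuous[OF gu]])
  obtain U where U: "\<And>i x. \<bar>v i x\<bar> \<le> U"
    using bounded_composition[of "\<lambda>i y. y $ i" u, OF has_grad_continuous[OF has_grad_nth] assms(3)] unfolding v_def by blast
  obtain F where F: "\<And>i x. \<bar>partial_deriv i H (u x)\<bar> \<le> F"
    using bounded_composition[of "\<lambda>i. partial_deriv i H" u] assms(3) has_grad_continuous[OF gH2] by blast
  have "continuous_on UNIV (case p of (i, j) \<Rightarrow> h i j)" for p
    by (cases p) (simp add: has_grad_cont_grad[OF gH2])
  from bounded_composition[of "\<lambda>p. case p of (i, j) \<Rightarrow> h i j", OF this assms(3)]
  obtain \<Lambda> where \<Lambda>: "\<And>p x. \<bar>(case p of (i, j) \<Rightarrow> h i j) (u x)\<bar> \<le> \<Lambda>" by blast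
  have mono: "P i ?N x \<noteq> 0" for i x
    using assms(5) by (simp add: H_monotone_def partial_last_def P_def v_def)
  have lt: "h i j (u x) * P i ?N x * P j ?N x \<le> 0" if "i < j" for i j x
    using assms(5) that by (simp add: H_monotone_def partial_last_def P_def v_def h_def)
  interpret monotone_system v P D "\<lambda>i x. partial_deriv i H (u x)" "\<lambda>i j x. h i j (u x)" ?N U F \<Lambda>
  proof
    show "D i k l x = D i l k x" for i k l x by (rule has_grad_symmetric[OF gv gP])
    show "(\<Sum>k\<in>UNIV. D i k k x) = partial_deriv i H (u x)" for i x
      using assms(4) by (simp add: classical_solution_def laplacian_def D_def P_def v_def)
    show "has_grad (\<lambda>x. partial_deriv i H (u x)) (\<lambda>k x. \<Sum>j\<in>UNIV. h i j (u x) * P j k x)" for i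
      by (rule has_grad_compose_vector[OF gH2 gu])
    show "continuous_on UNIV (\<lambda>x. h i j (u x))" for i j
      by (rule continuous_on_compose2[OF has_grad_cont_grad[OF gH2, of UNIV] cu]) simp
    show "h i j (u x) * P i ?N x * P j ?N x \<le> 0" if "i \<noteq> j" for i j x
      using that lt[of i j x] lt[of j i x] by (cases "i < j") (auto simp: hs[of j i] mult_ac)
    show "\<bar>h i j (u x)\<bar> \<le> \<Lambda>" for i j x using \<Lambda>[of "(i, j)" x] by simp
    show "h i j (u x) = h j i (u x)" for i j x by (rule hs)
  qed (rule gv gP F U mono assms(1))+
  have "\<exists>b. \<forall>x. P i l x = b * P i ?N x" for l
  proof (cases "l = ?N")
    case False
    then interpret monotone_system_dir v P D "\<lambda>i x. partial_deriv i H (u x)" "\<lambda>i j x. h i j (u x)" ?N U F \<Lambda> l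
      by unfold_locales
    show ?thesis by (rule quotient_constant)
  qed (intro exI[of _ 1], simp)
  then obtain b where b: "\<And>l x. P i l x = b l * P i ?N x" by metis
  have bN: "b ?N = 1" using b[of ?N 0] mono[of i 0] by simp
  show "hyperplane {x. u x $ i = c}"
  proof (rule level_set_hyperplane[OF gu])
    show "P i k x = (\<chi> l. b l) $ k * P i ?N x" for k x using b[of k x] by simp
    have "(\<chi> l. b l) $ ?N \<noteq> 0" using bN by simp
    then show "(\<chi> l. b l) \<noteq> 0" by (metis zero_index)
  qed (rule mono c)+
qed

end
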